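(* Let $n\ge3$, $\tau>0$, let $s$ be an integer with $s_0:=[\tfrac{2s-n}{4}]\ge[n/2]+2$, and let $(\psi,v,w,\eta)$ be a sufficiently smooth solution of the system below on $[0,T]$. Then for all integers $\kappa\ge1$, $j\ge0$ and all $t\in[0,T]$, $$\int_0^t(1+\sigma)^{j-1/2}\mathbf{R}_\kappa(\sigma)d\sigma\lesssim\mathcal{M}[v,w,U](t)\Big(\Upsilon^{(j,\kappa)}(t)+\int_0^t(1+\sigma)^{j-3/2}\mathbf{D}^{(\kappa-1)}(\sigma)d\sigma\Big),$$ with implicit constant independent of $t$.
   Context: Parameters $c,b>0$, $k\in\mathbb{R}$; kernel $g$ on $(0,\infty)$: $g\in W^{1,1}$, $g\ge0$, $c_g^2:=c^2-\int_0^\infty g\,dr>0$, $g'\le-\zeta g$ ($\zeta>0$), $g''\ge0$ a.e. System on $\mathbb{R}^n$: $\psi_t=v$, $v_t=w$, $\tau w_t=-w+c_g^2\Delta\psi+b\Delta v+\int_0^\infty g(r)\Delta\eta(r)\,dr+2k(vw+\nabla\psi\cdot\nabla v)$, $\eta_t=v-\eta_r$, $\eta(r=0)=0$. For $h\in\{g,-g'\}$, $\|f\|_{H^m,h}^2=\int_0^\infty h(r)\|f(r)\|_{H^m}^2dr$. Energies: $\mathbf{E}^{(\kappa)}=\|\nabla^{\kappa+1}(\psi+\tau v)\|_{L^2}^2+\|\nabla^\kappa(v+\tau w)\|_{L^2}^2+\|\nabla^{\kappa+1}v\|_{L^2}^2+\|\nabla^{\kappa+1}\eta\|_{L^2,-g'}^2+\|\Delta\nabla^\kappa\eta\|_{H^1,-g'}^2+\|\Delta\nabla^\kappa(\psi+\tau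 v)\|_{H^1}^2+\|\nabla^{\kappa+1}(v+\tau w)\|_{H^1}^2+\|\Delta\nabla^\kappa v\|_{H^1}^2+\|\nabla^\kappa w\|_{L^2}^2$; $\mathbf{D}^{(\kappa)}=\|\nabla^{\kappa+1}\eta\|_{H^2,-g'}^2+\|\Delta\nabla^\kappa\eta\|_{H^1,-g'}^2+\|\Delta\nabla^\kappa(\psi+\tau v)\|_{L^2}^2+\|\nabla^{\kappa+1}(v+\tau w)\|_{L^2}^2+\|\nabla^{\kappa+1}v\|_{L^2}^2+\|\Delta\nabla^\kappa v\|_{L^2}^2+\|\nabla^\kappa w\|_{L^2}^2$; $\Upsilon^{(j,\kappa)}(t)=\int_0^t(1+\sigma)^{j-3/2}\mathbf{E}^{(\kappa)}d\sigma+\int_0^t(1+\sigma)^{j-1/2}\mathbf{D}^{(\kappa)}d\sigma$. $F^{(\kappa)}=\nabla^\kappa\big(2k(vw+\nabla\psi\cdot\nabla v)\big)$, $R^{(1)}_\kappa(\varphi)=(F^{(\kappa)},\varphi)_{L^2}$, $R^{(2)}_\kappa(\varphi)=(\nabla F^{(\kappa)},\nabla\varphi)_{L^2}$, $\mathbf{R}_\kappa=|R^{(2)}_\kappa(\tau\nabla^\kappa v)|+|R^{(2)}_\kappa(\nabla^\kappa(\psi+\tau v))|+|R^{(1)}_\kappa(\nabla^\kappa w)|+|R^{(1)}_\kappa(\nabla^\kappa(v+\tau w))|+|R^{(2)}_\kappa(\nabla^\kappa(v+\tau w))|+|R^{(2)}_{\kappa+1}(\nabla^{\kappa+1}(v+\tau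 w))|$. $U=(v+\tau w,\nabla(\psi+\tau v),\nabla v)^T$; $\mathcal{M}[v,w,U](t)=\sum_{j=0}^{s_0}\sup_{0\le\sigma\le t}(1+\sigma)^{n/4+j/2}\|\nabla^jU(\sigma)\|_{L^2}+\sum_{j=0}^{s_0-1}\sup_{0\le\sigma\le t}\big[(1+\sigma)^{n/4+j/2}\|\nabla^jv(\sigma)\|_{L^2}+(1+\sigma)^{n/4+1/2+j/2}\|\nabla^jw(\sigma)\|_{L^2}\big]$. *)

theory Defs
  imports "HOL-Analysis.Analysis"
begin

definition pd :: "'n::finite \<Rightarrow> (real^'n \<Rightarrow> real) \<Rightarrow> real^'n \<Rightarrow> real" where
  "pd i f x = deriv (\<lambda>h. f (x + h *\<^sub>R axis i 1)) 0"

fun pdl :: "'n::finite list \<Rightarrow> (real^'n \<Rightarrow> real) \<Rightarrow> real^'n \<Rightarrow> real" where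
  "pdl [] f = f"
| "pdl (i # \<alpha>) f = pd i (pdl \<alpha> f)"

definition lap :: "(real^'n::finite \<Rightarrow> real) \<Rightarrow> real^'n \<Rightarrow> real" where
  "lap f x = (\<Sum>i\<in>UNIV. pdl [i, i] f x)"

definition mind :: "nat \<Rightarrow> 'n::finite list set" where
  "mind k = {\<alpha>. length \<alpha> = k}"

definition Lsq :: "(real^'n::finite \<Rightarrow> real) \<Rightarrow> real" where
  "Lsq f = (LINT x|lborel. (f x)\<^sup>2)"

definition gsq :: "nat \<Rightarrow> (real^'n::finite \<Rightarrow> real) \<Rightarrow> real" where
  "gsq k f = (\<Sum>\<alpha>\<in>mind k. Lsq (pdl \<alpha> f))"

definition lapsq :: "nat \<Rightarrow> nat \<Rightarrow> (real^'n::finite \<Rightarrow> real) \<Rightarrow> real" where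
  "lapsq l k f = (\<Sum>\<alpha>\<in>mind k. gsq l (lap (pdl \<alpha> f)))"

definition ipk :: "nat \<Rightarrow> (real^'n::finite \<Rightarrow> real) \<Rightarrow> (real^'n \<Rightarrow> real) \<Rightarrow> real" where
  "ipk k G f = (\<Sum>\<alpha>\<in>mind k. LINT x|lborel. pdl \<alpha> G x * pdl \<alpha> f x)"

text \<open>Weighted norm in the memory variable: int_0^infty h(r) F(r) dr (F(r) a squared norm).\<close>
definition wsq :: "(real \<Rightarrow> real) \<Rightarrow> (real \<Rightarrow> real) \<Rightarrow> ennreal" where
  "wsq h F = (\<integral>\<^sup>+ r\<in>{0<..}. ennreal (h r * F r) \<partial>lborel)"

definition Efun ::
  "real \<Rightarrow> (real \<Rightarrow> real) \<Rightarrow> nat \<Rightarrow> (real \<Rightarrow> real^'n::finite \<Rightarrow> real) \<Rightarrow> (real \<Rightarrow> real^'n \<Rightarrow> real)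
    \<Rightarrow> (real \<Rightarrow> real^'n \<Rightarrow> real) \<Rightarrow> (real \<Rightarrow> real \<Rightarrow> real^'n \<Rightarrow> real) \<Rightarrow> real \<Rightarrow> ennreal" where
  "Efun \<tau> g1 \<kappa> \<psi> v w \<eta> t =
    (let P = (\<lambda>x. \<psi> t x + \<tau> * v t x); Q = (\<lambda>x. v t x + \<tau> * w t x) in
       ennreal (gsq (\<kappa>+1) P) + ennreal (gsq \<kappa> Q) + ennreal (gsq (\<kappa>+1) (v t))
     + wsq (\<lambda>r. - g1 r) (\<lambda>r. gsq (\<kappa>+1) (\<eta> t r))
     + wsq (\<lambda>r. - g1 r) (\<lambda>r. lapsq 0 \<kappa> (\<eta> t r) + lapsq 1 \<kappa> (\<eta> t r))
     + ennreal (lapsq 0 \<kappa> P + lapsq 1 \<kappa> P)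
     + ennreal (gsq (\<kappa>+1) Q + gsq (\<kappa>+2) Q)
     + ennreal (lapsq 0 \<kappa> (v t) + lapsq 1 \<kappa> (v t))
     + ennreal (gsq \<kappa> (w t)))"

definition Dfun ::
  "real \<Rightarrow> (real \<Rightarrow> real) \<Rightarrow> nat \<Rightarrow> (real \<Rightarrow> real^'n::finite \<Rightarrow> real) \<Rightarrow> (real \<Rightarrow> real^'n \<Rightarrow> real)
    \<Rightarrow> (real \<Rightarrow> real^'n \<Rightarrow> real) \<Rightarrow> (real \<Rightarrow> real \<Rightarrow> real^'n \<Rightarrow> real) \<Rightarrow> real \<Rightarrow> ennreal" where
  "Dfun \<tau> g1 \<kappa> \<psi> v w \<eta> t =
    (let P = (\<lambda>x. \<psi> t x + \<tau> * v t x); Q = (\<lambda>x. v t x + \<tau> * w t x) in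
       wsq (\<lambda>r. - g1 r) (\<lambda>r. gsq (\<kappa>+1) (\<eta> t r) + gsq (\<kappa>+2) (\<eta> t r) + gsq (\<kappa>+3) (\<eta> t r))
     + wsq (\<lambda>r. - g1 r) (\<lambda>r. lapsq 0 \<kappa> (\<eta> t r) + lapsq 1 \<kappa> (\<eta> t r))
     + ennreal (lapsq 0 \<kappa> P)
     + ennreal (gsq (\<kappa>+1) Q)
     + ennreal (gsq (\<kappa>+1) (v t))
     + ennreal (lapsq 0 \<kappa> (v t))
     + ennreal (gsq \<kappa> (w t)))"

definition Nl :: "real \<Rightarrow> (real \<Rightarrow> real^'n::finite \<Rightarrow> real) \<Rightarrow> (real \<Rightarrow> real^'n \<Rightarrow> real)
    \<Rightarrow> (real \<Rightarrow> real^'n \<Rightarrow> real) \<Rightarrow> real \<Rightarrow> real^'n \<Rightarrow> real" where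
  "Nl k \<psi> v w t x = 2 * k * (v t x * w t x + (\<Sum>i\<in>UNIV. pd i (\<psi> t) x * pd i (v t) x))"

text \<open>Bold R_kappa: R^(1)_kappa(nabla^kappa f) = ipk kappa G f, R^(2)_kappa(nabla^kappa f) = ipk (kappa+1) G f.\<close>
definition Rfun :: "real \<Rightarrow> real \<Rightarrow> nat \<Rightarrow> (real \<Rightarrow> real^'n::finite \<Rightarrow> real) \<Rightarrow> (real \<Rightarrow> real^'n \<Rightarrow> real)
    \<Rightarrow> (real \<Rightarrow> real^'n \<Rightarrow> real) \<Rightarrow> real \<Rightarrow> real" where
  "Rfun \<tau> k \<kappa> \<psi> v w t =
    (let G = Nl k \<psi> v w t; P = (\<lambda>x. \<psi> t x + \<tau> * v t x); Q = (\<lambda>x. v t x + \<tau> * w t x) in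
       \<bar>ipk (\<kappa>+1) G (\<lambda>x. \<tau> * v t x)\<bar> + \<bar>ipk (\<kappa>+1) G P\<bar> + \<bar>ipk \<kappa> G (w t)\<bar>
     + \<bar>ipk \<kappa> G Q\<bar> + \<bar>ipk (\<kappa>+1) G Q\<bar> + \<bar>ipk (\<kappa>+2) G Q\<bar>)"

text \<open>Squared L2 norm of nabla^j U, U = (v + tau w, grad(psi + tau v), grad v).\<close>
definition Usq :: "real \<Rightarrow> nat \<Rightarrow> (real \<Rightarrow> real^'n::finite \<Rightarrow> real) \<Rightarrow> (real \<Rightarrow> real^'n \<Rightarrow> real)
    \<Rightarrow> (real \<Rightarrow> real^'n \<Rightarrow> real) \<Rightarrow> real \<Rightarrow> real" where
  "Usq \<tau> j \<psi> v w t = gsq j (\<lambda>x. v t x + \<tau> * w t x) + gsq (j+1) (\<lambda>x. \<psi> t x + \<tau> * v t x)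
     + gsq (j+1) (v t)"

definition Mfun :: "real \<Rightarrow> nat \<Rightarrow> (real \<Rightarrow> real^'n::finite \<Rightarrow> real) \<Rightarrow> (real \<Rightarrow> real^'n \<Rightarrow> real)
    \<Rightarrow> (real \<Rightarrow> real^'n \<Rightarrow> real) \<Rightarrow> real \<Rightarrow> ennreal" where
  "Mfun \<tau> s0 \<psi> v w t =
     (\<Sum>j\<in>{0..s0}. SUP \<sigma>\<in>{0..t}.
         ennreal ((1+\<sigma>) powr (CARD('n)/4 + j/2) * sqrt (Usq \<tau> j \<psi> v w \<sigma>)))
   + (\<Sum>j\<in>{0..<s0}. SUP \<sigma>\<in>{0..t}.
         ennreal ((1+\<sigma>) powr (CARD('n)/4 + j/2) * sqrt (gsq j (v \<sigma>))
                + (1+\<sigma>) powr (CARD('n)/4 + 1/2 + j/2) * sqrt (gsq j (w \<sigma>))))"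

text \<open>Kernel assumptions; g1 is the (weak) derivative g' of g, taken as its monotone
  representative (g'' >= 0 a.e.).\<close>
definition kernel_ok :: "real \<Rightarrow> real \<Rightarrow> (real \<Rightarrow> real) \<Rightarrow> (real \<Rightarrow> real) \<Rightarrow> bool" where
  "kernel_ok c \<zeta> g g1 \<longleftrightarrow>
     set_integrable lborel {0<..} g \<and> set_integrable lborel {0<..} g1
   \<and> (\<forall>a b. 0 < a \<longrightarrow> a \<le> b \<longrightarrow> g b - g a = integral {a..b} g1)
   \<and> (\<forall>r>0. g r \<ge> 0)
   \<and> c\<^sup>2 - (LBINT r:{0<..}. g r) > 0
   \<and> \<zeta> > 0 \<and> (\<forall>r>0. g1 r \<le> - \<zeta> * g r)
   \<and> mono_on {0<..} g1"

definition all_partials :: "(real^'n::finite \<Rightarrow> real) \<Rightarrow> bool" where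
  "all_partials f \<longleftrightarrow> (\<forall>\<alpha> i x.
      ((\<lambda>h. pdl \<alpha> f (x + h *\<^sub>R axis i 1)) has_real_derivative pdl (i # \<alpha>) f x) (at 0))"

definition sq_int_from :: "nat \<Rightarrow> (real^'n::finite \<Rightarrow> real) \<Rightarrow> bool" where
  "sq_int_from m f \<longleftrightarrow> (\<forall>\<alpha>. length \<alpha> \<ge> m \<longrightarrow>
      pdl \<alpha> f \<in> borel_measurable lborel \<and> integrable lborel (\<lambda>x. (pdl \<alpha> f x)\<^sup>2))"

definition smooth_solution ::
  "real \<Rightarrow> real \<Rightarrow> real \<Rightarrow> real \<Rightarrow> (real \<Rightarrow> real) \<Rightarrow> real
   \<Rightarrow> (real \<Rightarrow> real^'n::finite \<Rightarrow> real) \<Rightarrow> (real \<Rightarrow> real^'n \<Rightarrow> real)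
   \<Rightarrow> (real \<Rightarrow> real^'n \<Rightarrow> real) \<Rightarrow> (real \<Rightarrow> real \<Rightarrow> real^'n \<Rightarrow> real) \<Rightarrow> bool" where
  "smooth_solution c b k \<tau> g T \<psi> v w \<eta> \<longleftrightarrow>
     (\<forall>t\<in>{0..T}.
        all_partials (\<psi> t) \<and> all_partials (v t) \<and> all_partials (w t)
      \<and> sq_int_from 1 (\<psi> t) \<and> sq_int_from 0 (v t) \<and> sq_int_from 0 (w t)
      \<and> (\<forall>r>0. all_partials (\<eta> t r) \<and> sq_int_from 1 (\<eta> t r)))
   \<and> (\<forall>\<alpha>. continuous_on ({0..T} \<times> UNIV) (\<lambda>(t,x). pdl \<alpha> (\<psi> t) x)
         \<and> continuous_on ({0..T} \<times> UNIV) (\<lambda>(t,x). pdl \<alpha> (v t) x)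
         \<and> continuous_on ({0..T} \<times> UNIV) (\<lambda>(t,x). pdl \<alpha> (w t) x)
         \<and> continuous_on ({0..T} \<times> {0<..} \<times> UNIV) (\<lambda>(t,r,x). pdl \<alpha> (\<eta> t r) x))
   \<and> (\<forall>t\<in>{0..T}. \<forall>x.
        ((\<lambda>s. \<psi> s x) has_real_derivative v t x) (at t within {0..T})
      \<and> ((\<lambda>s. v s x) has_real_derivative w t x) (at t within {0..T})
      \<and> set_integrable lborel {0<..} (\<lambda>r. g r * lap (\<eta> t r) x)
      \<and> (\<exists>wt. ((\<lambda>s. w s x) has_real_derivative wt) (at t within {0..T})
          \<and> \<tau> * wt = - w t x + (c\<^sup>2 - (LBINT r:{0<..}. g r)) * lap (\<psi> t) x + b * lap (v t) x
                     + (LBINT r:{0<..}. g r * lap (\<eta> t r) x)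
                     + 2 * k * (v t x * w t x + (\<Sum>i\<in>UNIV. pd i (\<psi> t) x * pd i (v t) x)))
      \<and> \<eta> t 0 x = 0 \<and> ((\<lambda>r. \<eta> t r x) \<longlongrightarrow> 0) (at_right 0)
      \<and> (\<forall>r>0. \<exists>et er. ((\<lambda>s. \<eta> s r x) has_real_derivative et) (at t within {0..T})
                    \<and> ((\<lambda>\<rho>. \<eta> t \<rho> x) has_real_derivative er) (at r)
                    \<and> et = v t x - er))"

end

theory Submission
  imports Defs
begin

text \<open>
  At each time \<sigma> all four factors v, w, \<nabla>\<psi>, \<nabla>v of the nonlinearity are bounded in sup norm by a
  multiple of S = m / (1 + \<sigma>), where m is the integrand of M at time \<sigma>: a Sobolev inequality on cubes
  of side comparable to (1 + \<sigma>)^(1/2) turns the decay rates n/4 + j/2 of the L2 norms into the rate n/2,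
  and n/2 \<ge> 1. Moser's product estimate then bounds the L2 norm of \<nabla>^l of the nonlinearity, for l
  between \<kappa> and \<kappa> + 2, by S times L2 norms of \<nabla>^l v, \<nabla>^l w, \<nabla>^(l+1) \<psi>, \<nabla>^(l+1) v.
  All of these are controlled by the energy of level \<kappa>, except for \<nabla>^\<kappa> v, which is part of the
  dissipation of level \<kappa> - 1. Hence R is at most C m (1 + \<sigma>)^(-1) (E + D), which is integrated in time.

  Moser's estimate rests on the interpolation of the norm of \<nabla>^i f in L^(2l/i) between the sup norm of f
  and the L2 norm of \<nabla>^l f, obtained from one integration by parts and Young's inequality.
\<close>

section \<open>Iterated partial derivatives\<close>


definition smooth_fun :: "(real^'n::finite \<Rightarrow> real) \<Rightarrow> bool" where
  "smooth_fun f \<longleftrightarrow> all_partials f \<and> (\<forall>\<alpha>. continuous_on UNIV (pdl \<alpha> f))"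

definition Hinf :: "(real^'n::finite \<Rightarrow> real) \<Rightarrow> bool" where
  "Hinf f \<longleftrightarrow> smooth_fun f \<and> (\<forall>\<alpha>. integrable lborel (\<lambda>x. (pdl \<alpha> f x)\<^sup>2))"

lemma pdl_append: "pdl (\<alpha> @ \<beta>) f = pdl \<alpha> (pdl \<beta> f)"
  by (induction \<alpha>) auto

lemma pdl_singleton: "pdl [i] f = pd i f"
  by simp

lemma all_partials_pdl: "all_partials f \<Longrightarrow> all_partials (pdl \<beta> f)"
  unfolding all_partials_def by (metis pdl_append append_Cons)

lemma smooth_fun_pdl: "smooth_fun f \<Longrightarrow> smooth_fun (pdl \<beta> f)"
  unfolding smooth_fun_def by (metis pdl_append all_partials_pdl)

lemma Hinf_pdl: "Hinf f \<Longrightarrow> Hinf (pdl \<beta> f)"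
  unfolding Hinf_def by (metis pdl_append smooth_fun_pdl)

lemma Hinf_imp_smooth_fun: "Hinf f \<Longrightarrow> smooth_fun f"
  by (simp add: Hinf_def)

lemma smooth_fun_imp_all_partials: "smooth_fun f \<Longrightarrow> all_partials f"
  by (simp add: smooth_fun_def)

lemma smooth_fun_continuous: "smooth_fun f \<Longrightarrow> continuous_on UNIV (pdl \<alpha> f)"
  by (simp add: smooth_fun_def)

lemma smooth_fun_measurable: "smooth_fun f \<Longrightarrow> pdl \<alpha> f \<in> borel_measurable borel"
  by (simp add: smooth_fun_def borel_measurable_continuous_onI)

lemma all_partials_has_real_derivative:
  assumes "all_partials f"
  shows "((\<lambda>h. pdl \<alpha> f (x + h *\<^sub>R axis i 1)) has_real_derivative pdl (i # \<alpha>) f (x + s *\<^sub>R axis i 1)) (at s)"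
proof -
  let ?F = "\<lambda>h. pdl \<alpha> f (x + h *\<^sub>R axis i 1)"
  have "((\<lambda>h. pdl \<alpha> f ((x + s *\<^sub>R axis i 1) + h *\<^sub>R axis i 1)) has_real_derivative
      pdl (i # \<alpha>) f (x + s *\<^sub>R axis i 1)) (at 0)"
    using assms unfolding all_partials_def by simp
  then have "((\<lambda>h. ?F (h + s)) has_real_derivative pdl (i # \<alpha>) f (x + s *\<^sub>R axis i 1)) (at 0)"
    by (simp add: algebra_simps)
  then show ?thesis using DERIV_shift[of ?F _ 0 s] by simp
qed

lemma pd_eqI:
  "((\<lambda>h. f (x + h *\<^sub>R axis i 1)) has_real_derivative D) (at 0) \<Longrightarrow> pd i f x = D"
  unfolding pd_def by (rule DERIV_imp_deriv)

lemma pdl_lincomb: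
  assumes "all_partials f" "all_partials g"
  shows "pdl \<alpha> (\<lambda>x. a * f x + b * g x) = (\<lambda>x. a * pdl \<alpha> f x + b * pdl \<alpha> g x)"
proof (induction \<alpha>)
  case (Cons i \<alpha>)
  show ?case
  proof
    fix x
    have "((\<lambda>h. a * pdl \<alpha> f (x + h *\<^sub>R axis i 1) + b * pdl \<alpha> g (x + h *\<^sub>R axis i 1)) has_real_derivative
        a * pdl (i # \<alpha>) f x + b * pdl (i # \<alpha>) g x) (at 0)"
      by (intro DERIV_add DERIV_cmult) (use assms in \<open>auto simp: all_partials_def\<close>)
    then show "pdl (i # \<alpha>) (\<lambda>x. a * f x + b * g x) x = a * pdl (i # \<alpha>) f x + b * pdl (i # \<alpha>) g x"
      by (simp only: pdl.simps Cons.IH) (rule pd_eqI)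
  qed
qed auto

lemma all_partials_lincomb:
  assumes "all_partials f" "all_partials g"
  shows "all_partials (\<lambda>x. a * f x + b * g x)"
  unfolding all_partials_def pdl_lincomb[OF assms]
  by (intro allI DERIV_add DERIV_cmult) (use assms in \<open>auto simp: all_partials_def\<close>)

lemma smooth_fun_lincomb:
  assumes "smooth_fun f" "smooth_fun g"
  shows "smooth_fun (\<lambda>x. a * f x + b * g x)"
  using assms unfolding smooth_fun_def
  by (auto simp: pdl_lincomb all_partials_lincomb intro!: continuous_intros)

lemma pdl_zero: "pdl \<alpha> (\<lambda>x. 0) = (\<lambda>x. 0)"
  by (induction \<alpha>) (auto simp: fun_eq_iff intro!: pd_eqI)

lemma all_partials_zero: "all_partials (\<lambda>x. 0)"
  unfolding all_partials_def pdl_zero by (auto intro: DERIV_const)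

lemma all_partials_sum:
  assumes "finite A" "\<And>i. i \<in> A \<Longrightarrow> all_partials (f i)"
  shows "all_partials (\<lambda>x. \<Sum>i\<in>A. f i x)"
    and pdl_sum: "pdl \<alpha> (\<lambda>x. \<Sum>i\<in>A. f i x) = (\<lambda>x. \<Sum>i\<in>A. pdl \<alpha> (f i) x)"
proof -
  have "all_partials (\<lambda>x. \<Sum>i\<in>A. f i x) \<and> (\<forall>\<alpha>. pdl \<alpha> (\<lambda>x. \<Sum>i\<in>A. f i x) = (\<lambda>x. \<Sum>i\<in>A. pdl \<alpha> (f i) x))"
    using assms
  proof (induction A rule: finite_induct)
    case empty
    show ?case by (auto simp: all_partials_zero pdl_zero)
  next
    case (insert j A)
    then show ?case
      using all_partials_lincomb[of "f j" "\<lambda>x. \<Sum>i\<in>A. f i x" 1 1]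
        pdl_lincomb[of "f j" "\<lambda>x. \<Sum>i\<in>A. f i x" _ 1 1] by auto
  qed
  then show "all_partials (\<lambda>x. \<Sum>i\<in>A. f i x)"
    "pdl \<alpha> (\<lambda>x. \<Sum>i\<in>A. f i x) = (\<lambda>x. \<Sum>i\<in>A. pdl \<alpha> (f i) x)" by auto
qed

fun leibniz_splits :: "'n list \<Rightarrow> ('n list \<times> 'n list) list" where
  "leibniz_splits [] = [([], [])]"
| "leibniz_splits (i # \<alpha>) =
    map (\<lambda>(\<beta>, \<gamma>). (i # \<beta>, \<gamma>)) (leibniz_splits \<alpha>) @ map (\<lambda>(\<beta>, \<gamma>). (\<beta>, i # \<gamma>)) (leibniz_splits \<alpha>)"

lemma length_leibniz_splits: "length (leibniz_splits \<alpha>) = 2 ^ length \<alpha>"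
  by (induction \<alpha>) auto

lemma leibniz_splits_lengths:
  "(\<beta>, \<gamma>) \<in> set (leibniz_splits \<alpha>) \<Longrightarrow> length \<beta> + length \<gamma> = length \<alpha>"
  by (induction \<alpha> arbitrary: \<beta> \<gamma>) auto

lemma has_real_derivative_sum_list:
  assumes "\<And>p. p \<in> set L \<Longrightarrow> (F p has_real_derivative F' p) (at x)"
  shows "((\<lambda>h. \<Sum>p\<leftarrow>L. F p h) has_real_derivative (\<Sum>p\<leftarrow>L. F' p)) (at x)"
  using assms by (induction L) (auto intro!: DERIV_add)

lemma pdl_mult:
  assumes f: "all_partials f" and g: "all_partials g"
  shows "pdl \<alpha> (\<lambda>x. f x * g x) = (\<lambda>x. \<Sum>p\<leftarrow>leibniz_splits \<alpha>. pdl (fst p) f x * pdl (snd p) g x)"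
    and all_partials_mult: "all_partials (\<lambda>x. f x * g x)"
proof -
  let ?S = "\<lambda>\<alpha> x. \<Sum>p\<leftarrow>leibniz_splits \<alpha>. pdl (fst p) f x * pdl (snd p) g x"
  have D: "((\<lambda>h. ?S \<alpha> (x + h *\<^sub>R axis i 1)) has_real_derivative ?S (i # \<alpha>) x) (at 0)" for \<alpha> i x
  proof -
    have "((\<lambda>h. ?S \<alpha> (x + h *\<^sub>R axis i 1)) has_real_derivative
      (\<Sum>p\<leftarrow>leibniz_splits \<alpha>. pdl (i # fst p) f x * pdl (snd p) g x + pdl (i # snd p) g x * pdl (fst p) f x)) (at 0)"
    proof (rule has_real_derivative_sum_list)
      fix p
      have "((\<lambda>h. pdl (fst p) f (x + h *\<^sub>R axis i 1)) has_real_derivative pdl (i # fst p) f x) (at 0)"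
        "((\<lambda>h. pdl (snd p) g (x + h *\<^sub>R axis i 1)) has_real_derivative pdl (i # snd p) g x) (at 0)"
        using f g unfolding all_partials_def by blast+
      from DERIV_mult[OF this] show "((\<lambda>h. pdl (fst p) f (x + h *\<^sub>R axis i 1) * pdl (snd p) g (x + h *\<^sub>R axis i 1)) has_real_derivative
        pdl (i # fst p) f x * pdl (snd p) g x + pdl (i # snd p) g x * pdl (fst p) f x) (at 0)" by simp
    qed
    also have "(\<Sum>p\<leftarrow>leibniz_splits \<alpha>. pdl (i # fst p) f x * pdl (snd p) g x + pdl (i # snd p) g x * pdl (fst p) f x) = ?S (i # \<alpha>) x"
      by (simp add: sum_list_addf o_def case_prod_unfold mult.commute)
    finally show ?thesis .
  qed
  have eq: "pdl \<alpha> (\<lambda>x. f x * g x) = ?S \<alpha>" for \<alpha>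
  proof (induction \<alpha>)
    case (Cons i \<alpha>)
    show ?case
      by (rule ext, simp only: pdl.simps(2) Cons.IH, rule pd_eqI[OF D])
  qed auto
  show "pdl \<alpha> (\<lambda>x. f x * g x) = ?S \<alpha>" by (rule eq)
  show "all_partials (\<lambda>x. f x * g x)"
    unfolding all_partials_def eq using D by blast
qed

section \<open>Integration by parts in one direction\<close>


lemma lborel_integral_translate:
  fixes f :: "'a::euclidean_space \<Rightarrow> real"
  assumes [measurable]: "f \<in> borel_measurable borel"
  shows "(LINT x|lborel. f (x + a)) = (LINT x|lborel. f x)"
proof -
  have "(LINT x|lborel. f x) = (LINT x|distr lborel borel ((+) a). f x)"
    by (simp add: lborel_distr_plus)
  also have "\<dots> = (LINT x|lborel. f (a + x))"
    by (subst integral_distr) auto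
  finally show ?thesis by (simp add: add.commute)
qed

lemma lborel_integrable_translate:
  fixes f :: "'a::euclidean_space \<Rightarrow> real"
  assumes "integrable lborel f"
  shows "integrable lborel (\<lambda>x. f (x + a))"
proof -
  have "integrable (distr lborel borel ((+) a)) f"
    using assms by (simp add: lborel_distr_plus)
  then have "integrable lborel (\<lambda>x. f (a + x))"
    by (subst (asm) integrable_distr_eq) (use borel_measurable_integrable[OF assms] in auto)
  then show ?thesis by (simp add: add.commute)
qed

lemma lborel_nn_integral_translate:
  fixes f :: "'a::euclidean_space \<Rightarrow> ennreal"
  assumes [measurable]: "f \<in> borel_measurable borel"
  shows "(\<integral>\<^sup>+x. f (x + a) \<partial>lborel) = (\<integral>\<^sup>+x. f x \<partial>lborel)"
proof -
  have "(\<integral>\<^sup>+x. f x \<partial>lborel) = (\<integral>\<^sup>+x. f x \<partial>distr lborel borel ((+) a))"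
    by (simp add: lborel_distr_plus)
  also have "\<dots> = (\<integral>\<^sup>+x. f (a + x) \<partial>lborel)"
    by (subst nn_integral_distr) auto
  finally show ?thesis by (simp add: add.commute)
qed

text \<open>By translation invariance, 0 is the integral of F (x + e) - F x, which by the fundamental
  theorem of calculus and Fubini is the integral of F'.\<close>
lemma integral_directional_derivative_eq_0:
  fixes F F' :: "'a::euclidean_space \<Rightarrow> real"
  assumes D: "\<And>x s. ((\<lambda>h. F (x + h *\<^sub>R e)) has_real_derivative F' (x + s *\<^sub>R e)) (at s)"
    and cont: "continuous_on UNIV F'"
    and F: "integrable lborel F" and F': "integrable lborel F'"
  shows "(LINT x|lborel. F' x) = 0"
proof -
  define G where "G = (\<lambda>(x, s). indicator {0..1} s * F' (x + s *\<^sub>R e))"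
  have [measurable]: "F' \<in> borel_measurable borel"
    using cont by (rule borel_measurable_continuous_onI)
  have G_meas[measurable]: "G \<in> borel_measurable (lborel \<Otimes>\<^sub>M lborel)"
    unfolding G_def by measurable
  have fin: "(\<integral>\<^sup>+x. ennreal \<bar>F' x\<bar> \<partial>lborel) < \<infinity>"
    using F' unfolding integrable_iff_bounded by simp
  have G: "integrable (lborel \<Otimes>\<^sub>M lborel) G"
  proof (rule integrableI_bounded[OF G_meas])
    have "(\<integral>\<^sup>+z. ennreal (norm (G z)) \<partial>(lborel \<Otimes>\<^sub>M lborel)) =
        (\<integral>\<^sup>+s. \<integral>\<^sup>+x. ennreal (norm (G (x, s))) \<partial>lborel \<partial>lborel)"
      by (rule lborel_pair.nn_integral_snd[symmetric]) measurable
    also have "\<dots> = (\<integral>\<^sup>+s. indicator {0..1} (s::real) * (\<integral>\<^sup>+x. ennreal \<bar>F' x\<bar> \<partial>lborel) \<partial>lborel)"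
    proof (rule nn_integral_cong)
      fix s :: real
      have "(\<integral>\<^sup>+x. ennreal (norm (G (x, s))) \<partial>lborel) =
          (\<integral>\<^sup>+x. indicator {0..1} s * ennreal \<bar>F' (x + s *\<^sub>R e)\<bar> \<partial>lborel)"
        by (rule nn_integral_cong) (auto simp: G_def indicator_def)
      also have "\<dots> = indicator {0..1} s * (\<integral>\<^sup>+x. ennreal \<bar>F' (x + s *\<^sub>R e)\<bar> \<partial>lborel)"
        by (rule nn_integral_cmult) measurable
      also have "(\<integral>\<^sup>+x. ennreal \<bar>F' (x + s *\<^sub>R e)\<bar> \<partial>lborel) = (\<integral>\<^sup>+x. ennreal \<bar>F' x\<bar> \<partial>lborel)"
        by (rule lborel_nn_integral_translate) measurable
      finally show "(\<integral>\<^sup>+x. ennreal (norm (G (x, s))) \<partial>lborel) =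
          indicator {0..1} s * (\<integral>\<^sup>+x. ennreal \<bar>F' x\<bar> \<partial>lborel)" .
    qed
    also have "\<dots> = (\<integral>\<^sup>+x. ennreal \<bar>F' x\<bar> \<partial>lborel)"
      by (subst nn_integral_multc) auto
    finally show "(\<integral>\<^sup>+z. ennreal (norm (G z)) \<partial>(lborel \<Otimes>\<^sub>M lborel)) < \<infinity>" using fin by simp
  qed
  have "(LINT x|lborel. F' x) = (LINT s|lborel. indicator {0..1} (s::real) * (LINT x|lborel. F' x))"
    by simp
  also have "\<dots> = (LINT s|lborel. LINT x|lborel. G (x, s))"
  proof (rule Bochner_Integration.integral_cong)
    fix s :: real
    have "(LINT x|lborel. F' (x + s *\<^sub>R e)) = (LINT x|lborel. F' x)"
      by (rule lborel_integral_translate) measurable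
    then show "indicator {0..1} s * (LINT x|lborel. F' x) = (LINT x|lborel. G (x, s))"
      by (simp add: G_def)
  qed simp
  also have "\<dots> = (LINT x|lborel. LINT s|lborel. G (x, s))"
    using lborel_pair.Fubini_integral[of "\<lambda>x s. G (x, s)"] G by (simp add: case_prod_eta)
  also have "\<dots> = (LINT x|lborel. F (x + e) - F x)"
  proof (rule Bochner_Integration.integral_cong)
    fix x :: 'a
    have "(LBINT s. F' (x + s *\<^sub>R e) * indicator {0..1} s) = F (x + 1 *\<^sub>R e) - F (x + 0 *\<^sub>R e)"
    proof (rule integral_FTC_Icc_real)
      have "continuous_on UNIV (\<lambda>s. F' (x + s *\<^sub>R e))"
        by (rule continuous_on_compose2[OF cont]) (auto intro!: continuous_intros)
      then show "isCont (\<lambda>s. F' (x + s *\<^sub>R e)) s" for s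
        by (simp add: continuous_on_eq_continuous_at)
    qed (use D in auto)
    then show "(LINT s|lborel. G (x, s)) = F (x + e) - F x"
      by (simp add: G_def mult.commute)
  qed simp
  also have "\<dots> = (LINT x|lborel. F (x + e)) - (LINT x|lborel. F x)"
    by (rule Bochner_Integration.integral_diff[OF lborel_integrable_translate[OF F] F])
  also have "\<dots> = 0"
    using lborel_integral_translate[of F e] borel_measurable_integrable[OF F] by simp
  finally show ?thesis .
qed

section \<open>Chain rule and symmetry of partial derivatives\<close>


lemma smooth_fun_has_derivative_along:
  assumes f: "smooth_fun f" and "finite I"
  shows "((\<lambda>s. f (x + s *\<^sub>R (\<Sum>i\<in>I. y$i *\<^sub>R axis i 1))) has_real_derivative
    (\<Sum>i\<in>I. y$i * pd i f (x + s *\<^sub>R (\<Sum>i\<in>I. y$i *\<^sub>R axis i 1)))) (at s)"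
  using \<open>finite I\<close>
proof (induction I arbitrary: x s rule: finite_induct)
  case empty
  show ?case by simp
next
  case (insert j I)
  define z where "z = (\<Sum>i\<in>I. y$i *\<^sub>R axis i (1::real))"
  define F where "F = (\<lambda>s r. f (x + s *\<^sub>R z + (r * y$j) *\<^sub>R axis j 1))"
  have fx: "((\<lambda>s. F s r) has_derivative (*) (\<Sum>i\<in>I. y$i * pd i f (x + s *\<^sub>R z + (r * y$j) *\<^sub>R axis j 1))) (at s)" for r s
    using insert.IH[of "x + (r * y$j) *\<^sub>R axis j 1" s] unfolding has_field_derivative_def F_def z_def
    by (simp add: algebra_simps)
  have fy: "((\<lambda>r. F s r) has_derivative
      blinfun_apply (blinfun_mult_right (y$j * pd j f (x + s *\<^sub>R z + (r * y$j) *\<^sub>R axis j 1)))) (at r)" for r s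
  proof -
    have "((\<lambda>h. pdl [] f ((x + s *\<^sub>R z) + h *\<^sub>R axis j 1)) has_real_derivative
        pdl [j] f ((x + s *\<^sub>R z) + (r * y$j) *\<^sub>R axis j 1)) (at (r * y$j))"
      using all_partials_has_real_derivative f smooth_fun_imp_all_partials by blast
    moreover have "((\<lambda>r. r * y$j) has_real_derivative y$j) (at r)"
      by (auto intro!: derivative_eq_intros)
    ultimately have "((\<lambda>r. F s r) has_real_derivative
        pdl [j] f ((x + s *\<^sub>R z) + (r * y$j) *\<^sub>R axis j 1) * y$j) (at r)"
      using DERIV_chain2[of "\<lambda>h. pdl [] f ((x + s *\<^sub>R z) + h *\<^sub>R axis j 1)" _ "\<lambda>r. r * y$j" r] by (simp add: F_def)
    then show ?thesis unfolding has_field_derivative_def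
      by (simp add: mult.commute)
  qed
  have cont: "continuous_on UNIV (pd j f)"
    using smooth_fun_continuous[OF f, of "[j]"] by simp
  have c2: "continuous_on UNIV (\<lambda>p::real\<times>real. pd j f (x + fst p *\<^sub>R z + (snd p * y$j) *\<^sub>R axis j 1))"
    by (rule continuous_on_compose2[OF cont]) (auto intro!: continuous_intros)
  have c3: "continuous_on UNIV (\<lambda>p::real\<times>real. blinfun_mult_right (y$j * pd j f (x + fst p *\<^sub>R z + (snd p * y$j) *\<^sub>R axis j 1)))"
    by (intro bounded_linear.continuous_on[OF bounded_linear_blinfun_mult_right] continuous_intros c2)
  have "((\<lambda>(s, r). F s r) has_derivative (\<lambda>(ts, tr).
      (\<Sum>i\<in>I. y$i * pd i f (x + s *\<^sub>R z + (s * y$j) *\<^sub>R axis j 1)) * ts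
      + blinfun_apply (blinfun_mult_right (y$j * pd j f (x + s *\<^sub>R z + (s * y$j) *\<^sub>R axis j 1))) tr)) (at (s, s) within UNIV \<times> UNIV)"
    by (rule has_derivative_partialsI[where fy = "\<lambda>s r. blinfun_mult_right (y$j * pd j f (x + s *\<^sub>R z + (r * y$j) *\<^sub>R axis j 1))"])
      (use fx fy c3 in \<open>auto simp: continuous_on_eq_continuous_at case_prod_unfold\<close>)
  then have D: "((\<lambda>(s, r). F s r) has_derivative (\<lambda>(ts, tr).
      (\<Sum>i\<in>I. y$i * pd i f (x + s *\<^sub>R z + (s * y$j) *\<^sub>R axis j 1)) * ts
      + (y$j * pd j f (x + s *\<^sub>R z + (s * y$j) *\<^sub>R axis j 1)) * tr)) (at (s, s))"
    by simp
  have P: "((\<lambda>s. (s, s)) has_derivative (\<lambda>t. (t, t))) (at s)"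
    by (auto intro!: derivative_eq_intros)
  define A B where "A = (\<Sum>i\<in>I. y$i * pd i f (x + s *\<^sub>R z + (s * y$j) *\<^sub>R axis j 1))"
    and "B = y$j * pd j f (x + s *\<^sub>R z + (s * y$j) *\<^sub>R axis j 1)"
  have "((\<lambda>s. F s s) has_derivative (\<lambda>t. A * t + B * t)) (at s)"
    using has_derivative_compose[OF P D] by (simp add: A_def B_def)
  moreover have "(\<lambda>t. A * t + B * t) = (*) (B + A)"
    by (auto simp: fun_eq_iff algebra_simps)
  ultimately have "((\<lambda>s. F s s) has_real_derivative B + A) (at s)"
    by (simp add: has_field_derivative_def)
  moreover have eq: "x + s *\<^sub>R z + (s * y$j) *\<^sub>R axis j 1 = x + s *\<^sub>R (\<Sum>i\<in>insert j I. y$i *\<^sub>R axis i 1)" for s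
    using insert.hyps by (simp add: z_def algebra_simps)
  ultimately show ?case
    unfolding F_def A_def B_def eq using insert.hyps by simp
qed

lemma sum_component_axis: "(\<Sum>i\<in>UNIV. y$i *\<^sub>R axis i (1::real)) = (y :: real^'n::finite)"
  using basis_expansion[of y] by (simp add: scalar_mult_eq_scaleR)

lemma smooth_fun_directional_derivative:
  assumes "smooth_fun f"
  shows "((\<lambda>s. f (x + s *\<^sub>R y)) has_real_derivative (\<Sum>i\<in>UNIV. y$i * pd i f (x + s *\<^sub>R y))) (at s)"
  using smooth_fun_has_derivative_along[OF assms, of UNIV x y s] by (simp add: sum_component_axis)

lemma pd_commute:
  assumes f: "smooth_fun f"
  shows "pd i (pd j f) x = pd j (pd i f) x"
proof -
  note ap = smooth_fun_imp_all_partials[OF f]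
  let ?ei = "axis i (1::real)" and ?ej = "axis j (1::real)"
  have ci: "continuous_on UNIV (pd i f)" and cji: "continuous_on UNIV (pd j (pd i f))"
    using smooth_fun_continuous[OF f, of "[i]"] smooth_fun_continuous[OF f, of "[j, i]"] by simp_all
  have ftc: "((\<lambda>s. pd i f (x + s *\<^sub>R ?ei + b *\<^sub>R ?ej)) has_integral
      f (x + a *\<^sub>R ?ei + b *\<^sub>R ?ej) - f (x - ?ei + b *\<^sub>R ?ej)) {-1..a}" if "a \<ge> -1" for a b
  proof -
    have "((\<lambda>s. f ((x + b *\<^sub>R ?ej) + s *\<^sub>R ?ei)) has_real_derivative pd i f ((x + b *\<^sub>R ?ej) + s *\<^sub>R ?ei)) (at s)" for s
      using all_partials_has_real_derivative[OF ap, of "[]"] by simp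
    then have "((\<lambda>s. pd i f ((x + b *\<^sub>R ?ej) + s *\<^sub>R ?ei)) has_integral
        f ((x + b *\<^sub>R ?ej) + a *\<^sub>R ?ei) - f ((x + b *\<^sub>R ?ej) + (-1) *\<^sub>R ?ei)) {-1..a}"
      by (intro fundamental_theorem_of_calculus that)
        (auto simp: has_real_derivative_iff_has_vector_derivative intro: has_vector_derivative_at_within)
    then show ?thesis by (simp add: algebra_simps)
  qed
  have A: "pd j f (x + a *\<^sub>R ?ei) - pd j f (x - ?ei) = integral {-1..a} (\<lambda>s. pd j (pd i f) (x + s *\<^sub>R ?ei))"
    if "a \<ge> -1" for a
  proof -
    have "((\<lambda>b. integral (cbox (-1) a) (\<lambda>s. pd i f (x + s *\<^sub>R ?ei + b *\<^sub>R ?ej))) has_field_derivative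
        integral (cbox (-1) a) (\<lambda>s. pd j (pd i f) (x + s *\<^sub>R ?ei + 0 *\<^sub>R ?ej))) (at 0 within UNIV)"
    proof (rule leibniz_rule_field_derivative)
      show "((\<lambda>b. pd i f (x + s *\<^sub>R ?ei + b *\<^sub>R ?ej)) has_real_derivative
          pd j (pd i f) (x + s *\<^sub>R ?ei + b *\<^sub>R ?ej)) (at b within UNIV)" for b s
        using all_partials_has_real_derivative[OF ap, of "[i]"] by simp
      show "(\<lambda>s. pd i f (x + s *\<^sub>R ?ei + b *\<^sub>R ?ej)) integrable_on cbox (-1) a" for b
        using ftc[OF that] by (auto simp: integrable_on_def)
      show "continuous_on (UNIV \<times> cbox (-1) a) (\<lambda>(b, s). pd j (pd i f) (x + s *\<^sub>R ?ei + b *\<^sub>R ?ej))"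
        unfolding case_prod_unfold
        by (rule continuous_on_compose2[OF cji]) (auto intro!: continuous_intros)
    qed auto
    moreover have "integral (cbox (-1) a) (\<lambda>s. pd i f (x + s *\<^sub>R ?ei + b *\<^sub>R ?ej)) =
        f (x + a *\<^sub>R ?ei + b *\<^sub>R ?ej) - f (x - ?ei + b *\<^sub>R ?ej)" for b
      using ftc[OF that] by (simp add: integral_unique)
    ultimately have 1: "((\<lambda>b. f (x + a *\<^sub>R ?ei + b *\<^sub>R ?ej) - f (x - ?ei + b *\<^sub>R ?ej)) has_real_derivative
        integral {-1..a} (\<lambda>s. pd j (pd i f) (x + s *\<^sub>R ?ei))) (at 0)"
      by simp
    have "((\<lambda>b. f (z + b *\<^sub>R ?ej)) has_real_derivative pd j f z) (at 0)" for z
      using ap unfolding all_partials_def by (metis pdl.simps)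
    then have "((\<lambda>b. f (x + a *\<^sub>R ?ei + b *\<^sub>R ?ej) - f (x - ?ei + b *\<^sub>R ?ej)) has_real_derivative
        pd j f (x + a *\<^sub>R ?ei) - pd j f (x - ?ei)) (at 0)"
      by (intro DERIV_diff) auto
    with 1 show ?thesis using DERIV_unique by blast
  qed
  have "((\<lambda>a. integral {-1..a} (\<lambda>s. pd j (pd i f) (x + s *\<^sub>R ?ei))) has_real_derivative
      pd j (pd i f) (x + 0 *\<^sub>R ?ei)) (at 0 within {-1..1})"
    by (rule integral_has_real_derivative)
      (auto intro!: continuous_on_compose2[OF cji] continuous_intros)
  then have "((\<lambda>a. integral {-1..a} (\<lambda>s. pd j (pd i f) (x + s *\<^sub>R ?ei))) has_real_derivative pd j (pd i f) x) (at 0)"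
    by (simp add: at_within_interior[of 0 "{-1..1::real}"])
  moreover have "eventually (\<lambda>a. integral {-1..a} (\<lambda>s. pd j (pd i f) (x + s *\<^sub>R ?ei)) =
      pd j f (x + a *\<^sub>R ?ei) - pd j f (x - ?ei)) (nhds 0)"
    using eventually_nhds_in_open[of "{-1<..<1::real}" 0] A by (auto elim!: eventually_mono)
  ultimately have "((\<lambda>a. pd j f (x + a *\<^sub>R ?ei) - pd j f (x - ?ei)) has_real_derivative pd j (pd i f) x) (at 0)"
    by (simp add: DERIV_cong_ev)
  then have "((\<lambda>a. pd j f (x + a *\<^sub>R ?ei)) has_real_derivative pd j (pd i f) x) (at 0)"
    using DERIV_add[OF _ DERIV_const[of "pd j f (x - ?ei)"]] by fastforce
  then show ?thesis by (rule pd_eqI)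
qed

section \<open>Sobolev inequality\<close>


lemma finite_mind: "finite (mind k :: 'n::finite list set)"
  unfolding mind_def using finite_lists_length_eq[of "UNIV :: 'n set" k] by simp

lemma card_mind: "card (mind k :: 'n::finite list set) = CARD('n) ^ k"
  unfolding mind_def using card_lists_length_eq[of "UNIV :: 'n set" k] by simp

lemma mind_0: "mind 0 = {[]}"
  by (auto simp: mind_def)

lemma sum_mind_Suc:
  fixes F :: "'n::finite list \<Rightarrow> 'b::comm_monoid_add"
  shows "(\<Sum>\<alpha>\<in>mind (Suc k). F \<alpha>) = (\<Sum>i\<in>UNIV. \<Sum>\<alpha>\<in>mind k. F (i # \<alpha>))"
proof -
  have "(\<Sum>\<alpha>\<in>mind (Suc k). F \<alpha>) = (\<Sum>(i, \<alpha>)\<in>UNIV \<times> mind k. F (i # \<alpha>))"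
    by (rule sum.reindex_bij_witness[of _ "\<lambda>(i, \<alpha>). i # \<alpha>" "\<lambda>\<alpha>. (hd \<alpha>, tl \<alpha>)"])
      (auto simp: mind_def length_Suc_conv)
  then show ?thesis by (simp add: sum.cartesian_product)
qed

lemma Lsq_nonneg: "Lsq f \<ge> 0"
  by (simp add: Lsq_def)

lemma gsq_nonneg: "gsq k f \<ge> 0"
  by (simp add: gsq_def sum_nonneg Lsq_nonneg)

lemma Lsq_pdl_le_gsq: "\<alpha> \<in> mind k \<Longrightarrow> Lsq (pdl \<alpha> f) \<le> gsq k f"
  unfolding gsq_def by (rule member_le_sum) (auto simp: Lsq_nonneg finite_mind)

lemma lborel_integral_affine:
  fixes h :: "'a::euclidean_space \<Rightarrow> real"
  assumes h: "integrable lborel h" and s: "s > 0"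
  shows "integrable lborel (\<lambda>y. h (x + s *\<^sub>R y))"
    and "(LINT y|lborel. h (x + s *\<^sub>R y)) = s powr (- real DIM('a)) * (LINT y|lborel. h y)"
proof -
  have [measurable]: "h \<in> borel_measurable borel"
    using borel_measurable_integrable[OF h] by simp
  have eq: "lborel = density (distr lborel borel (\<lambda>y. x + s *\<^sub>R y)) (\<lambda>_. ennreal (s ^ DIM('a)))"
    using lborel_affine[of s x] s by (simp add: ennreal_power)
  have "integrable (density (distr lborel borel (\<lambda>y. x + s *\<^sub>R y)) (\<lambda>_. ennreal (s ^ DIM('a)))) h"
    using h eq by simp
  then have "integrable lborel (\<lambda>y. s ^ DIM('a) * h (x + s *\<^sub>R y))"
    using s by (subst (asm) integrable_density) (auto simp: integrable_distr_eq)
  then show "integrable lborel (\<lambda>y. h (x + s *\<^sub>R y))"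
    using s by (auto dest!: integrable_mult_right[of "1 / s ^ DIM('a)"])
  have "(LINT y|lborel. h y) = (LINT y|density (distr lborel borel (\<lambda>y. x + s *\<^sub>R y)) (\<lambda>_. ennreal (s ^ DIM('a))). h y)"
    using eq by simp
  also have "\<dots> = (LINT y|lborel. s ^ DIM('a) * h (x + s *\<^sub>R y))"
    using s by (subst integral_density) (auto simp: integral_distr)
  also have "\<dots> = s ^ DIM('a) * (LINT y|lborel. h (x + s *\<^sub>R y))"
    by simp
  finally show "(LINT y|lborel. h (x + s *\<^sub>R y)) = s powr (- real DIM('a)) * (LINT y|lborel. h y)"
    using s by (simp add: powr_minus powr_realpow field_simps)
qed

lemma integral_cbox_abs_le_L2:
  fixes h :: "'a::euclidean_space \<Rightarrow> real"
  assumes cont: "continuous_on UNIV h" and sq: "integrable lborel (\<lambda>y. (h y)\<^sup>2)"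
  shows "integral (cbox a b) (\<lambda>y. \<bar>h y\<bar>) \<le> sqrt (measure lborel (cbox a b)) * sqrt (LINT y|lborel. (h y)\<^sup>2)"
proof (cases "measure lborel (cbox a b) = 0")
  case True
  then show ?thesis by (simp add: integral_null)
next
  case False
  define V X where "V = measure lborel (cbox a b)" and "X = integral (cbox a b) (\<lambda>y. \<bar>h y\<bar>)"
  have V: "V > 0" using False by (simp add: V_def zero_less_measure_iff)
  have c: "continuous_on (cbox a b) h" using cont continuous_on_subset by blast
  have i1: "(\<lambda>y. \<bar>h y\<bar>) integrable_on cbox a b" and i2: "(\<lambda>y. (h y)\<^sup>2) integrable_on cbox a b"
    by (intro integrable_continuous continuous_intros c)+
  have "((\<lambda>y. (h y)\<^sup>2 - 2 * (X / V) * \<bar>h y\<bar> + (X / V)\<^sup>2) has_integral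
      integral (cbox a b) (\<lambda>y. (h y)\<^sup>2) - 2 * (X / V) * X + V *\<^sub>R (X / V)\<^sup>2) (cbox a b)"
    unfolding X_def V_def
    by (intro has_integral_add has_integral_diff has_integral_mult_right has_integral_const
        integrable_integral i1 i2)
  moreover have "(h y)\<^sup>2 - 2 * (X / V) * \<bar>h y\<bar> + (X / V)\<^sup>2 = (\<bar>h y\<bar> - X / V)\<^sup>2" for y
    by (simp add: power2_diff algebra_simps)
  ultimately have "((\<lambda>y. (\<bar>h y\<bar> - X / V)\<^sup>2) has_integral
      integral (cbox a b) (\<lambda>y. (h y)\<^sup>2) - 2 * (X / V) * X + V *\<^sub>R (X / V)\<^sup>2) (cbox a b)"
    by simp
  then have "0 \<le> integral (cbox a b) (\<lambda>y. (h y)\<^sup>2) - 2 * (X / V) * X + V *\<^sub>R (X / V)\<^sup>2"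
    by (rule has_integral_nonneg) simp
  also have "\<dots> = integral (cbox a b) (\<lambda>y. (h y)\<^sup>2) - X\<^sup>2 / V"
    using V by (simp add: power2_eq_square)
  finally have "X\<^sup>2 \<le> V * integral (cbox a b) (\<lambda>y. (h y)\<^sup>2)"
    using V by (simp add: field_simps)
  also have "integral (cbox a b) (\<lambda>y. (h y)\<^sup>2) \<le> integral UNIV (\<lambda>y. (h y)\<^sup>2)"
    by (rule integral_subset_le) (use i2 integrable_on_lborel[OF sq] in auto)
  also have "\<dots> = (LINT y|lborel. (h y)\<^sup>2)"
    by (rule integral_lborel[OF sq])
  finally have "X\<^sup>2 \<le> V * (LINT y|lborel. (h y)\<^sup>2)"
    using V by simp
  then have "X \<le> sqrt (V * (LINT y|lborel. (h y)\<^sup>2))"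
    by (rule real_le_rsqrt)
  then show ?thesis by (simp add: X_def V_def real_sqrt_mult)
qed

definition coord_monomial :: "'n list \<Rightarrow> real^'n::finite \<Rightarrow> real" where
  "coord_monomial \<alpha> y = (\<Prod>i\<leftarrow>\<alpha>. y$i)"

lemma abs_coord_monomial_le:
  assumes "y \<in> cbox (\<chi> i. - R) (\<chi> i. R)" "R \<ge> 0"
  shows "\<bar>coord_monomial \<alpha> y\<bar> \<le> R ^ length \<alpha>"
proof (induction \<alpha>)
  case (Cons i \<alpha>)
  have "\<bar>y$i\<bar> \<le> R" using assms(1) by (simp add: mem_box_cart abs_le_iff) (metis minus_le_iff)
  then show ?case using Cons assms(2)
    by (auto simp: coord_monomial_def abs_mult intro!: mult_mono)
qed (simp add: coord_monomial_def)

lemma continuous_on_coord_monomial: "continuous_on A (coord_monomial \<alpha>)"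
proof -
  have "continuous_on A (\<lambda>y. coord_monomial \<alpha> y)"
    by (induction \<alpha>) (auto simp: coord_monomial_def intro!: continuous_intros)
  then show ?thesis by simp
qed

definition radial_derivative :: "nat \<Rightarrow> (real^'n::finite \<Rightarrow> real) \<Rightarrow> real^'n \<Rightarrow> real \<Rightarrow> real^'n \<Rightarrow> real" where
  "radial_derivative k f x s y = (\<Sum>\<alpha>\<in>mind k. coord_monomial \<alpha> y * pdl \<alpha> f (x + s *\<^sub>R y))"

lemma radial_derivative_has_real_derivative:
  assumes f: "smooth_fun f"
  shows "((\<lambda>s. radial_derivative k f x s y) has_real_derivative radial_derivative (Suc k) f x s y) (at s)"
proof -
  have "((\<lambda>s. radial_derivative k f x s y) has_real_derivative
    (\<Sum>\<alpha>\<in>mind k. coord_monomial \<alpha> y * (\<Sum>i\<in>UNIV. y$i * pd i (pdl \<alpha> f) (x + s *\<^sub>R y)))) (at s)"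
    unfolding radial_derivative_def
    by (intro DERIV_sum DERIV_cmult smooth_fun_directional_derivative smooth_fun_pdl f)
  also have "(\<Sum>\<alpha>\<in>mind k. coord_monomial \<alpha> y * (\<Sum>i\<in>UNIV. y$i * pd i (pdl \<alpha> f) (x + s *\<^sub>R y))) =
      radial_derivative (Suc k) f x s y"
    unfolding radial_derivative_def sum_mind_Suc sum_distrib_left
    by (subst sum.swap) (simp add: coord_monomial_def mult_ac)
  finally show ?thesis .
qed

lemma continuous_on_radial_derivative:
  assumes f: "smooth_fun f"
  shows "continuous_on A (\<lambda>(s, y). radial_derivative k f x s y)"
  unfolding radial_derivative_def case_prod_unfold
  by (intro continuous_intros continuous_on_compose2[OF continuous_on_coord_monomial[of UNIV]]
      continuous_on_compose2[OF smooth_fun_continuous[OF f]]) auto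

lemma integral_radial_derivative_le:
  fixes f :: "real^'n::finite \<Rightarrow> real"
  assumes f: "Hinf f" and R: "R > 0" and s: "s > 0"
  shows "\<bar>integral (cbox (\<chi> i. - R) (\<chi> i. R)) (radial_derivative k f x s)\<bar>
    \<le> R ^ k * real CARD('n) ^ k * (2 * R) powr (CARD('n) / 2) * s powr (- (CARD('n) / 2)) * sqrt (gsq k f)"
proof -
  let ?B = "cbox (\<chi> i. - R) (\<chi> i. R) :: (real^'n) set"
  note sf = Hinf_imp_smooth_fun[OF f]
  have content: "measure lborel ?B = (2 * R) powr CARD('n)"
    using R by (subst content_cbox_cart) (auto simp: powr_realpow interval_cbox_cart interval_ne_empty_cart)
  have term_le: "\<bar>integral ?B (\<lambda>y. coord_monomial \<alpha> y * pdl \<alpha> f (x + s *\<^sub>R y))\<bar>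
      \<le> R ^ k * ((2 * R) powr (CARD('n) / 2) * (s powr (- (CARD('n) / 2)) * sqrt (gsq k f)))"
    if \<alpha>: "\<alpha> \<in> mind k" for \<alpha>
  proof -
    have cont: "continuous_on UNIV (\<lambda>y. pdl \<alpha> f (x + s *\<^sub>R y))"
      by (intro continuous_on_compose2[OF smooth_fun_continuous[OF sf]] continuous_intros) auto
    then have cont': "continuous_on ?B (\<lambda>y. pdl \<alpha> f (x + s *\<^sub>R y))"
      using continuous_on_subset by blast
    have sq: "integrable lborel (\<lambda>y. (pdl \<alpha> f y)\<^sup>2)" using f by (simp add: Hinf_def)
    have "\<bar>integral ?B (\<lambda>y. coord_monomial \<alpha> y * pdl \<alpha> f (x + s *\<^sub>R y))\<bar>
        \<le> integral ?B (\<lambda>y. R ^ k * \<bar>pdl \<alpha> f (x + s *\<^sub>R y)\<bar>)"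
    proof (rule integral_norm_bound_integral[where f = "\<lambda>y. coord_monomial \<alpha> y * pdl \<alpha> f (x + s *\<^sub>R y)", unfolded real_norm_def])
      show "(\<lambda>y. coord_monomial \<alpha> y * pdl \<alpha> f (x + s *\<^sub>R y)) integrable_on ?B"
        "(\<lambda>y. R ^ k * \<bar>pdl \<alpha> f (x + s *\<^sub>R y)\<bar>) integrable_on ?B"
        by (intro integrable_continuous continuous_intros continuous_on_coord_monomial cont')+
      fix y assume "y \<in> ?B"
      then show "\<bar>coord_monomial \<alpha> y * pdl \<alpha> f (x + s *\<^sub>R y)\<bar> \<le> R ^ k * \<bar>pdl \<alpha> f (x + s *\<^sub>R y)\<bar>"
        using abs_coord_monomial_le[of y R \<alpha>] R \<alpha> by (auto simp: abs_mult mind_def intro!: mult_right_mono)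
    qed
    also have "\<dots> = R ^ k * integral ?B (\<lambda>y. \<bar>pdl \<alpha> f (x + s *\<^sub>R y)\<bar>)"
      by simp
    also have "\<dots> \<le> R ^ k * (sqrt (measure lborel ?B) * sqrt (LINT y|lborel. (pdl \<alpha> f (x + s *\<^sub>R y))\<^sup>2))"
      using R lborel_integral_affine(1)[OF sq s]
      by (intro mult_left_mono integral_cbox_abs_le_L2[OF cont]) auto
    also have "(LINT y|lborel. (pdl \<alpha> f (x + s *\<^sub>R y))\<^sup>2) = s powr (- real CARD('n)) * Lsq (pdl \<alpha> f)"
      using lborel_integral_affine(2)[OF sq s] by (simp add: Lsq_def)
    also have "sqrt (s powr (- real CARD('n)) * Lsq (pdl \<alpha> f)) \<le> sqrt (s powr (- real CARD('n)) * gsq k f)"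
      using Lsq_pdl_le_gsq[OF \<alpha>] by (intro real_sqrt_le_mono mult_left_mono) auto
    finally show ?thesis
      using R s by (simp add: content powr_half_sqrt[symmetric] powr_mult powr_powr real_sqrt_mult mult_ac)
  qed
  have "integral ?B (radial_derivative k f x s) =
      (\<Sum>\<alpha>\<in>mind k. integral ?B (\<lambda>y. coord_monomial \<alpha> y * pdl \<alpha> f (x + s *\<^sub>R y)))"
    unfolding radial_derivative_def
    by (intro integral_sum finite_mind integrable_continuous continuous_intros continuous_on_coord_monomial
        continuous_on_compose2[OF smooth_fun_continuous[OF sf]]) auto
  also have "\<bar>\<dots>\<bar> \<le> (\<Sum>\<alpha>\<in>(mind k :: 'n list set). R ^ k * ((2 * R) powr (CARD('n) / 2) * (s powr (- (CARD('n) / 2)) * sqrt (gsq k f))))"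
    by (rule order_trans[OF sum_abs]) (intro sum_mono term_le)
  also have "\<dots> = R ^ k * real CARD('n) ^ k * (2 * R) powr (CARD('n) / 2) * s powr (- (CARD('n) / 2)) * sqrt (gsq k f)"
    by (simp add: card_mind)
  finally show ?thesis .
qed


lemma integral_radial_derivative_has_real_derivative:
  assumes f: "smooth_fun f"
  shows "((\<lambda>s. integral (cbox a b) (radial_derivative k f x s)) has_real_derivative
    integral (cbox a b) (radial_derivative (Suc k) f x s)) (at s)"
proof -
  have c: "continuous_on (cbox a b) (radial_derivative k f x s)" for s
    using continuous_on_compose2[OF continuous_on_radial_derivative[OF f, of UNIV k x], of "cbox a b" "\<lambda>y. (s, y)"]
    by (simp add: continuous_on_Pair)
  have "((\<lambda>s. integral (cbox a b) (\<lambda>y. radial_derivative k f x s y)) has_field_derivative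
    integral (cbox a b) (\<lambda>y. radial_derivative (Suc k) f x s y)) (at s within UNIV)"
    by (rule leibniz_rule_field_derivative)
      (auto intro: radial_derivative_has_real_derivative[OF f] continuous_on_radial_derivative[OF f]
        integrable_continuous c)
  then show ?thesis by simp
qed

lemma taylor_sum_has_real_derivative:
  fixes F :: "nat \<Rightarrow> real \<Rightarrow> real"
  assumes F: "\<And>k s. (F k has_real_derivative F (Suc k) s) (at s)"
  shows "((\<lambda>s. \<Sum>k<Suc M. (- s) ^ k / fact k * F k s) has_real_derivative
    (- s) ^ M / fact M * F (Suc M) s) (at s)"
proof (induction M)
  case 0
  show ?case using F by simp
next
  case (Suc M)
  have "((\<lambda>s. (- s) ^ Suc M / fact (Suc M)) has_real_derivative - ((- s) ^ M / fact M)) (at s)"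
  proof -
    have "((\<lambda>s. (- s) ^ Suc M) has_real_derivative - (real (Suc M) * (- s) ^ M)) (at s)"
      by (rule derivative_eq_intros refl | simp)+
    from DERIV_cdivide[OF this, of "fact (Suc M)"] show ?thesis
      by (simp del: power_Suc of_nat_Suc)
  qed
  from DERIV_mult[OF this F[of "Suc M" s]]
  have "((\<lambda>s. (- s) ^ Suc M / fact (Suc M) * F (Suc M) s) has_real_derivative
     - ((- s) ^ M / fact M) * F (Suc M) s + F (Suc (Suc M)) s * ((- s) ^ Suc M / fact (Suc M))) (at s)" .
  from DERIV_add[OF Suc.IH this] show ?case
    by (simp add: mult.commute)
qed

text \<open>Taylor's formula for s -> f (x + s y) from s = 1 back to s = 0 is averaged over y in a cube
  of side 2R; the scaling y -> s y turns the L2 norm of the remainder integrand into a power of s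
  that is integrable at 0 precisely because N > n/2.\<close>
lemma Sobolev_sup_bound:
  fixes f :: "real^'n::finite \<Rightarrow> real"
  assumes f: "Hinf f" and R: "R > 0" and N: "N = CARD('n) div 2 + 1"
  shows "\<bar>f x\<bar> \<le> 2 * real CARD('n) ^ N * (\<Sum>k\<le>N. R powr (real k - CARD('n) / 2) * sqrt (gsq k f))"
proof -
  note sf = Hinf_imp_smooth_fun[OF f]
  let ?B = "cbox (\<chi> i. - R) (\<chi> i. R) :: (real^'n) set"
  define n where "n = real CARD('n)"
  have n1: "n \<ge> 1" by (simp add: n_def Suc_leI)
  define M where "M = CARD('n) div 2"
  have NM: "N = Suc M" by (simp add: N M_def)
  define F where "F = (\<lambda>k s. integral ?B (radial_derivative k f x s))"
  define H where "H = (\<lambda>s. \<Sum>k<Suc M. (- s) ^ k / fact k * F k s)"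
  define g where "g = (\<lambda>k. R ^ k * n ^ k * (2 * R) powr (n / 2) * sqrt (gsq k f))"
  have g0: "g k \<ge> 0" for k using R n1 by (simp add: g_def gsq_nonneg)
  have F_le: "\<bar>F k s\<bar> \<le> g k * s powr (- (n / 2))" if "s > 0" for k s
    using integral_radial_derivative_le[OF f R that, of k x] by (simp add: F_def g_def n_def mult_ac)
  have H': "(H has_real_derivative (- s) ^ M / fact M * F (Suc M) s) (at s)" for s
    unfolding H_def F_def
    by (rule taylor_sum_has_real_derivative) (rule integral_radial_derivative_has_real_derivative[OF sf])
  define p where "p = real N - n / 2"
  have "CARD('n) < 2 * N" using N by linarith
  then have "CARD('n) + 1 \<le> 2 * N" by simp
  then have "real (CARD('n) + 1) \<le> real (2 * N)" by (simp only: of_nat_le_iff)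
  then have "real CARD('n) + 1 \<le> 2 * real N" by simp
  then have p: "p \<ge> 1 / 2" by (simp add: p_def n_def)
  have H'_le: "\<bar>(- s) ^ M / fact M * F (Suc M) s\<bar> \<le> g N * s powr (p - 1)" if "s > 0" for s
  proof -
    have "\<bar>(- s) ^ M / fact M * F (Suc M) s\<bar> = s ^ M / fact M * \<bar>F N s\<bar>"
      using that by (simp add: abs_mult power_abs NM)
    also have "\<dots> \<le> s ^ M / 1 * (g N * s powr (- (n / 2)))"
      using that F_le[OF that, of N] by (intro mult_mono divide_left_mono) auto
    also have "\<dots> = g N * s powr (p - 1)"
    proof -
      have "s ^ M * s powr (- (n / 2)) = s powr (real M - n / 2)"
        using that powr_add[of s "real M" "- (n / 2)"] by (simp add: powr_realpow)
      then show ?thesis by (simp add: p_def NM)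
    qed
    finally show ?thesis .
  qed
  have D: "((\<lambda>s. g N / p * s powr p + c * H s) has_real_derivative
      g N * s powr (p - 1) + c * ((- s) ^ M / fact M * F (Suc M) s)) (at s)" if "s > 0" for s c
  proof -
    have "((\<lambda>s. s powr p) has_real_derivative p * s powr (p - 1)) (at s)"
      using that by (rule has_real_derivative_powr)
    from DERIV_add[OF DERIV_cmult[OF this, of "g N / p"] DERIV_cmult[OF H', of c]] show ?thesis
      using p by simp
  qed
  have cont: "continuous_on {0..1} (\<lambda>s. g N / p * s powr p + c * H s)" for c
  proof -
    have "continuous_on {0..1} H"
      by (rule DERIV_continuous_on) (rule has_field_derivative_at_within, rule H')
    moreover have "continuous_on {0..1} (\<lambda>s. s powr p)"
      using p by (intro continuous_on_powr' continuous_intros) auto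
    ultimately show ?thesis by (intro continuous_on_add continuous_on_mult continuous_on_const)
  qed
  have mono: "c * H 0 \<le> g N / p + c * H 1" if c: "\<bar>c\<bar> = 1" for c
  proof -
    have "g N / p * 0 powr p + c * H 0 \<le> g N / p * 1 powr p + c * H 1"
    proof (rule DERIV_nonneg_imp_increasing_open[OF _ _ cont])
      fix s :: real assume s: "0 < s" "s < 1"
      have "\<bar>c * ((- s) ^ M / fact M * F (Suc M) s)\<bar> \<le> g N * s powr (p - 1)"
        using H'_le[OF s(1)] c by (subst abs_mult) simp
      then have "0 \<le> g N * s powr (p - 1) + c * ((- s) ^ M / fact M * F (Suc M) s)"
        using abs_le_D2 by fastforce
      then show "\<exists>y. ((\<lambda>s. g N / p * s powr p + c * H s) has_real_derivative y) (at s) \<and> 0 \<le> y"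
        using D[OF s(1), of c] by blast
    qed auto
    then show ?thesis using p by simp
  qed
  have "\<bar>H 0\<bar> \<le> g N / p + \<bar>H 1\<bar>"
    using mono[of 1] mono[of "-1"] by auto
  also have "g N / p \<le> 2 * g N"
    using p g0[of N] mult_left_mono[of 1 "2 * p" "g N"] by (simp add: divide_le_eq mult_ac)
  also have "\<bar>H 1\<bar> \<le> (\<Sum>k<Suc M. g k)"
    unfolding H_def
  proof (rule order_trans[OF sum_abs], rule sum_mono)
    fix k
    have "\<bar>(- 1) ^ k / fact k * F k 1\<bar> = \<bar>F k 1\<bar> / fact k"
      by (simp add: abs_mult power_abs)
    also have "\<dots> \<le> \<bar>F k 1\<bar> / 1" by (intro divide_left_mono) auto
    also have "\<dots> \<le> g k" using F_le[of 1 k] by simp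
    finally show "\<bar>(- 1) ^ k / fact k * F k 1\<bar> \<le> g k" .
  qed
  also have "(\<Sum>k<Suc M. g k) \<le> 2 * (\<Sum>k<Suc M. g k)"
    using g0 by (simp add: sum_nonneg)
  finally have H0_le: "\<bar>H 0\<bar> \<le> 2 * (\<Sum>k\<le>N. g k)"
    by (simp add: NM lessThan_Suc_atMost algebra_simps)
  have "H 0 = F 0 0"
    unfolding H_def by (subst sum.lessThan_Suc_shift) simp
  also have "\<dots> = measure lborel ?B * f x"
  proof -
    have "radial_derivative 0 f x 0 = (\<lambda>y. f x)"
      by (simp add: fun_eq_iff radial_derivative_def mind_0 coord_monomial_def)
    then show ?thesis by (simp add: F_def)
  qed
  also have "measure lborel ?B = (2 * R) powr n"
    using R by (subst content_cbox_cart) (auto simp: powr_realpow interval_ne_empty_cart n_def)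
  finally have "(2 * R) powr n * \<bar>f x\<bar> \<le> 2 * (\<Sum>k\<le>N. g k)"
    using H0_le R by (simp add: abs_mult)
  then have "\<bar>f x\<bar> \<le> (2 * R) powr (- n) * (2 * (\<Sum>k\<le>N. g k))"
    using R by (simp add: powr_minus field_simps)
  also have "\<dots> = 2 * (\<Sum>k\<le>N. (2 * R) powr (- n) * g k)"
    by (simp add: sum_distrib_left mult_ac)
  also have "\<dots> \<le> 2 * (\<Sum>k\<le>N. n ^ N * (R powr (real k - n / 2) * sqrt (gsq k f)))"
  proof (intro mult_left_mono sum_mono)
    fix k assume k: "k \<in> {..N}"
    have "(2 * R) powr (- n) * (2 * R) powr (n / 2) = (2 * R) powr (- (n / 2))"
      by (simp add: powr_add[symmetric])
    also have "\<dots> \<le> R powr (- (n / 2))"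
      using R n1 by (intro powr_mono2') auto
    finally have 1: "(2 * R) powr (- n) * (2 * R) powr (n / 2) \<le> R powr (- (n / 2))" .
    have 2: "n ^ k \<le> n ^ N" using k n1 by (intro power_increasing) auto
    have "(2 * R) powr (- n) * g k = n ^ k * (R ^ k * ((2 * R) powr (- n) * (2 * R) powr (n / 2)) * sqrt (gsq k f))"
      by (simp add: g_def mult_ac)
    also have "\<dots> \<le> n ^ N * (R ^ k * R powr (- (n / 2)) * sqrt (gsq k f))"
      using R n1 1 2 by (intro mult_mono) (auto simp: gsq_nonneg)
    also have "R ^ k * R powr (- (n / 2)) = R powr (real k - n / 2)"
      using R powr_add[of R "real k" "- (n / 2)"] by (simp add: powr_realpow)
    finally show "(2 * R) powr (- n) * g k \<le> n ^ N * (R powr (real k - n / 2) * sqrt (gsq k f))" .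
  qed simp
  finally show ?thesis
    by (simp add: n_def sum_distrib_left mult_ac)
qed

lemma Hinf_bounded:
  assumes "Hinf f"
  obtains B where "B > 0" "\<And>x. \<bar>pdl \<alpha> f x\<bar> \<le> B"
proof -
  obtain C where C: "\<And>x. \<bar>pdl \<alpha> f x\<bar> \<le> C"
    using Sobolev_sup_bound[OF Hinf_pdl[OF assms] zero_less_one refl] by blast
  have "\<bar>pdl \<alpha> f x\<bar> \<le> \<bar>C\<bar> + 1" for x using C[of x] by linarith
  then show ?thesis by (intro that[of "\<bar>C\<bar> + 1"]) auto
qed

section \<open>Gagliardo--Nirenberg interpolation\<close>


lemma Hinf_measurable: "Hinf f \<Longrightarrow> pdl \<alpha> f \<in> borel_measurable borel"
  by (simp add: Hinf_imp_smooth_fun smooth_fun_measurable)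

lemma Hinf_sq_integrable: "Hinf f \<Longrightarrow> integrable lborel (\<lambda>x. (pdl \<alpha> f x)\<^sup>2)"
  by (simp add: Hinf_def)

lemma integrable_mult_L2:
  fixes u v :: "'a::euclidean_space \<Rightarrow> real"
  assumes [measurable]: "u \<in> borel_measurable borel" "v \<in> borel_measurable borel"
    and "integrable lborel (\<lambda>x. (u x)\<^sup>2)" "integrable lborel (\<lambda>x. (v x)\<^sup>2)"
  shows "integrable lborel (\<lambda>x. u x * v x)"
proof (rule Bochner_Integration.integrable_bound)
  show "integrable lborel (\<lambda>x. (u x)\<^sup>2 + (v x)\<^sup>2)" using assms by auto
  have "\<bar>u x * v x\<bar> \<le> (u x)\<^sup>2 + (v x)\<^sup>2" for x
    using sum_squares_bound[of "\<bar>u x\<bar>" "\<bar>v x\<bar>"] mult_nonneg_nonneg[of "\<bar>u x\<bar>" "\<bar>v x\<bar>"]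
    unfolding abs_mult power2_abs mult.assoc by linarith
  then show "AE x in lborel. norm (u x * v x) \<le> norm ((u x)\<^sup>2 + (v x)\<^sup>2)" by simp
qed measurable

lemma integrable_mult_bounded:
  fixes u b :: "'a::euclidean_space \<Rightarrow> real"
  assumes u: "integrable lborel u" and [measurable]: "b \<in> borel_measurable borel"
    and B: "\<And>x. \<bar>b x\<bar> \<le> B"
  shows "integrable lborel (\<lambda>x. b x * u x)"
proof (rule Bochner_Integration.integrable_bound)
  have [measurable]: "u \<in> borel_measurable borel" using borel_measurable_integrable[OF u] by simp
  show "integrable lborel (\<lambda>x. B * u x)" using u by simp
  have "\<bar>b x\<bar> * \<bar>u x\<bar> \<le> \<bar>B\<bar> * \<bar>u x\<bar>" for x using B[of x] by (intro mult_right_mono) auto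
  then show "AE x in lborel. norm (b x * u x) \<le> norm (B * u x)" by (simp add: abs_mult)
  show "(\<lambda>x. b x * u x) \<in> borel_measurable lborel" by measurable
qed

lemma abs_powr_split: "q \<ge> 2 \<Longrightarrow> \<bar>u\<bar> powr q = \<bar>u\<bar> powr (q - 2) * u\<^sup>2" for u q :: real
  using powr_add[of "\<bar>u\<bar>" "q - 2" 2] by (cases "u = 0") auto

lemma Hinf_powr_integrable:
  assumes f: "Hinf f" and q: "q \<ge> 2"
  shows "integrable lborel (\<lambda>x. \<bar>pdl \<alpha> f x\<bar> powr q)"
proof -
  obtain B where B: "B > 0" "\<And>x. \<bar>pdl \<alpha> f x\<bar> \<le> B" using Hinf_bounded[OF f] by metis
  have [measurable]: "pdl \<alpha> f \<in> borel_measurable borel" by (rule Hinf_measurable[OF f])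
  have "integrable lborel (\<lambda>x. \<bar>pdl \<alpha> f x\<bar> powr (q - 2) * (pdl \<alpha> f x)\<^sup>2)"
  proof (rule integrable_mult_bounded[OF Hinf_sq_integrable[OF f]])
    show "\<bar>\<bar>pdl \<alpha> f x\<bar> powr (q - 2)\<bar> \<le> B powr (q - 2)" for x
      using B q by (auto intro!: powr_mono2)
  qed measurable
  then show ?thesis by (simp add: abs_powr_split[OF q])
qed

lemma signed_powr_has_real_derivative:
  fixes q z :: real
  assumes q: "q > 2"
  shows "((\<lambda>z. \<bar>z\<bar> powr (q - 2) * z) has_real_derivative (q - 1) * \<bar>z\<bar> powr (q - 2)) (at z)"
proof (cases "z = 0")
  case True
  have "((\<lambda>h. \<bar>h\<bar> powr (q - 2)) \<longlongrightarrow> \<bar>0\<bar> powr (q - 2)) (at 0)"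
    using q by (intro tendsto_powr' tendsto_intros) auto
  then have "((\<lambda>h. (\<bar>0 + h\<bar> powr (q - 2) * (0 + h) - \<bar>0\<bar> powr (q - 2) * 0) / h) \<longlongrightarrow> 0) (at 0)"
    using q by (subst (asm) tendsto_cong[where g = "\<lambda>h. (\<bar>0 + h\<bar> powr (q - 2) * (0 + h) - \<bar>0\<bar> powr (q - 2) * 0) / h"])
      (auto simp: eventually_at_filter)
  then show ?thesis using True by (simp add: DERIV_def)
next
  case False
  have ev: "eventually (\<lambda>x. sgn x = sgn z) (nhds z)"
  proof (cases "z > 0")
    case True
    then show ?thesis using eventually_nhds_in_open[of "{0<..}" z] by (auto elim!: eventually_mono)
  next
    case neg: False
    then show ?thesis using False eventually_nhds_in_open[of "{..<0}" z] by (auto elim!: eventually_mono)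
  qed
  have d1: "((\<lambda>x. sgn z * (sgn z * x) powr (q - 1)) has_real_derivative
      sgn z * ((q - 1) * (sgn z * z) powr (q - 1 - 1) * sgn z)) (at z)"
    using False by (auto intro!: derivative_eq_intros simp: sgn_if)
  have d2: "sgn z * ((q - 1) * (sgn z * z) powr (q - 1 - 1) * sgn z) = (q - 1) * \<bar>z\<bar> powr (q - 2)"
    using False by (auto simp: sgn_if)
  have d3: "eventually (\<lambda>x. sgn z * (sgn z * x) powr (q - 1) = \<bar>x\<bar> powr (q - 2) * x) (nhds z)"
    using ev
  proof (rule eventually_mono)
    fix x assume sx: "sgn x = sgn z"
    then have "x \<noteq> 0" using False by (metis sgn_zero_iff)
    then have "\<bar>x\<bar> powr (q - 1) = \<bar>x\<bar> powr (q - 2) * \<bar>x\<bar>"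
      using powr_add[of "\<bar>x\<bar>" "q - 2" 1] by simp
    moreover have "sgn z * x = \<bar>x\<bar>" using sx by (metis abs_sgn mult.commute)
    moreover have "sgn z * \<bar>x\<bar> = x" using sx by (metis sgn_mult_abs)
    ultimately show "sgn z * (sgn z * x) powr (q - 1) = \<bar>x\<bar> powr (q - 2) * x"
      by (simp add: mult.left_commute)
  qed
  show ?thesis using d1 unfolding d2 DERIV_cong_ev[OF refl d3 refl] .
qed

lemma integral_powr_derivative_le:
  fixes u :: "real^'n::finite \<Rightarrow> real"
  assumes u: "Hinf u" and q: "q > 2"
  shows "(LINT x|lborel. \<bar>pd j u x\<bar> powr q) \<le>
    (LINT x|lborel. (q - 1) * (\<bar>u x\<bar> * \<bar>pd j u x\<bar> powr (q - 2) * \<bar>pd j (pd j u) x\<bar>))"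
    and "integrable lborel (\<lambda>x. (q - 1) * (\<bar>u x\<bar> * \<bar>pd j u x\<bar> powr (q - 2) * \<bar>pd j (pd j u) x\<bar>))"
proof -
  define a c where "a = pd j u" and "c = pd j (pd j u)"
  have sf: "smooth_fun u" by (rule Hinf_imp_smooth_fun[OF u])
  have cu: "continuous_on UNIV u" and ca: "continuous_on UNIV a" and cc: "continuous_on UNIV c"
    using smooth_fun_continuous[OF sf, of "[]"] smooth_fun_continuous[OF sf, of "[j]"]
      smooth_fun_continuous[OF sf, of "[j, j]"] by (simp_all add: a_def c_def)
  have [measurable]: "u \<in> borel_measurable borel" "a \<in> borel_measurable borel" "c \<in> borel_measurable borel"
    using cu ca cc by (simp_all add: borel_measurable_continuous_onI)
  have i2: "integrable lborel (\<lambda>x. (u x)\<^sup>2)" "integrable lborel (\<lambda>x. (a x)\<^sup>2)" "integrable lborel (\<lambda>x. (c x)\<^sup>2)"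
    using Hinf_sq_integrable[OF u, of "[]"] Hinf_sq_integrable[OF u, of "[j]"] Hinf_sq_integrable[OF u, of "[j, j]"]
    by (simp_all add: a_def c_def)
  obtain B where B: "B > 0" "\<And>x. \<bar>a x\<bar> \<le> B"
    using Hinf_bounded[OF u, of "[j]"] by (metis a_def pdl_singleton)
  have bd: "\<bar>\<bar>a x\<bar> powr (q - 2)\<bar> \<le> B powr (q - 2)" for x
    using B q by (auto intro!: powr_mono2)
  define F where "F = (\<lambda>x. u x * (\<bar>a x\<bar> powr (q - 2) * a x))"
  define G where "G = (\<lambda>x. (q - 1) * (u x * \<bar>a x\<bar> powr (q - 2) * c x))"
  have iF: "integrable lborel F"
    using integrable_mult_bounded[OF integrable_mult_L2[of u a] _ bd] i2 by (simp add: F_def mult_ac)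
  have iG0: "integrable lborel (\<lambda>x. u x * \<bar>a x\<bar> powr (q - 2) * c x)"
    using integrable_mult_bounded[OF integrable_mult_L2[of u c] _ bd] i2 by (simp add: mult_ac)
  then have iG: "integrable lborel G" by (simp add: G_def)
  have ia: "integrable lborel (\<lambda>x. \<bar>a x\<bar> powr q)"
    using Hinf_powr_integrable[OF u, of q "[j]"] q by (simp add: a_def)
  have "(LINT x|lborel. \<bar>a x\<bar> powr q + G x) = 0"
  proof (rule integral_directional_derivative_eq_0[of F "axis j 1"])
    fix x :: "real^'n" and s :: real
    let ?z = "x + s *\<^sub>R axis j 1"
    have Du: "((\<lambda>h. u (x + h *\<^sub>R axis j 1)) has_real_derivative a ?z) (at s)"
      and Da: "((\<lambda>h. a (x + h *\<^sub>R axis j 1)) has_real_derivative c ?z) (at s)"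
      using all_partials_has_real_derivative[OF smooth_fun_imp_all_partials[OF sf], of "[]"]
        all_partials_has_real_derivative[OF smooth_fun_imp_all_partials[OF sf], of "[j]"]
      by (simp_all add: a_def c_def)
    from DERIV_mult[OF Du DERIV_chain2[OF signed_powr_has_real_derivative[OF q] Da]]
    have "((\<lambda>h. F (x + h *\<^sub>R axis j 1)) has_real_derivative
        a ?z * (\<bar>a ?z\<bar> powr (q - 2) * a ?z) + (q - 1) * \<bar>a ?z\<bar> powr (q - 2) * c ?z * u ?z) (at s)"
      by (simp add: F_def)
    moreover have "a ?z * (\<bar>a ?z\<bar> powr (q - 2) * a ?z) + (q - 1) * \<bar>a ?z\<bar> powr (q - 2) * c ?z * u ?z
        = \<bar>a ?z\<bar> powr q + G ?z"
      using q by (simp add: abs_powr_split[of q] G_def power2_eq_square mult_ac)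
    ultimately show "((\<lambda>h. F (x + h *\<^sub>R axis j 1)) has_real_derivative \<bar>a ?z\<bar> powr q + G ?z) (at s)"
      by simp
  next
    have 1: "continuous_on UNIV (\<lambda>x. \<bar>a x\<bar> powr p)" if "p > 0" for p
      using that by (intro continuous_on_powr' continuous_on_rabs ca continuous_on_const) auto
    show "continuous_on UNIV (\<lambda>x. \<bar>a x\<bar> powr q + G x)"
      unfolding G_def using q
      by (intro continuous_on_add continuous_on_mult continuous_on_const cu cc 1) auto
  qed (use iF iG ia in auto)
  then have "(LINT x|lborel. \<bar>a x\<bar> powr q) = - (LINT x|lborel. G x)"
    using ia iG by simp
  also have "\<dots> \<le> (LINT x|lborel. \<bar>G x\<bar>)"
    using integral_abs_bound[of lborel G] by linarith
  also have "(\<lambda>x. \<bar>G x\<bar>) = (\<lambda>x. (q - 1) * (\<bar>u x\<bar> * \<bar>a x\<bar> powr (q - 2) * \<bar>c x\<bar>))"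
    using q by (auto simp: G_def abs_mult)
  finally show "(LINT x|lborel. \<bar>pd j u x\<bar> powr q) \<le>
    (LINT x|lborel. (q - 1) * (\<bar>u x\<bar> * \<bar>pd j u x\<bar> powr (q - 2) * \<bar>pd j (pd j u) x\<bar>))"
    by (simp add: a_def c_def)
  have "integrable lborel (\<lambda>x. \<bar>u x * \<bar>a x\<bar> powr (q - 2) * c x\<bar>)"
    using iG0 by simp
  then show "integrable lborel (\<lambda>x. (q - 1) * (\<bar>u x\<bar> * \<bar>pd j u x\<bar> powr (q - 2) * \<bar>pd j (pd j u) x\<bar>))"
    by (simp add: abs_mult a_def c_def)
qed


lemma weighted_arith_geom_mean3:
  fixes a b c x y z :: real
  assumes w: "a \<ge> 0" "b > 0" "c > 0" "a + b + c = 1" and x: "x > 0 \<or> a > 0 \<and> x \<ge> 0" and yz: "y \<ge> 0" "z \<ge> 0"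
  shows "x powr a * y powr b * z powr c \<le> a * x + b * y + c * z"
proof (cases "x = 0 \<or> y = 0 \<or> z = 0")
  case True
  then have "x powr a * y powr b * z powr c = 0" using w by auto
  also have "0 \<le> a * x + b * y + c * z" using w x yz by auto
  finally show ?thesis .
next
  case False
  then have pos: "x > 0" "y > 0" "z > 0" using x yz by auto
  define A where "A = a * x + b * y + c * z"
  have A: "A > 0" using w pos by (simp add: A_def add_nonneg_pos)
  have l: "t * ln u \<le> t * (ln A + u / A - 1)" if "u > 0" "t \<ge> 0" for t u
  proof -
    have "ln (u / A) \<le> u / A - 1" using that A by (intro ln_le_minus_one) auto
    then show ?thesis using that A by (intro mult_left_mono) (auto simp: ln_div)
  qed
  have "a * ln x + b * ln y + c * ln z \<le> a * (ln A + x / A - 1) + b * (ln A + y / A - 1) + c * (ln A + z / A - 1)"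
    by (intro add_mono l) (use pos w in auto)
  also have "\<dots> = (a + b + c) * (ln A - 1) + (a * x + b * y + c * z) / A"
    by (simp add: algebra_simps add_divide_distrib)
  also have "\<dots> = ln A" using w A by (simp add: A_def)
  finally have "exp (a * ln x + b * ln y + c * ln z) \<le> A"
    using A by (metis exp_le_cancel_iff exp_ln)
  then show ?thesis using pos by (simp add: powr_def exp_add A_def)
qed

lemma interpolation_Young:
  fixes a b c K \<epsilon> :: real
  assumes w: "a \<ge> 0" "b > 0" "c > 0" "a + b + c = 1" and K: "K > 0" and \<epsilon>: "\<epsilon> > 0"
  obtains C where "C > 0"
    "\<And>x y z. \<lbrakk>x > 0 \<or> a > 0 \<and> x \<ge> 0; y \<ge> 0; z \<ge> 0\<rbrakk> \<Longrightarrow>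
      K * (x powr a * y powr b * z powr c) \<le> a * (\<epsilon> * x) + \<epsilon> * y + C * z"
proof
  define C where "C = (K / (\<epsilon> powr a * \<epsilon> powr b)) powr (1 / c)"
  show C: "C > 0" using K \<epsilon> by (simp add: C_def)
  have Cc: "\<epsilon> powr a * \<epsilon> powr b * C powr c = K"
    using w K \<epsilon> by (simp add: C_def powr_powr)
  fix x y z :: real
  assume x: "x > 0 \<or> a > 0 \<and> x \<ge> 0" and yz: "y \<ge> 0" "z \<ge> 0"
  have x0: "x \<ge> 0" using x by auto
  have "K * (x powr a * y powr b * z powr c) = (\<epsilon> * x) powr a * (\<epsilon> * y) powr b * (C * z) powr c"
    using x0 yz \<epsilon> C Cc[symmetric] by (simp add: powr_mult mult_ac)
  also have "\<dots> \<le> a * (\<epsilon> * x) + b * (\<epsilon> * y) + c * (C * z)"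
    using w x yz \<epsilon> C by (intro weighted_arith_geom_mean3) auto
  also have "\<dots> \<le> a * (\<epsilon> * x) + 1 * (\<epsilon> * y) + 1 * (C * z)"
    using w x0 yz \<epsilon> C by (intro add_mono mult_right_mono) auto
  finally show "K * (x powr a * y powr b * z powr c) \<le> a * (\<epsilon> * x) + \<epsilon> * y + C * z" by simp
qed

definition gpow :: "real \<Rightarrow> nat \<Rightarrow> (real^'n::finite \<Rightarrow> real) \<Rightarrow> real" where
  "gpow q i f = (\<Sum>\<alpha>\<in>mind i. LINT x|lborel. \<bar>pdl \<alpha> f x\<bar> powr q)"

lemma gpow_2: "gpow 2 i f = gsq i f"
  by (simp add: gpow_def gsq_def Lsq_def)

lemma sum_mind_diag_le:
  fixes F :: "'n::finite list \<Rightarrow> real"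
  assumes "\<And>\<alpha>. F \<alpha> \<ge> 0"
  shows "(\<Sum>j\<in>UNIV. \<Sum>\<alpha>\<in>mind i. F (j # j # \<alpha>)) \<le> (\<Sum>\<alpha>\<in>mind (Suc (Suc i)). F \<alpha>)"
proof -
  have "(\<Sum>\<alpha>\<in>mind i. F (j # j # \<alpha>)) \<le> (\<Sum>k\<in>UNIV. \<Sum>\<alpha>\<in>mind i. F (j # k # \<alpha>))" for j
    by (rule member_le_sum[of j UNIV "\<lambda>k. \<Sum>\<alpha>\<in>mind i. F (j # k # \<alpha>)"]) (auto intro!: sum_nonneg assms)
  then show ?thesis by (simp add: sum_mind_Suc sum_mono)
qed

lemma gpow_first_le:
  assumes l: "l \<ge> (2::nat)"
  shows "\<exists>C>0. \<forall>f :: real^'n::finite \<Rightarrow> real. Hinf f \<longrightarrow> (\<forall>x. \<bar>f x\<bar> \<le> 1) \<longrightarrow>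
    gpow (2 * real l) 1 f \<le> C * gpow (real l) 2 f"
proof -
  define q where "q = 2 * real l"
  have q: "q > 2" using l by (simp add: q_def)
  obtain C where C: "C > 0" "\<And>x y z. \<lbrakk>x > 0 \<or> (0::real) > 0 \<and> x \<ge> 0; y \<ge> 0; z \<ge> 0\<rbrakk> \<Longrightarrow>
      (q - 1) * (x powr 0 * y powr (1 - 2 / q) * z powr (2 / q)) \<le> 0 * (1 / 2 * x) + 1 / 2 * y + C * z"
    using q by (rule_tac interpolation_Young[of 0 "1 - 2 / q" "2 / q" "q - 1" "1 / 2"]) auto
  have Y: "(q - 1) * (u * a powr (q - 2) * c) \<le> 1 / 2 * a powr q + C * c powr real l"
    if "0 \<le> u" "u \<le> 1" "a \<ge> 0" "c \<ge> 0" for u a c :: real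
  proof -
    have "(a powr q) powr (1 - 2 / q) = a powr (q - 2)"
      using q by (simp add: powr_powr right_diff_distrib)
    moreover have "(c powr real l) powr (2 / q) = c"
      using q that by (simp add: powr_powr q_def)
    ultimately have "(q - 1) * (1 * a powr (q - 2) * c) \<le> 1 / 2 * a powr q + C * c powr real l"
      using C(2)[of 1 "a powr q" "c powr real l"] by simp
    moreover have "(q - 1) * (u * a powr (q - 2) * c) \<le> (q - 1) * (1 * a powr (q - 2) * c)"
      using that q by (intro mult_left_mono mult_right_mono) auto
    ultimately show ?thesis by linarith
  qed
  have "gpow q 1 f \<le> 2 * C * gpow (real l) 2 f" if f: "Hinf f" and b: "\<forall>x. \<bar>f x\<bar> \<le> 1" for f :: "real^'n \<Rightarrow> real"
  proof -
    have le: "(LINT x|lborel. \<bar>pd j f x\<bar> powr q) \<le>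
        1 / 2 * (LINT x|lborel. \<bar>pd j f x\<bar> powr q) + C * (LINT x|lborel. \<bar>pd j (pd j f) x\<bar> powr real l)" for j
    proof -
      have i1: "integrable lborel (\<lambda>x. \<bar>pd j f x\<bar> powr q)"
        using Hinf_powr_integrable[OF f, of q "[j]"] q by simp
      have i2: "integrable lborel (\<lambda>x. \<bar>pd j (pd j f) x\<bar> powr real l)"
        using Hinf_powr_integrable[OF f, of "real l" "[j, j]"] l by simp
      have "(LINT x|lborel. \<bar>pd j f x\<bar> powr q) \<le>
          (LINT x|lborel. (q - 1) * (\<bar>f x\<bar> * \<bar>pd j f x\<bar> powr (q - 2) * \<bar>pd j (pd j f) x\<bar>))"
        by (rule integral_powr_derivative_le[OF f q])
      also have "\<dots> \<le> (LINT x|lborel. 1 / 2 * \<bar>pd j f x\<bar> powr q + C * \<bar>pd j (pd j f) x\<bar> powr real l)"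
        using i1 i2 b by (intro integral_mono integral_powr_derivative_le(2)[OF f q] Y) auto
      also have "\<dots> = 1 / 2 * (LINT x|lborel. \<bar>pd j f x\<bar> powr q) + C * (LINT x|lborel. \<bar>pd j (pd j f) x\<bar> powr real l)"
        using i1 i2 by (subst Bochner_Integration.integral_add) auto
      finally show ?thesis .
    qed
    have "(LINT x|lborel. \<bar>pd j f x\<bar> powr q) \<le> 2 * C * (LINT x|lborel. \<bar>pd j (pd j f) x\<bar> powr real l)" for j
      using le[of j] by simp
    then have "gpow q 1 f \<le> (\<Sum>j\<in>UNIV. 2 * C * (LINT x|lborel. \<bar>pd j (pd j f) x\<bar> powr real l))"
      unfolding gpow_def One_nat_def sum_mind_Suc by (intro sum_mono) (simp add: mind_0)
    also have "\<dots> = 2 * C * (\<Sum>j\<in>UNIV. \<Sum>\<alpha>\<in>mind 0. LINT x|lborel. \<bar>pdl (j # j # \<alpha>) f x\<bar> powr real l)"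
      by (simp add: sum_distrib_left mind_0)
    also have "\<dots> \<le> 2 * C * gpow (real l) 2 f"
      unfolding gpow_def numeral_2_eq_2 using C(1) by (intro mult_left_mono sum_mind_diag_le) auto
    finally show ?thesis .
  qed
  then show ?thesis using C(1) unfolding q_def by (intro exI[of _ "2 * C"]) auto
qed

lemma gpow_three_term:
  assumes i: "2 \<le> i" "i < l" and \<epsilon>: "\<epsilon> > 0"
  shows "\<exists>C>0. \<forall>f :: real^'n::finite \<Rightarrow> real. Hinf f \<longrightarrow>
    gpow (2 * real l / real i) i f \<le> \<epsilon> * (real CARD('n) * gpow (2 * real l / real (i - 1)) (i - 1) f)
      + \<epsilon> * gpow (2 * real l / real i) i f + C * gpow (2 * real l / real (i + 1)) (i + 1) f"
proof -
  define r q p where "r = 2 * real l / real (i - 1)" and "q = 2 * real l / real i" and "p = 2 * real l / real (i + 1)"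
  have q: "q > 2" using i by (simp add: q_def field_simps)
  have r: "r > 2" using i by (simp add: r_def field_simps)
  have p: "p \<ge> 2" using i by (simp add: p_def field_simps)
  have sum1: "1 / r + (1 - 2 / q) + 1 / p = 1"
    using i by (simp add: r_def q_def p_def field_simps of_nat_diff)
  have pos: "1 / r > 0" "1 / p > 0" "1 - 2 / q > 0" using r p q by auto
  obtain C where C: "C > 0" "\<And>x y z. \<lbrakk>x > 0 \<or> 1 / r > 0 \<and> x \<ge> 0; y \<ge> 0; z \<ge> 0\<rbrakk> \<Longrightarrow>
      (q - 1) * (x powr (1 / r) * y powr (1 - 2 / q) * z powr (1 / p)) \<le> 1 / r * (\<epsilon> * x) + \<epsilon> * y + C * z"
    using pos sum1 q \<epsilon> by (rule_tac interpolation_Young[of "1 / r" "1 - 2 / q" "1 / p" "q - 1" \<epsilon>]) auto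
  have Y: "(q - 1) * (u * a powr (q - 2) * c) \<le> \<epsilon> * u powr r + \<epsilon> * a powr q + C * c powr p"
    if "0 \<le> u" "a \<ge> 0" "c \<ge> 0" for u a c :: real
  proof -
    have "(a powr q) powr (1 - 2 / q) = a powr (q - 2)"
      using q by (simp add: powr_powr right_diff_distrib)
    moreover have "(c powr p) powr (1 / p) = c" "(u powr r) powr (1 / r) = u"
      using p r that by (simp_all add: powr_powr)
    ultimately have "(q - 1) * (u * a powr (q - 2) * c) \<le> 1 / r * (\<epsilon> * u powr r) + \<epsilon> * a powr q + C * c powr p"
      using C(2)[of "u powr r" "a powr q" "c powr p"] pos by simp
    moreover have "1 / r * (\<epsilon> * u powr r) \<le> 1 * (\<epsilon> * u powr r)"
      using r \<epsilon> by (intro mult_right_mono) auto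
    ultimately show ?thesis by linarith
  qed
  obtain i' where i': "i = Suc i'" using i by (cases i) auto
  have "gpow q i f \<le> \<epsilon> * (real CARD('n) * gpow r (i - 1) f) + \<epsilon> * gpow q i f + C * gpow p (i + 1) f"
    if f: "Hinf f" for f :: "real^'n \<Rightarrow> real"
  proof -
    have le: "(LINT x|lborel. \<bar>pdl (j # \<alpha>) f x\<bar> powr q) \<le>
        \<epsilon> * (LINT x|lborel. \<bar>pdl \<alpha> f x\<bar> powr r) + \<epsilon> * (LINT x|lborel. \<bar>pdl (j # \<alpha>) f x\<bar> powr q)
        + C * (LINT x|lborel. \<bar>pdl (j # j # \<alpha>) f x\<bar> powr p)" for j \<alpha>
    proof -
      have i1: "integrable lborel (\<lambda>x. \<bar>pdl (j # \<alpha>) f x\<bar> powr q)"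
        "integrable lborel (\<lambda>x. \<bar>pdl \<alpha> f x\<bar> powr r)"
        "integrable lborel (\<lambda>x. \<bar>pdl (j # j # \<alpha>) f x\<bar> powr p)"
        using Hinf_powr_integrable[OF f] q r p by (simp_all del: pdl.simps)
      have i2: "integrable lborel (\<lambda>x. \<epsilon> * \<bar>pdl \<alpha> f x\<bar> powr r + \<epsilon> * \<bar>pdl (j # \<alpha>) f x\<bar> powr q + C * \<bar>pdl (j # j # \<alpha>) f x\<bar> powr p)"
        by (intro Bochner_Integration.integrable_add integrable_mult_right i1)
      have "(LINT x|lborel. \<bar>pdl (j # \<alpha>) f x\<bar> powr q) \<le>
          (LINT x|lborel. (q - 1) * (\<bar>pdl \<alpha> f x\<bar> * \<bar>pd j (pdl \<alpha> f) x\<bar> powr (q - 2) * \<bar>pd j (pd j (pdl \<alpha> f)) x\<bar>))"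
        using integral_powr_derivative_le(1)[OF Hinf_pdl[OF f] q] by simp
      also have "\<dots> \<le> (LINT x|lborel. \<epsilon> * \<bar>pdl \<alpha> f x\<bar> powr r + \<epsilon> * \<bar>pdl (j # \<alpha>) f x\<bar> powr q + C * \<bar>pdl (j # j # \<alpha>) f x\<bar> powr p)"
        using Y by (intro integral_mono integral_powr_derivative_le(2)[OF Hinf_pdl[OF f] q] i2) simp
      also have "\<dots> = \<epsilon> * (LINT x|lborel. \<bar>pdl \<alpha> f x\<bar> powr r) + \<epsilon> * (LINT x|lborel. \<bar>pdl (j # \<alpha>) f x\<bar> powr q)
        + C * (LINT x|lborel. \<bar>pdl (j # j # \<alpha>) f x\<bar> powr p)"
        using i1 by (simp del: pdl.simps)
      finally show ?thesis .
    qed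
    have "gpow q i f = (\<Sum>j\<in>UNIV. \<Sum>\<alpha>\<in>mind i'. LINT x|lborel. \<bar>pdl (j # \<alpha>) f x\<bar> powr q)"
      by (simp add: gpow_def i' sum_mind_Suc)
    also have "\<dots> \<le> (\<Sum>j\<in>UNIV. \<Sum>\<alpha>\<in>mind i'. \<epsilon> * (LINT x|lborel. \<bar>pdl \<alpha> f x\<bar> powr r)
        + \<epsilon> * (LINT x|lborel. \<bar>pdl (j # \<alpha>) f x\<bar> powr q) + C * (LINT x|lborel. \<bar>pdl (j # j # \<alpha>) f x\<bar> powr p))"
      by (intro sum_mono le)
    also have "\<dots> = \<epsilon> * (real CARD('n) * gpow r i' f) + \<epsilon> * gpow q i f
        + C * (\<Sum>j\<in>UNIV. \<Sum>\<alpha>\<in>mind i'. (LINT x|lborel. \<bar>pdl (j # j # \<alpha>) f x\<bar> powr p))"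
      by (simp add: gpow_def i' sum_mind_Suc sum.distrib sum_distrib_left mult.left_commute del: pdl.simps)
    also have "\<dots> \<le> \<epsilon> * (real CARD('n) * gpow r i' f) + \<epsilon> * gpow q i f + C * gpow p (i + 1) f"
      unfolding gpow_def[of p] i' using C(1)
      by (intro add_left_mono mult_left_mono) (auto intro!: sum_mind_diag_le simp del: pdl.simps)
    finally show ?thesis by (simp add: i')
  qed
  then show ?thesis using C(1) unfolding r_def q_def p_def by blast
qed

lemma gpow_step:
  assumes "1 \<le> i" "i < l"
  shows "\<exists>C>0. \<forall>f :: real^'n::finite \<Rightarrow> real. Hinf f \<longrightarrow> (\<forall>x. \<bar>f x\<bar> \<le> 1) \<longrightarrow>
    gpow (2 * real l / real i) i f \<le> C * gpow (2 * real l / real (i + 1)) (i + 1) f"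
  using assms
proof (induction i rule: dec_induct)
  case base
  then show ?case using gpow_first_le[of l, where 'n = 'n] by (simp add: numeral_2_eq_2)
next
  case (step i)
  then obtain C1 where C1: "C1 > 0" "\<And>f :: real^'n \<Rightarrow> real. Hinf f \<Longrightarrow> (\<forall>x. \<bar>f x\<bar> \<le> 1) \<Longrightarrow>
    gpow (2 * real l / real i) i f \<le> C1 * gpow (2 * real l / real (Suc i)) (Suc i) f" by auto
  define \<epsilon> where "\<epsilon> = 1 / (2 * (real CARD('n) * C1 + 1))"
  have n: "real CARD('n) * C1 \<ge> 0" using C1 by simp
  then have \<epsilon>: "\<epsilon> > 0" unfolding \<epsilon>_def by simp
  obtain C2 where C2: "C2 > 0" "\<And>f :: real^'n \<Rightarrow> real. Hinf f \<Longrightarrow>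
    gpow (2 * real l / real (Suc i)) (Suc i) f \<le> \<epsilon> * (real CARD('n) * gpow (2 * real l / real i) i f)
      + \<epsilon> * gpow (2 * real l / real (Suc i)) (Suc i) f + C2 * gpow (2 * real l / real (Suc i + 1)) (Suc i + 1) f"
    using gpow_three_term[of "Suc i" l \<epsilon>, where 'n = 'n] step \<epsilon> by auto
  have "gpow (2 * real l / real (Suc i)) (Suc i) f \<le> 2 * C2 * gpow (2 * real l / real (Suc i + 1)) (Suc i + 1) f"
    if f: "Hinf f" "\<forall>x. \<bar>f x\<bar> \<le> 1" for f :: "real^'n \<Rightarrow> real"
  proof -
    let ?K = "gpow (2 * real l / real (Suc i)) (Suc i) f"
    have "\<epsilon> * (real CARD('n) * gpow (2 * real l / real i) i f) \<le> \<epsilon> * (real CARD('n) * (C1 * ?K))"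
      using \<epsilon> C1(2)[OF f] by (intro mult_left_mono) auto
    moreover have "\<epsilon> * (real CARD('n) * (C1 * ?K)) + \<epsilon> * ?K = \<epsilon> * (real CARD('n) * C1 + 1) * ?K"
      by (simp add: algebra_simps)
    moreover have "\<epsilon> * (real CARD('n) * C1 + 1) = 1 / 2"
      using n by (simp add: \<epsilon>_def field_simps)
    ultimately show ?thesis using C2(2)[OF f(1)] by simp
  qed
  then show ?case using C2(1) by (intro exI[of _ "2 * C2"]) auto
qed

lemma gpow_le_gsq:
  assumes "1 \<le> i" "i \<le> l"
  shows "\<exists>C>0. \<forall>f :: real^'n::finite \<Rightarrow> real. Hinf f \<longrightarrow> (\<forall>x. \<bar>f x\<bar> \<le> 1) \<longrightarrow>
    gpow (2 * real l / real i) i f \<le> C * gsq l f"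
  using assms(2,1)
proof (induction i rule: inc_induct)
  case base
  then show ?case by (intro exI[of _ 1]) (auto simp: gpow_2)
next
  case (step i)
  then obtain C1 where C1: "C1 > 0" "\<And>f :: real^'n \<Rightarrow> real. Hinf f \<Longrightarrow> (\<forall>x. \<bar>f x\<bar> \<le> 1) \<Longrightarrow>
    gpow (2 * real l / real (Suc i)) (Suc i) f \<le> C1 * gsq l f" by auto
  obtain C2 where C2: "C2 > 0" "\<And>f :: real^'n \<Rightarrow> real. Hinf f \<Longrightarrow> (\<forall>x. \<bar>f x\<bar> \<le> 1) \<Longrightarrow>
    gpow (2 * real l / real i) i f \<le> C2 * gpow (2 * real l / real (i + 1)) (i + 1) f"
    using gpow_step[of i l, where 'n = 'n] step by auto
  have "gpow (2 * real l / real i) i f \<le> C2 * C1 * gsq l f"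
    if f: "Hinf f" "\<forall>x. \<bar>f x\<bar> \<le> 1" for f :: "real^'n \<Rightarrow> real"
  proof -
    have "C2 * gpow (2 * real l / real (Suc i)) (Suc i) f \<le> C2 * (C1 * gsq l f)"
      using C1(2)[OF f] C2(1) by (intro mult_left_mono) auto
    then show ?thesis using C2(2)[OF f] by simp
  qed
  then show ?case using C1(1) C2(1) by (intro exI[of _ "C2 * C1"]) auto
qed

section \<open>Products\<close>


lemma sq_integrable_lincomb:
  fixes u v :: "'a::euclidean_space \<Rightarrow> real"
  assumes [measurable]: "u \<in> borel_measurable borel" "v \<in> borel_measurable borel"
    and i: "integrable lborel (\<lambda>x. (u x)\<^sup>2)" "integrable lborel (\<lambda>x. (v x)\<^sup>2)"
  shows "integrable lborel (\<lambda>x. (a * u x + b * v x)\<^sup>2)"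
    and "(LINT x|lborel. (a * u x + b * v x)\<^sup>2) \<le> 2 * a\<^sup>2 * (LINT x|lborel. (u x)\<^sup>2) + 2 * b\<^sup>2 * (LINT x|lborel. (v x)\<^sup>2)"
proof -
  have le: "(a * u x + b * v x)\<^sup>2 \<le> 2 * a\<^sup>2 * (u x)\<^sup>2 + 2 * b\<^sup>2 * (v x)\<^sup>2" for x
    using sum_squares_bound[of "a * u x" "b * v x"] by (simp add: power2_sum power_mult_distrib)
  have i2: "integrable lborel (\<lambda>x. 2 * a\<^sup>2 * (u x)\<^sup>2 + 2 * b\<^sup>2 * (v x)\<^sup>2)"
    using i by simp
  show i3: "integrable lborel (\<lambda>x. (a * u x + b * v x)\<^sup>2)"
    by (rule Bochner_Integration.integrable_bound[OF i2]) (use le in auto)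
  have "(LINT x|lborel. (a * u x + b * v x)\<^sup>2) \<le> (LINT x|lborel. 2 * a\<^sup>2 * (u x)\<^sup>2 + 2 * b\<^sup>2 * (v x)\<^sup>2)"
    by (intro integral_mono i2 i3 le)
  also have "\<dots> = 2 * a\<^sup>2 * (LINT x|lborel. (u x)\<^sup>2) + 2 * b\<^sup>2 * (LINT x|lborel. (v x)\<^sup>2)"
    using i by simp
  finally show "(LINT x|lborel. (a * u x + b * v x)\<^sup>2) \<le> 2 * a\<^sup>2 * (LINT x|lborel. (u x)\<^sup>2) + 2 * b\<^sup>2 * (LINT x|lborel. (v x)\<^sup>2)" .
qed

lemma Hinf_iff: "Hinf f \<longleftrightarrow> smooth_fun f \<and> sq_int_from 0 f"
  unfolding Hinf_def sq_int_from_def using smooth_fun_measurable by auto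

lemma Hinf_pdl_from:
  assumes "smooth_fun f" "sq_int_from m f" "m \<le> length \<alpha>"
  shows "Hinf (pdl \<alpha> f)"
  using assms unfolding Hinf_iff sq_int_from_def
  by (auto simp: smooth_fun_pdl pdl_append[symmetric])

lemma gsq_lincomb_le:
  assumes f: "smooth_fun f" "sq_int_from m f" and g: "smooth_fun g" "sq_int_from m g" and k: "m \<le> k"
  shows "gsq k (\<lambda>x. a * f x + b * g x) \<le> 2 * a\<^sup>2 * gsq k f + 2 * b\<^sup>2 * gsq k g"
proof -
  have "Lsq (\<lambda>x. a * pdl \<alpha> f x + b * pdl \<alpha> g x) \<le> 2 * a\<^sup>2 * Lsq (pdl \<alpha> f) + 2 * b\<^sup>2 * Lsq (pdl \<alpha> g)"
    if "\<alpha> \<in> mind k" for \<alpha>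
    unfolding Lsq_def using that f g k
    by (intro sq_integrable_lincomb) (auto simp: sq_int_from_def mind_def)
  then have "gsq k (\<lambda>x. a * f x + b * g x) \<le> (\<Sum>\<alpha>\<in>mind k. 2 * a\<^sup>2 * Lsq (pdl \<alpha> f) + 2 * b\<^sup>2 * Lsq (pdl \<alpha> g))"
    unfolding gsq_def using f g
    by (intro sum_mono) (simp add: pdl_lincomb smooth_fun_imp_all_partials)
  also have "\<dots> = 2 * a\<^sup>2 * gsq k f + 2 * b\<^sup>2 * gsq k g"
    by (simp add: gsq_def sum.distrib sum_distrib_left)
  finally show ?thesis .
qed

lemma sq_int_from_lincomb:
  assumes f: "smooth_fun f" "sq_int_from m f" and g: "smooth_fun g" "sq_int_from m g"
  shows "sq_int_from m (\<lambda>x. a * f x + b * g x)"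
  using assms unfolding sq_int_from_def
  by (auto simp: pdl_lincomb smooth_fun_imp_all_partials intro!: sq_integrable_lincomb(1)
      borel_measurable_add borel_measurable_times)

lemma Hinf_lincomb: "Hinf f \<Longrightarrow> Hinf g \<Longrightarrow> Hinf (\<lambda>x. a * f x + b * g x)"
  by (simp add: Hinf_iff smooth_fun_lincomb sq_int_from_lincomb)

lemma pdl_cmult: "all_partials f \<Longrightarrow> pdl \<alpha> (\<lambda>x. a * f x) = (\<lambda>x. a * pdl \<alpha> f x)"
  using pdl_lincomb[of f f \<alpha> a 0] by simp

lemma Hinf_cmult: "Hinf f \<Longrightarrow> Hinf (\<lambda>x. a * f x)"
  using Hinf_lincomb[of f f a 0] by simp

lemma gsq_cmult:
  assumes "all_partials f"
  shows "gsq k (\<lambda>x. a * f x) = a\<^sup>2 * gsq k f"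
  unfolding gsq_def Lsq_def by (simp add: pdl_cmult[OF assms] power_mult_distrib sum_distrib_left)

lemma Hinf_zero: "Hinf (\<lambda>x. 0)"
  by (simp add: Hinf_def smooth_fun_def pdl_zero all_partials_zero)

lemma Hinf_sum:
  assumes "finite A" "\<And>i. i \<in> A \<Longrightarrow> Hinf (f i)"
  shows "Hinf (\<lambda>x. \<Sum>i\<in>A. f i x)"
  using assms
proof (induction A rule: finite_induct)
  case (insert j A)
  then show ?case using Hinf_lincomb[of "f j" "\<lambda>x. \<Sum>i\<in>A. f i x" 1 1] by simp
qed (simp add: Hinf_zero)

lemma sum_list_squared_le: "(\<Sum>p\<leftarrow>L. h p)\<^sup>2 \<le> real (length L) * (\<Sum>p\<leftarrow>L. (h p)\<^sup>2)" for h :: "'a \<Rightarrow> real"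
  using sum_squared_le_sum_of_squares[of "\<lambda>i. h (L ! i)" "{0..<length L}"]
  by (simp add: sum_list_sum_nth mult.commute)

lemma integral_sum_list:
  fixes h :: "'b \<Rightarrow> 'a \<Rightarrow> real"
  assumes "\<And>p. p \<in> set L \<Longrightarrow> integrable M (h p)"
  shows "integrable M (\<lambda>x. \<Sum>p\<leftarrow>L. h p x) \<and> (LINT x|M. (\<Sum>p\<leftarrow>L. h p x)) = (\<Sum>p\<leftarrow>L. LINT x|M. h p x)"
  using assms by (induction L) auto

lemma Hinf_mult_sq_integrable:
  assumes f: "Hinf f" and g: "Hinf g"
  shows "integrable lborel (\<lambda>x. (pdl \<beta> f x * pdl \<gamma> g x)\<^sup>2)"
proof -
  obtain B where B: "B > 0" "\<And>x. \<bar>pdl \<beta> f x\<bar> \<le> B" using Hinf_bounded[OF f] by metis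
  have "\<bar>(pdl \<beta> f x)\<^sup>2\<bar> \<le> B\<^sup>2" for x
    using B(2)[of x] B(1) by (simp add: abs_le_square_iff[symmetric])
  moreover have [measurable]: "pdl \<beta> f \<in> borel_measurable borel" by (rule Hinf_measurable[OF f])
  ultimately show ?thesis unfolding power_mult_distrib
    by (intro integrable_mult_bounded[where B = "B\<^sup>2"] Hinf_sq_integrable[OF g]) auto
qed

lemma smooth_fun_mult:
  assumes f: "smooth_fun f" and g: "smooth_fun g"
  shows "smooth_fun (\<lambda>x. f x * g x)"
proof -
  note ap = smooth_fun_imp_all_partials
  have "continuous_on UNIV (\<lambda>x. \<Sum>p\<leftarrow>L. pdl (fst p) f x * pdl (snd p) g x)" for L
    by (induction L) (auto intro!: continuous_intros smooth_fun_continuous f g)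
  then show ?thesis
    unfolding smooth_fun_def using all_partials_mult[OF ap[OF f] ap[OF g]]
    by (simp add: pdl_mult[OF ap[OF f] ap[OF g]])
qed

lemma Lsq_pdl_mult_le:
  assumes f: "Hinf f" and g: "Hinf g"
  shows "integrable lborel (\<lambda>x. (pdl \<alpha> (\<lambda>x. f x * g x) x)\<^sup>2)"
    and "Lsq (pdl \<alpha> (\<lambda>x. f x * g x)) \<le>
      2 ^ length \<alpha> * (\<Sum>p\<leftarrow>leibniz_splits \<alpha>. LINT x|lborel. (pdl (fst p) f x * pdl (snd p) g x)\<^sup>2)"
proof -
  let ?L = "leibniz_splits \<alpha>" and ?h = "\<lambda>p x. pdl (fst p) f x * pdl (snd p) g x"
  note ap = smooth_fun_imp_all_partials[OF Hinf_imp_smooth_fun]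
  have eq: "pdl \<alpha> (\<lambda>x. f x * g x) x = (\<Sum>p\<leftarrow>?L. ?h p x)" for x
    by (simp add: pdl_mult[OF ap[OF f] ap[OF g]])
  have le: "(pdl \<alpha> (\<lambda>x. f x * g x) x)\<^sup>2 \<le> 2 ^ length \<alpha> * (\<Sum>p\<leftarrow>?L. (?h p x)\<^sup>2)" for x
    using sum_list_squared_le[of "\<lambda>p. ?h p x" ?L] by (simp add: eq length_leibniz_splits)
  have I: "integrable lborel (\<lambda>x. \<Sum>p\<leftarrow>?L. (?h p x)\<^sup>2) \<and>
      (LINT x|lborel. (\<Sum>p\<leftarrow>?L. (?h p x)\<^sup>2)) = (\<Sum>p\<leftarrow>?L. LINT x|lborel. (?h p x)\<^sup>2)"
    by (intro integral_sum_list Hinf_mult_sq_integrable f g)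
  then have I2: "integrable lborel (\<lambda>x. 2 ^ length \<alpha> * (\<Sum>p\<leftarrow>?L. (?h p x)\<^sup>2))" by simp
  have [measurable]: "pdl \<alpha> (\<lambda>x. f x * g x) \<in> borel_measurable borel"
    by (intro smooth_fun_measurable smooth_fun_mult Hinf_imp_smooth_fun f g)
  show I3: "integrable lborel (\<lambda>x. (pdl \<alpha> (\<lambda>x. f x * g x) x)\<^sup>2)"
    by (rule Bochner_Integration.integrable_bound[OF I2]) (use le in \<open>auto intro: order_trans[OF _ abs_ge_self]\<close>)
  have "Lsq (pdl \<alpha> (\<lambda>x. f x * g x)) \<le> (LINT x|lborel. 2 ^ length \<alpha> * (\<Sum>p\<leftarrow>?L. (?h p x)\<^sup>2))"
    unfolding Lsq_def by (intro integral_mono I2 I3 le)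
  then show "Lsq (pdl \<alpha> (\<lambda>x. f x * g x)) \<le> 2 ^ length \<alpha> * (\<Sum>p\<leftarrow>?L. LINT x|lborel. (?h p x)\<^sup>2)"
    using I by simp
qed

lemma Hinf_mult: "Hinf f \<Longrightarrow> Hinf g \<Longrightarrow> Hinf (\<lambda>x. f x * g x)"
  using smooth_fun_mult Lsq_pdl_mult_le(1) unfolding Hinf_def by blast

lemma power2_powr_abs: "(x\<^sup>2) powr p = \<bar>x\<bar> powr (2 * p)" for x p :: real
proof (cases "x = 0")
  case False
  then have "x\<^sup>2 = \<bar>x\<bar> powr 2" by simp
  then show ?thesis by (simp only: powr_powr)
qed auto

lemma gpow_le_gsq_uniform:
  "\<exists>C>0. \<forall>i\<in>{1..l}. \<forall>f :: real^'n::finite \<Rightarrow> real. Hinf f \<longrightarrow> (\<forall>x. \<bar>f x\<bar> \<le> 1) \<longrightarrow>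
    gpow (2 * real l / real i) i f \<le> C * gsq l f"
proof -
  have "\<forall>i\<in>{1..l}. \<exists>C>0. \<forall>f :: real^'n \<Rightarrow> real. Hinf f \<longrightarrow> (\<forall>x. \<bar>f x\<bar> \<le> 1) \<longrightarrow>
    gpow (2 * real l / real i) i f \<le> C * gsq l f"
    using gpow_le_gsq[where 'n = 'n] by auto
  then obtain c where c: "\<And>i. i \<in> {1..l} \<Longrightarrow> c i > 0"
    "\<And>i f. i \<in> {1..l} \<Longrightarrow> Hinf f \<Longrightarrow> \<forall>x. \<bar>f x\<bar> \<le> 1 \<Longrightarrow>
      gpow (2 * real l / real i) i (f :: real^'n \<Rightarrow> real) \<le> c i * gsq l f"
    by metis
  define C where "C = (\<Sum>i\<in>{1..l}. c i) + 1"
  have pos: "(\<Sum>i\<in>{1..l}. c i) \<ge> 0" using c(1) by (intro sum_nonneg) (auto intro: less_imp_le)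
  have "c i * gsq l f \<le> C * gsq l f" if "i \<in> {1..l}" for i and f :: "real^'n \<Rightarrow> real"
  proof -
    have "c i \<le> (\<Sum>i\<in>{1..l}. c i)" using that c(1) by (intro member_le_sum) (auto intro: less_imp_le)
    then show ?thesis by (intro mult_right_mono gsq_nonneg) (simp add: C_def)
  qed
  then have "\<forall>i\<in>{1..l}. \<forall>f :: real^'n \<Rightarrow> real. Hinf f \<longrightarrow> (\<forall>x. \<bar>f x\<bar> \<le> 1) \<longrightarrow>
    gpow (2 * real l / real i) i f \<le> C * gsq l f"
    using c(2) by (meson order_trans)
  then show ?thesis using pos by (intro exI[of _ C]) (simp add: C_def)
qed

lemma product_L2_le_normalized:
  assumes l: "l \<ge> 1"
  shows "\<exists>C>0. \<forall>(f :: real^'n::finite \<Rightarrow> real) g \<beta> \<gamma>. Hinf f \<longrightarrow> Hinf g \<longrightarrow>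
    (\<forall>x. \<bar>f x\<bar> \<le> 1) \<longrightarrow> (\<forall>x. \<bar>g x\<bar> \<le> 1) \<longrightarrow> length \<beta> + length \<gamma> = l \<longrightarrow>
    (LINT x|lborel. (pdl \<beta> f x * pdl \<gamma> g x)\<^sup>2) \<le> C * (gsq l f + gsq l g)"
proof -
  obtain C where C: "C > 0" "\<And>i f. i \<in> {1..l} \<Longrightarrow> Hinf f \<Longrightarrow> \<forall>x. \<bar>f x\<bar> \<le> 1 \<Longrightarrow>
      gpow (2 * real l / real i) i (f :: real^'n \<Rightarrow> real) \<le> C * gsq l f"
    using gpow_le_gsq_uniform[of l, where 'n = 'n] by metis
  have "(LINT x|lborel. (pdl \<beta> f x * pdl \<gamma> g x)\<^sup>2) \<le> (C + 1) * (gsq l f + gsq l g)"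
    if f: "Hinf f" "\<forall>x. \<bar>f x\<bar> \<le> 1" and g: "Hinf g" "\<forall>x. \<bar>g x\<bar> \<le> 1" and len: "length \<beta> + length \<gamma> = l"
    for f g :: "real^'n \<Rightarrow> real" and \<beta> \<gamma>
  proof -
    have nn: "C * (gsq l f + gsq l g) \<ge> 0" using C(1) by (simp add: gsq_nonneg)
    have int: "integrable lborel (\<lambda>x. (pdl \<beta> f x * pdl \<gamma> g x)\<^sup>2)"
      by (rule Hinf_mult_sq_integrable[OF f(1) g(1)])
    consider "\<beta> = []" | "\<gamma> = []" | "\<beta> \<noteq> []" "\<gamma> \<noteq> []" by blast
    then show ?thesis
    proof cases
      case 1
      have "(f x * pdl \<gamma> g x)\<^sup>2 \<le> (pdl \<gamma> g x)\<^sup>2" for x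
        using f(2) by (simp add: power_mult_distrib mult_left_le_one_le abs_square_le_1)
      then have "(LINT x|lborel. (pdl \<beta> f x * pdl \<gamma> g x)\<^sup>2) \<le> Lsq (pdl \<gamma> g)"
        unfolding Lsq_def using 1 by (intro integral_mono int Hinf_sq_integrable g) auto
      also have "\<dots> \<le> gsq l g" using len 1 by (intro Lsq_pdl_le_gsq) (simp add: mind_def)
      finally show ?thesis using nn gsq_nonneg[of l f] by (simp add: algebra_simps)
    next
      case 2
      have "(pdl \<beta> f x * g x)\<^sup>2 \<le> (pdl \<beta> f x)\<^sup>2" for x
        using g(2) by (simp add: power_mult_distrib mult_right_le_one_le abs_square_le_1)
      then have "(LINT x|lborel. (pdl \<beta> f x * pdl \<gamma> g x)\<^sup>2) \<le> Lsq (pdl \<beta> f)"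
        unfolding Lsq_def using 2 by (intro integral_mono int Hinf_sq_integrable f) auto
      also have "\<dots> \<le> gsq l f" using len 2 by (intro Lsq_pdl_le_gsq) (simp add: mind_def)
      finally show ?thesis using nn gsq_nonneg[of l g] by (simp add: algebra_simps)
    next
      case 3
      define p q where "p = real l / real (length \<beta>)" and "q = real l / real (length \<gamma>)"
      have pos: "length \<beta> > 0" "length \<gamma> > 0" using 3 by auto
      have lr: "real l = real (length \<beta>) + real (length \<gamma>)" using len by simp
      have pq: "p > 1" "q > 1" using pos by (auto simp: p_def q_def lr)
      have pq1: "1 / p + 1 / q = 1"
        unfolding p_def q_def using l lr by (simp add: add_divide_distrib[symmetric])
      have Y: "(x * y)\<^sup>2 \<le> \<bar>x\<bar> powr (2 * p) + \<bar>y\<bar> powr (2 * q)" for x y :: real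
      proof -
        have "x\<^sup>2 * y\<^sup>2 \<le> \<bar>x\<bar> powr (2 * p) / p + \<bar>y\<bar> powr (2 * q) / q"
          using Youngs_inequality[OF pq pq1, of "x\<^sup>2" "y\<^sup>2"] by (simp add: power2_powr_abs)
        also have "\<dots> \<le> \<bar>x\<bar> powr (2 * p) / 1 + \<bar>y\<bar> powr (2 * q) / 1"
          using pq by (intro add_mono divide_left_mono) auto
        finally show ?thesis by (simp add: power_mult_distrib)
      qed
      have i: "integrable lborel (\<lambda>x. \<bar>pdl \<beta> f x\<bar> powr (2 * p))" "integrable lborel (\<lambda>x. \<bar>pdl \<gamma> g x\<bar> powr (2 * q))"
        using pq by (auto intro!: Hinf_powr_integrable f g)
      have "(LINT x|lborel. (pdl \<beta> f x * pdl \<gamma> g x)\<^sup>2) \<le> (LINT x|lborel. \<bar>pdl \<beta> f x\<bar> powr (2 * p) + \<bar>pdl \<gamma> g x\<bar> powr (2 * q))"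
        by (intro integral_mono int Bochner_Integration.integrable_add i Y)
      also have "\<dots> = (LINT x|lborel. \<bar>pdl \<beta> f x\<bar> powr (2 * p)) + (LINT x|lborel. \<bar>pdl \<gamma> g x\<bar> powr (2 * q))"
        using i by simp
      also have "\<dots> \<le> gpow (2 * p) (length \<beta>) f + gpow (2 * q) (length \<gamma>) g"
        unfolding gpow_def
        by (intro add_mono member_le_sum[where f = "\<lambda>\<alpha>. LINT x|lborel. \<bar>pdl \<alpha> f x\<bar> powr (2 * p)"]
            member_le_sum[where f = "\<lambda>\<alpha>. LINT x|lborel. \<bar>pdl \<alpha> g x\<bar> powr (2 * q)"])
          (use finite_mind in \<open>auto simp: mind_def\<close>)
      also have "\<dots> \<le> C * gsq l f + C * gsq l g"
        using C(2)[of "length \<beta>" f] C(2)[of "length \<gamma>" g] f g pos len by (simp add: p_def q_def)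
      also have "\<dots> \<le> (C + 1) * (gsq l f + gsq l g)"
        using gsq_nonneg[of l f] gsq_nonneg[of l g] by (simp add: algebra_simps)
      finally show ?thesis .
    qed
  qed
  then show ?thesis using C(1) by (intro exI[of _ "C + 1"]) auto
qed

lemma gsq_mult_le_normalized:
  assumes l: "l \<ge> 1"
  shows "\<exists>C>0. \<forall>(f :: real^'n::finite \<Rightarrow> real) g. Hinf f \<longrightarrow> Hinf g \<longrightarrow>
    (\<forall>x. \<bar>f x\<bar> \<le> 1) \<longrightarrow> (\<forall>x. \<bar>g x\<bar> \<le> 1) \<longrightarrow>
    gsq l (\<lambda>x. f x * g x) \<le> C * (gsq l f + gsq l g)"
proof -
  obtain C where C: "C > 0" "\<forall>(f :: real^'n \<Rightarrow> real) g \<beta> \<gamma>. Hinf f \<longrightarrow> Hinf g \<longrightarrow>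
    (\<forall>x. \<bar>f x\<bar> \<le> 1) \<longrightarrow> (\<forall>x. \<bar>g x\<bar> \<le> 1) \<longrightarrow> length \<beta> + length \<gamma> = l \<longrightarrow>
    (LINT x|lborel. (pdl \<beta> f x * pdl \<gamma> g x)\<^sup>2) \<le> C * (gsq l f + gsq l g)"
    using product_L2_le_normalized[OF l, where 'n = 'n] by blast
  define C' where "C' = real CARD('n) ^ l * (2 ^ l * (2 ^ l * C))"
  have "gsq l (\<lambda>x. f x * g x) \<le> C' * (gsq l f + gsq l g)"
    if H: "Hinf f" "Hinf g" "\<forall>x. \<bar>f x\<bar> \<le> 1" "\<forall>x. \<bar>g x\<bar> \<le> 1" for f g :: "real^'n \<Rightarrow> real"
  proof -
    let ?X = "C * (gsq l f + gsq l g)"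
    have "Lsq (pdl \<alpha> (\<lambda>x. f x * g x)) \<le> 2 ^ l * (2 ^ l * ?X)" if \<alpha>: "\<alpha> \<in> mind l" for \<alpha>
    proof -
      have len: "length \<alpha> = l" using \<alpha> by (simp add: mind_def)
      have "(\<Sum>p\<leftarrow>leibniz_splits \<alpha>. LINT x|lborel. (pdl (fst p) f x * pdl (snd p) g x)\<^sup>2) \<le> (\<Sum>p\<leftarrow>leibniz_splits \<alpha>. ?X)"
      proof (rule sum_list_mono)
        fix p assume "p \<in> set (leibniz_splits \<alpha>)"
        then have "length (fst p) + length (snd p) = l"
          using leibniz_splits_lengths[of "fst p" "snd p" \<alpha>] len by simp
        then show "(LINT x|lborel. (pdl (fst p) f x * pdl (snd p) g x)\<^sup>2) \<le> ?X"
          using C(2) H by blast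
      qed
      also have "\<dots> = 2 ^ l * ?X"
        by (simp add: sum_list_triv length_leibniz_splits len)
      finally show ?thesis
        using order_trans[OF Lsq_pdl_mult_le(2)[OF H(1,2), of \<alpha>] mult_left_mono[of _ "2 ^ l * ?X" "2 ^ length \<alpha>"]]
        by (simp add: len)
    qed
    then have "gsq l (\<lambda>x. f x * g x) \<le> (\<Sum>\<alpha>\<in>(mind l :: 'n list set). 2 ^ l * (2 ^ l * ?X))"
      unfolding gsq_def by (intro sum_mono)
    then show ?thesis by (simp add: C'_def card_mind mult_ac)
  qed
  moreover have "C' > 0" using C(1) by (simp add: C'_def)
  ultimately show ?thesis by blast
qed

lemma gsq_mult_le:
  assumes l: "l \<ge> 1"
  shows "\<exists>C>0. \<forall>(f :: real^'n::finite \<Rightarrow> real) g S. Hinf f \<longrightarrow> Hinf g \<longrightarrow> S > 0 \<longrightarrow>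
    (\<forall>x. \<bar>f x\<bar> \<le> S) \<longrightarrow> (\<forall>x. \<bar>g x\<bar> \<le> S) \<longrightarrow>
    gsq l (\<lambda>x. f x * g x) \<le> C * S\<^sup>2 * (gsq l f + gsq l g)"
proof -
  obtain C where C: "C > 0" "\<forall>(f :: real^'n \<Rightarrow> real) g. Hinf f \<longrightarrow> Hinf g \<longrightarrow>
    (\<forall>x. \<bar>f x\<bar> \<le> 1) \<longrightarrow> (\<forall>x. \<bar>g x\<bar> \<le> 1) \<longrightarrow> gsq l (\<lambda>x. f x * g x) \<le> C * (gsq l f + gsq l g)"
    using gsq_mult_le_normalized[OF l, where 'n = 'n] by blast
  have "gsq l (\<lambda>x. f x * g x) \<le> C * S\<^sup>2 * (gsq l f + gsq l g)"
    if f: "Hinf f" "\<forall>x. \<bar>f x\<bar> \<le> S" and g: "Hinf g" "\<forall>x. \<bar>g x\<bar> \<le> S" and S: "S > 0"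
    for f g :: "real^'n \<Rightarrow> real" and S
  proof -
    note ap = smooth_fun_imp_all_partials[OF Hinf_imp_smooth_fun]
    have "gsq l (\<lambda>x. (1 / S * f x) * (1 / S * g x)) \<le> C * (gsq l (\<lambda>x. 1 / S * f x) + gsq l (\<lambda>x. 1 / S * g x))"
      using f g S by (intro C(2)[rule_format] Hinf_cmult) (auto simp: abs_mult)
    also have "(\<lambda>x. (1 / S * f x) * (1 / S * g x)) = (\<lambda>x. (1 / S)\<^sup>2 * (f x * g x))"
      by (simp add: power2_eq_square)
    also have "gsq l (\<lambda>x. (1 / S)\<^sup>2 * (f x * g x)) = ((1 / S)\<^sup>2)\<^sup>2 * gsq l (\<lambda>x. f x * g x)"
      by (rule gsq_cmult[OF ap[OF Hinf_mult[OF f(1) g(1)]]])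
    also have "gsq l (\<lambda>x. 1 / S * f x) = (1 / S)\<^sup>2 * gsq l f" by (rule gsq_cmult[OF ap[OF f(1)]])
    also have "gsq l (\<lambda>x. 1 / S * g x) = (1 / S)\<^sup>2 * gsq l g" by (rule gsq_cmult[OF ap[OF g(1)]])
    finally show ?thesis using S by (simp add: field_simps power2_eq_square)
  qed
  then show ?thesis using C(1) by (intro exI[of _ C]) auto
qed

section \<open>Elliptic identities\<close>


lemma integral_by_parts:
  fixes f g :: "real^'n::finite \<Rightarrow> real"
  assumes f: "Hinf f" and g: "Hinf g"
  shows "(LINT x|lborel. f x * pd i g x) = - (LINT x|lborel. pd i f x * g x)"
proof -
  have m: "f \<in> borel_measurable borel" "g \<in> borel_measurable borel" "pd i f \<in> borel_measurable borel" "pd i g \<in> borel_measurable borel"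
    using Hinf_measurable[OF f, of "[]"] Hinf_measurable[OF g, of "[]"] Hinf_measurable[OF f, of "[i]"] Hinf_measurable[OF g, of "[i]"] by simp_all
  have s: "integrable lborel (\<lambda>x. (f x)\<^sup>2)" "integrable lborel (\<lambda>x. (g x)\<^sup>2)"
    "integrable lborel (\<lambda>x. (pd i f x)\<^sup>2)" "integrable lborel (\<lambda>x. (pd i g x)\<^sup>2)"
    using Hinf_sq_integrable[OF f, of "[]"] Hinf_sq_integrable[OF g, of "[]"] Hinf_sq_integrable[OF f, of "[i]"] Hinf_sq_integrable[OF g, of "[i]"] by simp_all
  have c: "continuous_on UNIV f" "continuous_on UNIV g" "continuous_on UNIV (pd i f)" "continuous_on UNIV (pd i g)"
    using smooth_fun_continuous[OF Hinf_imp_smooth_fun[OF f], of "[]"] smooth_fun_continuous[OF Hinf_imp_smooth_fun[OF g], of "[]"]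
      smooth_fun_continuous[OF Hinf_imp_smooth_fun[OF f], of "[i]"] smooth_fun_continuous[OF Hinf_imp_smooth_fun[OF g], of "[i]"] by simp_all
  have i1: "integrable lborel (\<lambda>x. f x * pd i g x)" and i2: "integrable lborel (\<lambda>x. pd i f x * g x)"
    and i3: "integrable lborel (\<lambda>x. f x * g x)"
    using integrable_mult_L2 m s by blast+
  have "(LINT x|lborel. f x * pd i g x + pd i f x * g x) = 0"
  proof (rule integral_directional_derivative_eq_0[of "\<lambda>x. f x * g x" "axis i 1"])
    fix x :: "real^'n" and s :: real
    have Df: "((\<lambda>h. f (x + h *\<^sub>R axis i 1)) has_real_derivative pd i f (x + s *\<^sub>R axis i 1)) (at s)"
      and Dg: "((\<lambda>h. g (x + h *\<^sub>R axis i 1)) has_real_derivative pd i g (x + s *\<^sub>R axis i 1)) (at s)"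
      using all_partials_has_real_derivative[OF smooth_fun_imp_all_partials[OF Hinf_imp_smooth_fun[OF f]], of "[]"]
        all_partials_has_real_derivative[OF smooth_fun_imp_all_partials[OF Hinf_imp_smooth_fun[OF g]], of "[]"] by simp_all
    from DERIV_mult[OF Df Dg]
    show "((\<lambda>h. f (x + h *\<^sub>R axis i 1) * g (x + h *\<^sub>R axis i 1)) has_real_derivative
        f (x + s *\<^sub>R axis i 1) * pd i g (x + s *\<^sub>R axis i 1) + pd i f (x + s *\<^sub>R axis i 1) * g (x + s *\<^sub>R axis i 1)) (at s)"
      by (simp add: algebra_simps)
  qed (auto intro!: continuous_on_add continuous_on_mult c i1 i2 i3)
  then show ?thesis using i1 i2 by simp
qed

lemma pd_commute_fun: "smooth_fun f \<Longrightarrow> pd i (pd j f) = pd j (pd i f)"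
  using pd_commute by blast

lemma integral_second_partials:
  assumes u: "Hinf u"
  shows "(LINT x|lborel. (pd i (pd j u) x)\<^sup>2) = (LINT x|lborel. pd i (pd i u) x * pd j (pd j u) x)"
proof -
  note sf = Hinf_imp_smooth_fun[OF u]
  have H: "Hinf (pd i u)" "Hinf (pd j u)" "Hinf (pd i (pd j u))" "Hinf (pd i (pd i u))"
    using Hinf_pdl[OF u, of "[i]"] Hinf_pdl[OF u, of "[j]"] Hinf_pdl[OF u, of "[i, j]"] Hinf_pdl[OF u, of "[i, i]"] by simp_all
  have com: "pd i (pd i (pd j u)) = pd j (pd i (pd i u))"
    using pd_commute_fun[OF sf, of i j] pd_commute_fun[OF Hinf_imp_smooth_fun[OF H(1)], of i j] by simp
  have "(LINT x|lborel. (pd i (pd j u) x)\<^sup>2) = (LINT x|lborel. pd i (pd j u) x * pd i (pd j u) x)"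
    by (simp add: power2_eq_square)
  also have "\<dots> = - (LINT x|lborel. pd j u x * pd i (pd i (pd j u)) x)"
    using integral_by_parts[OF H(2) H(3), of i] by simp
  also have "\<dots> = - (LINT x|lborel. pd j u x * pd j (pd i (pd i u)) x)"
    by (simp only: com)
  also have "\<dots> = (LINT x|lborel. pd j (pd j u) x * pd i (pd i u) x)"
    using integral_by_parts[OF H(2) H(4), of j] by simp
  finally show ?thesis by (simp add: mult.commute)
qed

lemma Lsq_lap:
  assumes u: "Hinf u"
  shows "Lsq (lap u) = (\<Sum>i\<in>UNIV. \<Sum>j\<in>UNIV. Lsq (pd i (pd j u)))"
proof -
  have int: "integrable lborel (\<lambda>x. pd i (pd i u) x * pd j (pd j u) x)" for i j
    using integrable_mult_L2[OF Hinf_measurable[OF u, of "[i, i]"] Hinf_measurable[OF u, of "[j, j]"]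
      Hinf_sq_integrable[OF u, of "[i, i]"] Hinf_sq_integrable[OF u, of "[j, j]"]] by simp
  have "Lsq (lap u) = (LINT x|lborel. (\<Sum>i\<in>UNIV. \<Sum>j\<in>UNIV. pd i (pd i u) x * pd j (pd j u) x))"
    unfolding Lsq_def lap_def by (simp add: power2_eq_square sum_product)
  also have "\<dots> = (\<Sum>i\<in>UNIV. \<Sum>j\<in>UNIV. LINT x|lborel. pd i (pd i u) x * pd j (pd j u) x)"
    using int by (simp add: Bochner_Integration.integral_sum)
  finally show ?thesis
    by (simp add: Lsq_def integral_second_partials[OF u])
qed

lemma gsq_0: "gsq 0 f = Lsq f"
  by (simp add: gsq_def mind_0)

lemma gsq_eq_lapsq_0:
  assumes f: "smooth_fun f" "sq_int_from m f" and k: "m \<le> k"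
  shows "gsq (k + 2) f = lapsq 0 k f"
proof -
  have "gsq (k + 2) f = (\<Sum>i\<in>UNIV. \<Sum>j\<in>UNIV. \<Sum>\<alpha>\<in>mind k. Lsq (pd i (pd j (pdl \<alpha> f))))"
    by (simp add: gsq_def sum_mind_Suc)
  also have "\<dots> = (\<Sum>i\<in>UNIV. \<Sum>\<alpha>\<in>mind k. \<Sum>j\<in>UNIV. Lsq (pd i (pd j (pdl \<alpha> f))))"
    by (intro sum.cong refl sum.swap)
  also have "\<dots> = (\<Sum>\<alpha>\<in>mind k. \<Sum>i\<in>UNIV. \<Sum>j\<in>UNIV. Lsq (pd i (pd j (pdl \<alpha> f))))"
    by (rule sum.swap)
  also have "\<dots> = (\<Sum>\<alpha>\<in>mind k. Lsq (lap (pdl \<alpha> f)))"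
    using k by (intro sum.cong refl Lsq_lap[symmetric] Hinf_pdl_from[OF f]) (simp add: mind_def)
  finally show ?thesis by (simp add: lapsq_def gsq_0)
qed

lemma pd_lap:
  assumes u: "smooth_fun u"
  shows "pd i (lap u) = lap (pd i u)"
proof -
  have com: "pd i (pd j (pd j u)) = pd j (pd j (pd i u))" for j
    using pd_commute_fun[OF u, of i j] pd_commute_fun[OF smooth_fun_pdl[OF u, of "[j]"], of i j] by simp
  have "pdl [i] (\<lambda>x. \<Sum>j\<in>UNIV. pdl [j, j] u x) = (\<lambda>x. \<Sum>j\<in>UNIV. pdl [i] (pdl [j, j] u) x)"
    by (rule pdl_sum) (auto intro: all_partials_pdl[OF smooth_fun_imp_all_partials[OF u], of "[_, _]", simplified])
  then show ?thesis by (simp add: lap_def[abs_def] com)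
qed

lemma gsq_eq_lapsq_1:
  assumes f: "smooth_fun f" "sq_int_from m f" and k: "m \<le> k"
  shows "gsq (k + 3) f = lapsq 1 k f"
proof -
  have "lapsq 1 k f = (\<Sum>\<alpha>\<in>mind k. \<Sum>i\<in>UNIV. Lsq (pd i (lap (pdl \<alpha> f))))"
    by (simp add: lapsq_def gsq_def sum_mind_Suc mind_0)
  also have "\<dots> = (\<Sum>\<alpha>\<in>mind k. \<Sum>i\<in>UNIV. Lsq (lap (pdl (i # \<alpha>) f)))"
    by (simp add: pd_lap smooth_fun_pdl f)
  also have "\<dots> = (\<Sum>\<alpha>\<in>mind (Suc k). Lsq (lap (pdl \<alpha> f)))"
    unfolding sum_mind_Suc by (rule sum.swap)
  also have "\<dots> = gsq (k + 3) f"
    using gsq_eq_lapsq_0[OF f, of "Suc k"] k by (simp add: lapsq_def gsq_0 numeral_3_eq_3)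
  finally show ?thesis by simp
qed

section \<open>The nonlinear term\<close>


lemma gsq_pd_le: "gsq l (pd i f) \<le> gsq (l + 1) f"
proof -
  have "gsq l (pd i f) = (\<Sum>\<alpha>\<in>mind l. Lsq (pdl (\<alpha> @ [i]) f))"
    by (simp add: gsq_def pdl_append)
  also have "\<dots> = (\<Sum>\<alpha>\<in>(\<lambda>\<alpha>. \<alpha> @ [i]) ` mind l. Lsq (pdl \<alpha> f))"
    by (subst sum.reindex) (auto simp: inj_on_def)
  also have "\<dots> \<le> gsq (l + 1) f"
    unfolding gsq_def by (intro sum_mono2 finite_mind) (auto simp: mind_def Lsq_nonneg)
  finally show ?thesis .
qed

lemma gsq_sum_le:
  assumes "finite A" and h: "\<And>i. i \<in> A \<Longrightarrow> Hinf (h i)"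
  shows "gsq l (\<lambda>x. \<Sum>i\<in>A. h i x) \<le> real (card A) * (\<Sum>i\<in>A. gsq l (h i))"
proof -
  have eq: "pdl \<alpha> (\<lambda>x. \<Sum>i\<in>A. h i x) = (\<lambda>x. \<Sum>i\<in>A. pdl \<alpha> (h i) x)" for \<alpha>
    by (intro pdl_sum assms smooth_fun_imp_all_partials Hinf_imp_smooth_fun)
  have "Lsq (pdl \<alpha> (\<lambda>x. \<Sum>i\<in>A. h i x)) \<le> real (card A) * (\<Sum>i\<in>A. Lsq (pdl \<alpha> (h i)))" for \<alpha>
  proof -
    have le: "(pdl \<alpha> (\<lambda>x. \<Sum>i\<in>A. h i x) x)\<^sup>2 \<le> real (card A) * (\<Sum>i\<in>A. (pdl \<alpha> (h i) x)\<^sup>2)" for x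
      using sum_squared_le_sum_of_squares[of "\<lambda>i. pdl \<alpha> (h i) x" A] by (simp add: eq mult.commute)
    have i: "integrable lborel (\<lambda>x. \<Sum>i\<in>A. (pdl \<alpha> (h i) x)\<^sup>2)"
      by (intro Bochner_Integration.integrable_sum Hinf_sq_integrable h)
    have "Lsq (pdl \<alpha> (\<lambda>x. \<Sum>i\<in>A. h i x)) \<le> (LINT x|lborel. real (card A) * (\<Sum>i\<in>A. (pdl \<alpha> (h i) x)\<^sup>2))"
      unfolding Lsq_def by (intro integral_mono le integrable_mult_right i Hinf_sq_integrable Hinf_sum assms)
    also have "\<dots> = real (card A) * (\<Sum>i\<in>A. Lsq (pdl \<alpha> (h i)))"
      unfolding Lsq_def using h by (simp add: Hinf_sq_integrable)
    finally show ?thesis .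
  qed
  then have "gsq l (\<lambda>x. \<Sum>i\<in>A. h i x) \<le> (\<Sum>\<alpha>\<in>mind l. real (card A) * (\<Sum>i\<in>A. Lsq (pdl \<alpha> (h i))))"
    unfolding gsq_def by (intro sum_mono)
  also have "\<dots> = real (card A) * (\<Sum>i\<in>A. gsq l (h i))"
    unfolding gsq_def sum_distrib_left[symmetric] by (subst sum.swap) simp
  finally show ?thesis .
qed

lemma gsq_nonlinearity_le:
  assumes l: "l \<ge> 1"
  shows "\<exists>C>0. \<forall>(\<psi> :: real^'n::finite \<Rightarrow> real) v w S. smooth_fun \<psi> \<longrightarrow> sq_int_from 1 \<psi> \<longrightarrow> Hinf v \<longrightarrow> Hinf w \<longrightarrow> S > 0 \<longrightarrow>
    (\<forall>x. \<bar>v x\<bar> \<le> S) \<longrightarrow> (\<forall>x. \<bar>w x\<bar> \<le> S) \<longrightarrow> (\<forall>i x. \<bar>pd i \<psi> x\<bar> \<le> S) \<longrightarrow> (\<forall>i x. \<bar>pd i v x\<bar> \<le> S) \<longrightarrow>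
    Hinf (\<lambda>x. 2 * k * (v x * w x + (\<Sum>i\<in>UNIV. pd i \<psi> x * pd i v x))) \<and>
    gsq l (\<lambda>x. 2 * k * (v x * w x + (\<Sum>i\<in>UNIV. pd i \<psi> x * pd i v x)))
      \<le> C * S\<^sup>2 * (gsq l v + gsq l w + gsq (l + 1) \<psi> + gsq (l + 1) v)"
proof -
  obtain C where C: "C > 0" "\<forall>(f :: real^'n::finite \<Rightarrow> real) g S. Hinf f \<longrightarrow> Hinf g \<longrightarrow> S > 0 \<longrightarrow>
    (\<forall>x. \<bar>f x\<bar> \<le> S) \<longrightarrow> (\<forall>x. \<bar>g x\<bar> \<le> S) \<longrightarrow>
    gsq l (\<lambda>x. f x * g x) \<le> C * S\<^sup>2 * (gsq l f + gsq l g)"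
    using gsq_mult_le[OF l, where 'n = 'n] by blast
  define n where "n = real CARD('n)"
  have n1: "n \<ge> 1" by (simp add: n_def Suc_leI)
  define K where "K = 2 * (2 * k)\<^sup>2"
  define C' where "C' = (K + 1) * (n * n * C)"
  have K0: "K \<ge> 0" by (simp add: K_def)
  have C'0: "C' > 0" using C(1) n1 K0 by (simp add: C'_def)
  have "Hinf (\<lambda>x. 2 * k * (v x * w x + (\<Sum>i\<in>UNIV. pd i \<psi> x * pd i v x))) \<and>
    gsq l (\<lambda>x. 2 * k * (v x * w x + (\<Sum>i\<in>UNIV. pd i \<psi> x * pd i v x)))
      \<le> C' * S\<^sup>2 * (gsq l v + gsq l w + gsq (l + 1) \<psi> + gsq (l + 1) v)"
    if \<psi>: "smooth_fun \<psi>" "sq_int_from 1 \<psi>" and v: "Hinf v" and w: "Hinf w" and S: "S > 0"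
      and b: "\<forall>x. \<bar>v x\<bar> \<le> S" "\<forall>x. \<bar>w x\<bar> \<le> S" "\<forall>i x. \<bar>pd i \<psi> x\<bar> \<le> S" "\<forall>i x. \<bar>pd i v x\<bar> \<le> S"
    for \<psi> v w :: "real^'n \<Rightarrow> real" and S
  proof -
    have H\<psi>: "Hinf (pd i \<psi>)" for i
      using Hinf_pdl_from[OF \<psi>, of "[i]"] by simp
    have Hv: "Hinf (pd i v)" for i
      using Hinf_pdl[OF v, of "[i]"] by simp
    define f g where "f = (\<lambda>x. v x * w x)" and "g = (\<lambda>x. \<Sum>i\<in>UNIV. pd i \<psi> x * pd i v x)"
    have Hf: "Hinf f" unfolding f_def by (rule Hinf_mult[OF v w])
    have Hg: "Hinf g" unfolding g_def by (intro Hinf_sum Hinf_mult H\<psi> Hv) simp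
    have G: "(\<lambda>x. 2 * k * (v x * w x + (\<Sum>i\<in>UNIV. pd i \<psi> x * pd i v x))) = (\<lambda>x. (2 * k) * f x + (2 * k) * g x)"
      by (simp add: f_def g_def algebra_simps)
    have fle: "gsq l f \<le> C * S\<^sup>2 * (gsq l v + gsq l w)"
      unfolding f_def using C(2) v w S b by blast
    have "gsq l (\<lambda>x. pd i \<psi> x * pd i v x) \<le> C * S\<^sup>2 * (gsq (l + 1) \<psi> + gsq (l + 1) v)" for i
    proof -
      have "gsq l (\<lambda>x. pd i \<psi> x * pd i v x) \<le> C * S\<^sup>2 * (gsq l (pd i \<psi>) + gsq l (pd i v))"
        using C(2) H\<psi> Hv S b by blast
      also have "\<dots> \<le> C * S\<^sup>2 * (gsq (l + 1) \<psi> + gsq (l + 1) v)"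
        using C(1) by (intro mult_left_mono add_mono gsq_pd_le) auto
      finally show ?thesis .
    qed
    then have "(\<Sum>i\<in>UNIV. gsq l (\<lambda>x. pd i \<psi> x * pd i v x)) \<le> (\<Sum>i\<in>(UNIV :: 'n set). C * S\<^sup>2 * (gsq (l + 1) \<psi> + gsq (l + 1) v))"
      by (intro sum_mono)
    then have "n * (\<Sum>i\<in>UNIV. gsq l (\<lambda>x. pd i \<psi> x * pd i v x)) \<le> n * (n * (C * S\<^sup>2 * (gsq (l + 1) \<psi> + gsq (l + 1) v)))"
      using n1 by (intro mult_left_mono) (auto simp: n_def)
    moreover have "gsq l g \<le> n * (\<Sum>i\<in>UNIV. gsq l (\<lambda>x. pd i \<psi> x * pd i v x))"
      unfolding g_def n_def by (intro gsq_sum_le Hinf_mult H\<psi> Hv) simp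
    ultimately have gle: "gsq l g \<le> n * n * C * S\<^sup>2 * (gsq (l + 1) \<psi> + gsq (l + 1) v)"
      by (simp add: mult_ac)
    have "1 * (C * S\<^sup>2 * (gsq l v + gsq l w)) \<le> (n * n) * (C * S\<^sup>2 * (gsq l v + gsq l w))"
      using n1 C(1) mult_mono[of 1 n 1 n] by (intro mult_right_mono) (auto simp: gsq_nonneg)
    with fle have fle': "gsq l f \<le> n * n * C * S\<^sup>2 * (gsq l v + gsq l w)"
      by (simp add: mult_ac)
    have "gsq l (\<lambda>x. (2 * k) * f x + (2 * k) * g x) \<le> K * gsq l f + K * gsq l g"
      unfolding K_def by (rule gsq_lincomb_le[where m = 0]) (use Hf Hg in \<open>auto simp: Hinf_iff\<close>)
    also have "\<dots> \<le> (K + 1) * gsq l f + (K + 1) * gsq l g"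
      by (intro add_mono mult_right_mono) (auto simp: gsq_nonneg)
    also have "\<dots> \<le> (K + 1) * (n * n * C * S\<^sup>2 * (gsq l v + gsq l w)) + (K + 1) * (n * n * C * S\<^sup>2 * (gsq (l + 1) \<psi> + gsq (l + 1) v))"
      using K0 by (intro add_mono mult_left_mono fle' gle) auto
    also have "\<dots> = C' * S\<^sup>2 * (gsq l v + gsq l w + gsq (l + 1) \<psi> + gsq (l + 1) v)"
      by (simp add: C'_def algebra_simps)
    finally show ?thesis unfolding G using Hinf_lincomb[OF Hf Hg] by simp
  qed
  then show ?thesis using C'0 by blast
qed

lemma abs_ipk_le:
  assumes G: "Hinf G" and f: "smooth_fun f" "sq_int_from m f" and ml: "m \<le> l" and S: "S > 0"
  shows "\<bar>ipk l G f\<bar> \<le> gsq l G / S + S * gsq l f"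
proof -
  have "\<bar>LINT x|lborel. pdl \<alpha> G x * pdl \<alpha> f x\<bar> \<le> Lsq (pdl \<alpha> G) / S + S * Lsq (pdl \<alpha> f)" if "\<alpha> \<in> mind l" for \<alpha>
  proof -
    have f2: "pdl \<alpha> f \<in> borel_measurable borel" "integrable lborel (\<lambda>x. (pdl \<alpha> f x)\<^sup>2)"
      using f ml that by (auto simp: sq_int_from_def mind_def)
    have i: "integrable lborel (\<lambda>x. (pdl \<alpha> G x)\<^sup>2 / S + S * (pdl \<alpha> f x)\<^sup>2)"
      using f2 Hinf_sq_integrable[OF G] by simp
    have ab: "\<bar>a * b\<bar> \<le> a\<^sup>2 / S + S * b\<^sup>2" for a b :: real
    proof -
      have "2 * (\<bar>a\<bar> / sqrt S) * (sqrt S * \<bar>b\<bar>) \<le> (\<bar>a\<bar> / sqrt S)\<^sup>2 + (sqrt S * \<bar>b\<bar>)\<^sup>2"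
        by (rule sum_squares_bound)
      then have "2 * (\<bar>a\<bar> * \<bar>b\<bar>) \<le> a\<^sup>2 / S + S * b\<^sup>2"
        using S by (simp add: power_divide power_mult_distrib)
      moreover have "0 \<le> \<bar>a\<bar> * \<bar>b\<bar>" by simp
      ultimately show ?thesis unfolding abs_mult by linarith
    qed
    have "integrable lborel (\<lambda>x. pdl \<alpha> G x * pdl \<alpha> f x)"
      by (intro integrable_mult_L2 Hinf_measurable Hinf_sq_integrable G f2)
    then have "(LINT x|lborel. \<bar>pdl \<alpha> G x * pdl \<alpha> f x\<bar>) \<le> (LINT x|lborel. (pdl \<alpha> G x)\<^sup>2 / S + S * (pdl \<alpha> f x)\<^sup>2)"
      by (intro integral_mono i ab) simp
    also have "\<dots> = Lsq (pdl \<alpha> G) / S + S * Lsq (pdl \<alpha> f)"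
      using f2 Hinf_sq_integrable[OF G] by (simp add: Lsq_def)
    finally show ?thesis
      using integral_abs_bound[of lborel "\<lambda>x. pdl \<alpha> G x * pdl \<alpha> f x"] by linarith
  qed
  then have "\<bar>ipk l G f\<bar> \<le> (\<Sum>\<alpha>\<in>mind l. Lsq (pdl \<alpha> G) / S + S * Lsq (pdl \<alpha> f))"
    unfolding ipk_def by (intro order_trans[OF sum_abs] sum_mono)
  also have "\<dots> = gsq l G / S + S * gsq l f"
    by (simp add: gsq_def sum.distrib sum_distrib_left sum_divide_distrib)
  finally show ?thesis .
qed

text \<open>The orders of differentiation that are controlled by the energy of level kappa.\<close>
definition energy_part :: "nat \<Rightarrow> (real^'n::finite \<Rightarrow> real) \<Rightarrow> (real^'n \<Rightarrow> real) \<Rightarrow> (real^'n \<Rightarrow> real) \<Rightarrow> real" where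
  "energy_part \<kappa> \<psi> v w = gsq (\<kappa> + 1) v + gsq (\<kappa> + 2) v + gsq (\<kappa> + 3) v
    + gsq \<kappa> w + gsq (\<kappa> + 1) w + gsq (\<kappa> + 2) w
    + gsq (\<kappa> + 1) \<psi> + gsq (\<kappa> + 2) \<psi> + gsq (\<kappa> + 3) \<psi>"

lemma energy_part_nonneg: "energy_part \<kappa> \<psi> v w \<ge> 0"
  by (simp add: energy_part_def gsq_nonneg)

lemma Rfun_le:
  assumes \<kappa>: "\<kappa> \<ge> 1" and \<tau>: "\<tau> > 0"
  shows "\<exists>C>0. \<forall>(\<psi> :: real \<Rightarrow> real^'n::finite \<Rightarrow> real) v w t S.
    smooth_fun (\<psi> t) \<longrightarrow> sq_int_from 1 (\<psi> t) \<longrightarrow> Hinf (v t) \<longrightarrow> Hinf (w t) \<longrightarrow> S > 0 \<longrightarrow>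
    (\<forall>x. \<bar>v t x\<bar> \<le> S) \<longrightarrow> (\<forall>x. \<bar>w t x\<bar> \<le> S) \<longrightarrow> (\<forall>i x. \<bar>pd i (\<psi> t) x\<bar> \<le> S) \<longrightarrow> (\<forall>i x. \<bar>pd i (v t) x\<bar> \<le> S) \<longrightarrow>
    Rfun \<tau> k \<kappa> \<psi> v w t \<le> C * S * (energy_part \<kappa> (\<psi> t) (v t) (w t) + gsq \<kappa> (v t))"
proof -
  have ex: "\<exists>C>0. \<forall>(\<psi> :: real^'n::finite \<Rightarrow> real) v w S. smooth_fun \<psi> \<longrightarrow> sq_int_from 1 \<psi> \<longrightarrow> Hinf v \<longrightarrow> Hinf w \<longrightarrow> S > 0 \<longrightarrow>
    (\<forall>x. \<bar>v x\<bar> \<le> S) \<longrightarrow> (\<forall>x. \<bar>w x\<bar> \<le> S) \<longrightarrow> (\<forall>i x. \<bar>pd i \<psi> x\<bar> \<le> S) \<longrightarrow> (\<forall>i x. \<bar>pd i v x\<bar> \<le> S) \<longrightarrow>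
    Hinf (\<lambda>x. 2 * k * (v x * w x + (\<Sum>i\<in>UNIV. pd i \<psi> x * pd i v x))) \<and>
    gsq l (\<lambda>x. 2 * k * (v x * w x + (\<Sum>i\<in>UNIV. pd i \<psi> x * pd i v x)))
      \<le> C * S\<^sup>2 * (gsq l v + gsq l w + gsq (l + 1) \<psi> + gsq (l + 1) v)" if "l \<ge> 1" for l
    using gsq_nonlinearity_le[OF that, where 'n = 'n and k = k] .
  have k12: "\<kappa> + 1 \<ge> 1" "\<kappa> + 2 \<ge> 1" by auto
  obtain C0 where C0: "C0 > 0" "\<forall>(\<psi> :: real^'n::finite \<Rightarrow> real) v w S. smooth_fun \<psi> \<longrightarrow> sq_int_from 1 \<psi> \<longrightarrow> Hinf v \<longrightarrow> Hinf w \<longrightarrow> S > 0 \<longrightarrow>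
    (\<forall>x. \<bar>v x\<bar> \<le> S) \<longrightarrow> (\<forall>x. \<bar>w x\<bar> \<le> S) \<longrightarrow> (\<forall>i x. \<bar>pd i \<psi> x\<bar> \<le> S) \<longrightarrow> (\<forall>i x. \<bar>pd i v x\<bar> \<le> S) \<longrightarrow>
    Hinf (\<lambda>x. 2 * k * (v x * w x + (\<Sum>i\<in>UNIV. pd i \<psi> x * pd i v x))) \<and>
    gsq \<kappa> (\<lambda>x. 2 * k * (v x * w x + (\<Sum>i\<in>UNIV. pd i \<psi> x * pd i v x)))
      \<le> C0 * S\<^sup>2 * (gsq \<kappa> v + gsq \<kappa> w + gsq (\<kappa> + 1) \<psi> + gsq (\<kappa> + 1) v)"
    using ex[OF \<kappa>] by blast
  obtain C1 where C1: "C1 > 0" "\<forall>(\<psi> :: real^'n::finite \<Rightarrow> real) v w S. smooth_fun \<psi> \<longrightarrow> sq_int_from 1 \<psi> \<longrightarrow> Hinf v \<longrightarrow> Hinf w \<longrightarrow> S > 0 \<longrightarrow>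
    (\<forall>x. \<bar>v x\<bar> \<le> S) \<longrightarrow> (\<forall>x. \<bar>w x\<bar> \<le> S) \<longrightarrow> (\<forall>i x. \<bar>pd i \<psi> x\<bar> \<le> S) \<longrightarrow> (\<forall>i x. \<bar>pd i v x\<bar> \<le> S) \<longrightarrow>
    Hinf (\<lambda>x. 2 * k * (v x * w x + (\<Sum>i\<in>UNIV. pd i \<psi> x * pd i v x))) \<and>
    gsq (\<kappa> + 1) (\<lambda>x. 2 * k * (v x * w x + (\<Sum>i\<in>UNIV. pd i \<psi> x * pd i v x)))
      \<le> C1 * S\<^sup>2 * (gsq (\<kappa> + 1) v + gsq (\<kappa> + 1) w + gsq (\<kappa> + 1 + 1) \<psi> + gsq (\<kappa> + 1 + 1) v)"
    using ex[OF k12(1)] by blast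
  obtain C2 where C2: "C2 > 0" "\<forall>(\<psi> :: real^'n::finite \<Rightarrow> real) v w S. smooth_fun \<psi> \<longrightarrow> sq_int_from 1 \<psi> \<longrightarrow> Hinf v \<longrightarrow> Hinf w \<longrightarrow> S > 0 \<longrightarrow>
    (\<forall>x. \<bar>v x\<bar> \<le> S) \<longrightarrow> (\<forall>x. \<bar>w x\<bar> \<le> S) \<longrightarrow> (\<forall>i x. \<bar>pd i \<psi> x\<bar> \<le> S) \<longrightarrow> (\<forall>i x. \<bar>pd i v x\<bar> \<le> S) \<longrightarrow>
    Hinf (\<lambda>x. 2 * k * (v x * w x + (\<Sum>i\<in>UNIV. pd i \<psi> x * pd i v x))) \<and>
    gsq (\<kappa> + 2) (\<lambda>x. 2 * k * (v x * w x + (\<Sum>i\<in>UNIV. pd i \<psi> x * pd i v x)))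
      \<le> C2 * S\<^sup>2 * (gsq (\<kappa> + 2) v + gsq (\<kappa> + 2) w + gsq (\<kappa> + 2 + 1) \<psi> + gsq (\<kappa> + 2 + 1) v)"
    using ex[OF k12(2)] by blast
  define A where "A = 2 + 2 * \<tau>\<^sup>2"
  define C where "C = 2 * C0 + 3 * C1 + C2 + 6 * A"
  have A0: "A > 0" by (simp add: A_def add_pos_nonneg)
  have "Rfun \<tau> k \<kappa> \<psi> v w t \<le> C * S * (energy_part \<kappa> (\<psi> t) (v t) (w t) + gsq \<kappa> (v t))"
    if \<psi>: "smooth_fun (\<psi> t)" "sq_int_from 1 (\<psi> t)" and v: "Hinf (v t)" and w: "Hinf (w t)" and S: "S > 0"
      and b: "\<forall>x. \<bar>v t x\<bar> \<le> S" "\<forall>x. \<bar>w t x\<bar> \<le> S" "\<forall>i x. \<bar>pd i (\<psi> t) x\<bar> \<le> S" "\<forall>i x. \<bar>pd i (v t) x\<bar> \<le> S"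
    for \<psi> v w :: "real \<Rightarrow> real^'n \<Rightarrow> real" and t S
  proof -
    define G where "G = Nl k \<psi> v w t"
    have G: "G = (\<lambda>x. 2 * k * (v t x * w t x + (\<Sum>i\<in>UNIV. pd i (\<psi> t) x * pd i (v t) x)))"
      by (simp add: G_def Nl_def fun_eq_iff)
    define B where "B = energy_part \<kappa> (\<psi> t) (v t) (w t) + gsq \<kappa> (v t)"
    note nn = gsq_nonneg[of _ "v t"] gsq_nonneg[of _ "w t"] gsq_nonneg[of _ "\<psi> t"]
    have HG: "Hinf G"
      unfolding G using C0(2) \<psi> v w S b by blast
    have vv: "smooth_fun (v t)" "sq_int_from 1 (v t)" and ww: "smooth_fun (w t)" "sq_int_from 1 (w t)"
      using v w by (auto simp: Hinf_iff sq_int_from_def)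
    define P Q where "P = (\<lambda>x. \<psi> t x + \<tau> * v t x)" and "Q = (\<lambda>x. v t x + \<tau> * w t x)"
    have PQ: "P = (\<lambda>x. 1 * \<psi> t x + \<tau> * v t x)" "Q = (\<lambda>x. 1 * v t x + \<tau> * w t x)"
      by (simp_all add: P_def Q_def)
    have sP: "smooth_fun P" "sq_int_from 1 P" and sQ: "smooth_fun Q" "sq_int_from 1 Q"
      unfolding PQ by (intro smooth_fun_lincomb sq_int_from_lincomb \<psi> vv ww)+
    have V: "(\<lambda>x. \<tau> * v t x) = (\<lambda>x. \<tau> * v t x + 0 * v t x)" by simp
    have sV: "smooth_fun (\<lambda>x. \<tau> * v t x)" "sq_int_from 1 (\<lambda>x. \<tau> * v t x)"
      by (subst V, intro smooth_fun_lincomb sq_int_from_lincomb vv)+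
    have g0: "gsq \<kappa> G \<le> C0 * S\<^sup>2 * B"
    proof -
      have "gsq \<kappa> G \<le> C0 * S\<^sup>2 * (gsq \<kappa> (v t) + gsq \<kappa> (w t) + gsq (\<kappa> + 1) (\<psi> t) + gsq (\<kappa> + 1) (v t))"
        unfolding G using C0(2) \<psi> v w S b by blast
      also have "\<dots> \<le> C0 * S\<^sup>2 * B"
        using C0(1) nn by (intro mult_left_mono) (auto simp: B_def energy_part_def add_nonneg_nonneg)
      finally show ?thesis .
    qed
    have g1: "gsq (\<kappa> + 1) G \<le> C1 * S\<^sup>2 * B"
    proof -
      have "gsq (\<kappa> + 1) G \<le> C1 * S\<^sup>2 * (gsq (\<kappa> + 1) (v t) + gsq (\<kappa> + 1) (w t) + gsq (\<kappa> + 1 + 1) (\<psi> t) + gsq (\<kappa> + 1 + 1) (v t))"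
        unfolding G using C1(2) \<psi> v w S b by blast
      also have "\<dots> \<le> C1 * S\<^sup>2 * B"
        using C1(1) nn by (intro mult_left_mono) (auto simp: B_def energy_part_def add_nonneg_nonneg)
      finally show ?thesis .
    qed
    have g2: "gsq (\<kappa> + 2) G \<le> C2 * S\<^sup>2 * B"
    proof -
      have "gsq (\<kappa> + 2) G \<le> C2 * S\<^sup>2 * (gsq (\<kappa> + 2) (v t) + gsq (\<kappa> + 2) (w t) + gsq (\<kappa> + 2 + 1) (\<psi> t) + gsq (\<kappa> + 2 + 1) (v t))"
        unfolding G using C2(2) \<psi> v w S b by blast
      also have "\<dots> \<le> C2 * S\<^sup>2 * B"
        using C2(1) nn by (intro mult_left_mono) (auto simp: B_def energy_part_def add_nonneg_nonneg numeral_3_eq_3)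
      finally show ?thesis .
    qed
    have two: "2 * x + 2 * \<tau>\<^sup>2 * y \<le> A * B" if "x \<le> B" "y \<le> B" "0 \<le> x" "0 \<le> y" for x y
    proof -
      have "2 * x + 2 * \<tau>\<^sup>2 * y \<le> 2 * B + 2 * \<tau>\<^sup>2 * B" using that by (intro add_mono mult_left_mono) auto
      then show ?thesis by (simp add: A_def algebra_simps)
    qed
    have mem: "gsq \<kappa> (v t) \<le> B" "gsq (\<kappa> + 1) (v t) \<le> B" "gsq (\<kappa> + 2) (v t) \<le> B"
      "gsq \<kappa> (w t) \<le> B" "gsq (\<kappa> + 1) (w t) \<le> B" "gsq (\<kappa> + 2) (w t) \<le> B" "gsq (\<kappa> + 1) (\<psi> t) \<le> B"
      using nn by (simp_all add: B_def energy_part_def add_nonneg_nonneg add_increasing add_increasing2)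
    have B0: "0 \<le> B" using mem(1) nn(1)[of \<kappa>] by linarith
    have fV: "gsq (\<kappa> + 1) (\<lambda>x. \<tau> * v t x) \<le> A * B"
    proof -
      have "gsq (\<kappa> + 1) (\<lambda>x. \<tau> * v t x) = 2 * 0 + \<tau>\<^sup>2 * gsq (\<kappa> + 1) (v t)"
        by (simp add: gsq_cmult[OF smooth_fun_imp_all_partials[OF vv(1)]])
      also have "\<dots> \<le> 2 * 0 + 2 * \<tau>\<^sup>2 * gsq (\<kappa> + 1) (v t)" using nn by simp
      also have "\<dots> \<le> A * B" using mem(2) nn B0 by (intro two) auto
      finally show ?thesis .
    qed
    have fP: "gsq (\<kappa> + 1) P \<le> A * B"
    proof -
      have "gsq (\<kappa> + 1) P \<le> 2 * gsq (\<kappa> + 1) (\<psi> t) + 2 * \<tau>\<^sup>2 * gsq (\<kappa> + 1) (v t)"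
        using gsq_lincomb_le[OF \<psi> vv, of "\<kappa> + 1" 1 \<tau>] unfolding PQ by simp
      also have "\<dots> \<le> A * B" by (rule two[OF mem(7) mem(2) nn(3) nn(1)])
      finally show ?thesis .
    qed
    have fQ: "gsq l Q \<le> A * B" if "l \<ge> 1" "gsq l (v t) \<le> B" "gsq l (w t) \<le> B" for l
    proof -
      have "gsq l Q \<le> 2 * gsq l (v t) + 2 * \<tau>\<^sup>2 * gsq l (w t)"
        using gsq_lincomb_le[OF vv ww that(1), of 1 \<tau>] unfolding PQ by simp
      also have "\<dots> \<le> A * B" by (rule two[OF that(2,3) nn(1) nn(2)])
      finally show ?thesis .
    qed
    have fw: "gsq \<kappa> (w t) \<le> A * B"
    proof -
      have "1 * B \<le> A * B" using B0 by (intro mult_right_mono) (auto simp: A_def)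
      then show ?thesis using mem(4) by simp
    qed
    have ip: "\<bar>ipk l G f\<bar> \<le> (c + A) * (S * B)"
      if f: "smooth_fun f" "sq_int_from 1 f" and l: "l \<ge> 1" and "gsq l G \<le> c * S\<^sup>2 * B" "gsq l f \<le> A * B" for l f c
    proof -
      have "gsq l G / S \<le> c * S * B"
        using that S by (simp add: divide_le_eq power2_eq_square mult_ac)
      moreover have "S * gsq l f \<le> S * (A * B)" using that S by (intro mult_left_mono) auto
      moreover have "\<bar>ipk l G f\<bar> \<le> gsq l G / S + S * gsq l f"
        by (rule abs_ipk_le[OF HG f l S])
      ultimately show ?thesis by (simp add: algebra_simps)
    qed
    have "Rfun \<tau> k \<kappa> \<psi> v w t = \<bar>ipk (\<kappa>+1) G (\<lambda>x. \<tau> * v t x)\<bar> + \<bar>ipk (\<kappa>+1) G P\<bar> + \<bar>ipk \<kappa> G (w t)\<bar>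
     + \<bar>ipk \<kappa> G Q\<bar> + \<bar>ipk (\<kappa>+1) G Q\<bar> + \<bar>ipk (\<kappa>+2) G Q\<bar>"
      by (simp add: Rfun_def Let_def G_def P_def Q_def)
    also have "\<dots> \<le> (C1 + A) * (S * B) + (C1 + A) * (S * B) + (C0 + A) * (S * B)
      + (C0 + A) * (S * B) + (C1 + A) * (S * B) + (C2 + A) * (S * B)"
      using \<kappa> mem by (intro add_mono ip sV sP sQ ww g0 g1 g2 fV fP fw fQ) auto
    also have "\<dots> = C * S * B" by (simp add: C_def algebra_simps)
    finally show ?thesis by (simp add: B_def)
  qed
  moreover have "C > 0" using C0(1) C1(1) C2(1) A0 by (simp add: C_def add_pos_pos)
  ultimately show ?thesis by blast
qed

section \<open>Decay of the sup norms\<close>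


lemma Sobolev_decay:
  fixes f :: "real^'n::finite \<Rightarrow> real"
  assumes f: "Hinf f" and n: "CARD('n) \<ge> 2" and N: "N = CARD('n) div 2 + 1" and lam: "lam \<ge> 1"
    and m: "\<And>k. k \<le> N \<Longrightarrow> lam powr (CARD('n) / 4 + k / 2) * sqrt (gsq k f) \<le> m"
  shows "\<bar>f x\<bar> \<le> 2 * real CARD('n) ^ N * (real N + 1) * (m / lam)"
proof -
  have term_le: "sqrt lam powr (real k - CARD('n) / 2) * sqrt (gsq k f) \<le> m / lam" if "k \<le> N" for k
  proof -
    have "sqrt lam powr (real k - CARD('n) / 2) = lam powr (1 / 2 * (real k - CARD('n) / 2))"
      using lam by (simp add: powr_half_sqrt[symmetric] powr_powr)
    also have "1 / 2 * (real k - CARD('n) / 2) = - (CARD('n) / 2) + (CARD('n) / 4 + k / 2)"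
      by (simp add: field_simps)
    finally have "sqrt lam powr (real k - CARD('n) / 2) * sqrt (gsq k f) =
        lam powr (- (CARD('n) / 2)) * (lam powr (CARD('n) / 4 + k / 2) * sqrt (gsq k f))"
      by (simp only: powr_add mult.assoc)
    also have "\<dots> \<le> lam powr (- 1) * m"
      using m[OF that] lam n by (intro mult_mono powr_mono) (auto simp: gsq_nonneg)
    also have "\<dots> = m / lam" using lam by (simp add: powr_minus divide_inverse)
    finally show ?thesis .
  qed
  have "\<bar>f x\<bar> \<le> 2 * real CARD('n) ^ N * (\<Sum>k\<le>N. sqrt lam powr (real k - CARD('n) / 2) * sqrt (gsq k f))"
    by (rule Sobolev_sup_bound[OF f _ N]) (use lam in auto)
  also have "\<dots> \<le> 2 * real CARD('n) ^ N * (\<Sum>k\<le>N. m / lam)"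
    by (intro mult_left_mono sum_mono term_le) auto
  finally show ?thesis by (simp add: mult_ac add.commute)
qed

definition decay_dominated :: "real \<Rightarrow> nat \<Rightarrow> (real \<Rightarrow> real^'n::finite \<Rightarrow> real) \<Rightarrow> (real \<Rightarrow> real^'n \<Rightarrow> real)
    \<Rightarrow> (real \<Rightarrow> real^'n \<Rightarrow> real) \<Rightarrow> real \<Rightarrow> real \<Rightarrow> bool" where
  "decay_dominated \<tau> s0 \<psi> v w \<sigma> m \<longleftrightarrow>
    (\<forall>j\<le>s0. (1+\<sigma>) powr (CARD('n)/4 + j/2) * sqrt (Usq \<tau> j \<psi> v w \<sigma>) \<le> m) \<and>
    (\<forall>j<s0. (1+\<sigma>) powr (CARD('n)/4 + j/2) * sqrt (gsq j (v \<sigma>))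
      + (1+\<sigma>) powr (CARD('n)/4 + 1/2 + j/2) * sqrt (gsq j (w \<sigma>)) \<le> m)"

lemma decay_dominated_exists: "\<exists>m. decay_dominated \<tau> s0 \<psi> v w \<sigma> (m::real)"
proof -
  let ?X = "\<lambda>j::nat. (1+\<sigma>) powr (CARD('a)/4 + j/2) * sqrt (Usq \<tau> j \<psi> v w \<sigma>)"
  let ?Y = "\<lambda>j::nat. (1+\<sigma>) powr (CARD('a)/4 + j/2) * sqrt (gsq j (v \<sigma>))
      + (1+\<sigma>) powr (CARD('a)/4 + 1/2 + j/2) * sqrt (gsq j (w \<sigma>))"
  let ?m = "Max (insert 0 (?X ` {..s0})) + Max (insert 0 (?Y ` {..<s0}))"
  have a: "0 \<le> Max (insert 0 (?X ` {..s0}))" "0 \<le> Max (insert 0 (?Y ` {..<s0}))"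
    by (auto intro!: Max_ge)
  have "?X j \<le> Max (insert 0 (?X ` {..s0}))" if "j \<le> s0" for j using that by (intro Max_ge) auto
  moreover have "?Y j \<le> Max (insert 0 (?Y ` {..<s0}))" if "j < s0" for j using that by (intro Max_ge) auto
  ultimately have "decay_dominated \<tau> s0 \<psi> v w \<sigma> ?m"
    unfolding decay_dominated_def using a by (meson add_increasing add_increasing2)
  then show ?thesis by blast
qed

lemma decay_dominated_nonneg:
  "decay_dominated \<tau> s0 \<psi> v w \<sigma> m \<Longrightarrow> m \<ge> 0"
  unfolding decay_dominated_def
  by (auto intro: order_trans[rotated] simp: Usq_def gsq_nonneg add_nonneg_nonneg dest!: spec[of _ 0])

lemma decay_dominated_mono:
  "decay_dominated \<tau> s0 \<psi> v w \<sigma> m \<Longrightarrow> m \<le> m' \<Longrightarrow> decay_dominated \<tau> s0 \<psi> v w \<sigma> m'"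
  unfolding decay_dominated_def by (meson order_trans)

lemma decay_dominated_Mfun:
  assumes M: "Mfun \<tau> s0 \<psi> v w t < \<infinity>" and \<sigma>: "\<sigma> \<in> {0..t}"
  shows "decay_dominated \<tau> s0 \<psi> v w \<sigma> (enn2real (Mfun \<tau> s0 \<psi> v w t))"
proof -
  let ?M = "Mfun \<tau> s0 \<psi> v w t"
  let ?X = "\<lambda>j \<sigma>. (1+\<sigma>) powr (CARD('a)/4 + real j/2) * sqrt (Usq \<tau> j \<psi> v w \<sigma>)"
  let ?Y = "\<lambda>j \<sigma>. (1+\<sigma>) powr (CARD('a)/4 + real j/2) * sqrt (gsq j (v \<sigma>))
      + (1+\<sigma>) powr (CARD('a)/4 + 1/2 + real j/2) * sqrt (gsq j (w \<sigma>))"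
  have le: "r \<le> enn2real ?M" if "ennreal r \<le> ?M" for r
  proof (cases "r \<ge> 0")
    case True
    then show ?thesis using enn2real_mono[OF that] M by simp
  next
    case False
    then show ?thesis using enn2real_nonneg[of ?M] by linarith
  qed
  have "ennreal (?X j \<sigma>) \<le> ?M" if "j \<le> s0" for j
  proof -
    have "ennreal (?X j \<sigma>) \<le> (SUP \<sigma>\<in>{0..t}. ennreal (?X j \<sigma>))" by (rule SUP_upper[OF \<sigma>])
    also have "\<dots> \<le> (\<Sum>j\<in>{0..s0}. SUP \<sigma>\<in>{0..t}. ennreal (?X j \<sigma>))"
      using that by (intro member_le_sum) auto
    also have "\<dots> \<le> ?M" unfolding Mfun_def by simp
    finally show ?thesis .
  qed
  moreover have "ennreal (?Y j \<sigma>) \<le> ?M" if "j < s0" for j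
  proof -
    have "ennreal (?Y j \<sigma>) \<le> (SUP \<sigma>\<in>{0..t}. ennreal (?Y j \<sigma>))" by (rule SUP_upper[OF \<sigma>])
    also have "\<dots> \<le> (\<Sum>j\<in>{0..<s0}. SUP \<sigma>\<in>{0..t}. ennreal (?Y j \<sigma>))"
      using that by (intro member_le_sum[where f = "\<lambda>j. SUP \<sigma>\<in>{0..t}. ennreal (?Y j \<sigma>)"]) auto
    also have "\<dots> \<le> ?M" unfolding Mfun_def by simp
    finally show ?thesis .
  qed
  ultimately show ?thesis unfolding decay_dominated_def using le by blast
qed

definition sup_const :: "nat \<Rightarrow> real" where
  "sup_const n = 2 * real n ^ (n div 2 + 1) * (real (n div 2 + 1) + 1)"

lemma sup_bounds:
  fixes \<psi> v w :: "real \<Rightarrow> real^'n::finite \<Rightarrow> real"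
  assumes n: "CARD('n) \<ge> 2" and \<tau>: "\<tau> > 0" and s0: "s0 \<ge> CARD('n) div 2 + 2" and \<sigma>: "\<sigma> \<ge> 0"
    and \<psi>: "smooth_fun (\<psi> \<sigma>)" "sq_int_from 1 (\<psi> \<sigma>)" and v: "Hinf (v \<sigma>)" and w: "Hinf (w \<sigma>)"
    and dom: "decay_dominated \<tau> s0 \<psi> v w \<sigma> m"
  defines "S \<equiv> (1 + \<tau>) * sup_const CARD('n) * (m / (1 + \<sigma>))"
  shows "\<bar>v \<sigma> x\<bar> \<le> S" "\<bar>w \<sigma> x\<bar> \<le> S" "\<bar>pd i (\<psi> \<sigma>) x\<bar> \<le> S" "\<bar>pd i (v \<sigma>) x\<bar> \<le> S"
proof -
  define S1 where "S1 = sup_const CARD('n) * (m / (1 + \<sigma>))"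
  have m0: "m \<ge> 0" by (rule decay_dominated_nonneg[OF dom])
  have c0: "sup_const CARD('n) \<ge> 0" by (simp add: sup_const_def)
  have S10: "S1 \<ge> 0" using m0 c0 \<sigma> by (simp add: S1_def)
  have S: "S = S1 + \<tau> * S1" by (simp add: S_def S1_def algebra_simps)
  have S1S: "S1 \<le> S" using S S10 \<tau> by simp
  have lam: "1 + \<sigma> \<ge> 1" using \<sigma> by simp
  have sup: "\<bar>f x\<bar> \<le> S1" if f: "Hinf f"
    and d: "\<And>k. k \<le> CARD('n) div 2 + 1 \<Longrightarrow> (1 + \<sigma>) powr (CARD('n) / 4 + k / 2) * sqrt (gsq k f) \<le> m" for f :: "real^'n \<Rightarrow> real"
    using Sobolev_decay[OF f n refl lam d] by (simp add: S1_def sup_const_def mult_ac)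
  have dU: "(1 + \<sigma>) powr (CARD('n) / 4 + k / 2) * sqrt z \<le> m"
    if "k \<le> CARD('n) div 2 + 1" "z \<le> Usq \<tau> k \<psi> v w \<sigma>" for k z
  proof -
    have "(1 + \<sigma>) powr (CARD('n) / 4 + k / 2) * sqrt z \<le> (1 + \<sigma>) powr (CARD('n) / 4 + k / 2) * sqrt (Usq \<tau> k \<psi> v w \<sigma>)"
      using that by (intro mult_left_mono) auto
    also have "\<dots> \<le> m" using dom that s0 by (simp add: decay_dominated_def)
    finally show ?thesis .
  qed
  have dVW: "(1 + \<sigma>) powr (CARD('n) / 4 + k / 2) * sqrt (gsq k (v \<sigma>))
      + (1 + \<sigma>) powr (CARD('n) / 4 + 1 / 2 + k / 2) * sqrt (gsq k (w \<sigma>)) \<le> m"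
    if "k \<le> CARD('n) div 2 + 1" for k
    using dom that s0 by (simp add: decay_dominated_def)
  have "\<bar>v \<sigma> x\<bar> \<le> S1"
  proof (rule sup[OF v])
    fix k assume k: "k \<le> CARD('n) div 2 + 1"
    have "0 \<le> (1 + \<sigma>) powr (CARD('n) / 4 + 1 / 2 + k / 2) * sqrt (gsq k (w \<sigma>))" by (simp add: gsq_nonneg)
    then show "(1 + \<sigma>) powr (CARD('n) / 4 + k / 2) * sqrt (gsq k (v \<sigma>)) \<le> m"
      using dVW[OF k] by linarith
  qed
  then show "\<bar>v \<sigma> x\<bar> \<le> S" using S1S by linarith
  have "\<bar>w \<sigma> x\<bar> \<le> S1"
  proof (rule sup[OF w])
    fix k assume k: "k \<le> CARD('n) div 2 + 1"
    have "0 \<le> (1 + \<sigma>) powr (CARD('n) / 4 + k / 2) * sqrt (gsq k (v \<sigma>))" by (simp add: gsq_nonneg)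
    moreover have "(1 + \<sigma>) powr (CARD('n) / 4 + k / 2) * sqrt (gsq k (w \<sigma>)) \<le>
        (1 + \<sigma>) powr (CARD('n) / 4 + 1 / 2 + k / 2) * sqrt (gsq k (w \<sigma>))"
      using lam by (intro mult_right_mono powr_mono) (auto simp: gsq_nonneg)
    ultimately show "(1 + \<sigma>) powr (CARD('n) / 4 + k / 2) * sqrt (gsq k (w \<sigma>)) \<le> m"
      using dVW[OF k] by linarith
  qed
  then show "\<bar>w \<sigma> x\<bar> \<le> S" using S1S by linarith
  have pv: "\<bar>pd i (v \<sigma>) x\<bar> \<le> S1"
  proof (rule sup)
    show "Hinf (pd i (v \<sigma>))" using Hinf_pdl[OF v, of "[i]"] by simp
    fix k assume k: "k \<le> CARD('n) div 2 + 1"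
    have "gsq k (pd i (v \<sigma>)) \<le> Usq \<tau> k \<psi> v w \<sigma>"
      unfolding Usq_def using gsq_pd_le[of k i "v \<sigma>"] by (intro order_trans[OF gsq_pd_le]) (simp add: gsq_nonneg)
    then show "(1 + \<sigma>) powr (CARD('n) / 4 + k / 2) * sqrt (gsq k (pd i (v \<sigma>))) \<le> m"
      by (rule dU[OF k])
  qed
  then show "\<bar>pd i (v \<sigma>) x\<bar> \<le> S" using S1S by linarith
  define P where "P = (\<lambda>x. \<psi> \<sigma> x + \<tau> * v \<sigma> x)"
  have P: "P = (\<lambda>x. 1 * \<psi> \<sigma> x + \<tau> * v \<sigma> x)" by (simp add: P_def)
  have vv: "smooth_fun (v \<sigma>)" "sq_int_from 1 (v \<sigma>)" using v by (auto simp: Hinf_iff sq_int_from_def)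
  have sP: "smooth_fun P" "sq_int_from 1 P"
    unfolding P by (intro smooth_fun_lincomb sq_int_from_lincomb \<psi> vv)+
  have pP: "\<bar>pd i P x\<bar> \<le> S1"
  proof (rule sup)
    show "Hinf (pd i P)" using Hinf_pdl_from[OF sP, of "[i]"] by simp
    fix k assume k: "k \<le> CARD('n) div 2 + 1"
    have "gsq k (pd i P) \<le> Usq \<tau> k \<psi> v w \<sigma>"
      unfolding Usq_def P_def[symmetric] by (intro order_trans[OF gsq_pd_le]) (simp add: gsq_nonneg)
    then show "(1 + \<sigma>) powr (CARD('n) / 4 + k / 2) * sqrt (gsq k (pd i P)) \<le> m"
      by (rule dU[OF k])
  qed
  have "pdl [i] P x = 1 * pdl [i] (\<psi> \<sigma>) x + \<tau> * pdl [i] (v \<sigma>) x"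
    unfolding P by (simp only: pdl_lincomb[OF smooth_fun_imp_all_partials[OF \<psi>(1)] smooth_fun_imp_all_partials[OF vv(1)]])
  then have "pd i (\<psi> \<sigma>) x = pd i P x - \<tau> * pd i (v \<sigma>) x" by simp
  moreover have "\<bar>\<tau> * pd i (v \<sigma>) x\<bar> \<le> \<tau> * S1"
    using pv \<tau> by (simp add: abs_mult)
  ultimately show "\<bar>pd i (\<psi> \<sigma>) x\<bar> \<le> S" using pP S by linarith
qed

lemma Rfun_le_dominated:
  assumes \<kappa>: "\<kappa> \<ge> 1" and \<tau>: "\<tau> > 0" and n: "CARD('n::finite) \<ge> 2" and s0: "s0 \<ge> CARD('n) div 2 + 2"
  shows "\<exists>C>0. \<forall>(\<psi> :: real \<Rightarrow> real^'n \<Rightarrow> real) v w \<sigma> m.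
    smooth_fun (\<psi> \<sigma>) \<longrightarrow> sq_int_from 1 (\<psi> \<sigma>) \<longrightarrow> Hinf (v \<sigma>) \<longrightarrow> Hinf (w \<sigma>) \<longrightarrow> \<sigma> \<ge> 0 \<longrightarrow>
    decay_dominated \<tau> s0 \<psi> v w \<sigma> m \<longrightarrow>
    Rfun \<tau> k \<kappa> \<psi> v w \<sigma> \<le> C * m / (1 + \<sigma>) * (energy_part \<kappa> (\<psi> \<sigma>) (v \<sigma>) (w \<sigma>) + gsq \<kappa> (v \<sigma>))"
proof -
  obtain C where C: "C > 0" "\<forall>(\<psi> :: real \<Rightarrow> real^'n::finite \<Rightarrow> real) v w t S.
    smooth_fun (\<psi> t) \<longrightarrow> sq_int_from 1 (\<psi> t) \<longrightarrow> Hinf (v t) \<longrightarrow> Hinf (w t) \<longrightarrow> S > 0 \<longrightarrow>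
    (\<forall>x. \<bar>v t x\<bar> \<le> S) \<longrightarrow> (\<forall>x. \<bar>w t x\<bar> \<le> S) \<longrightarrow> (\<forall>i x. \<bar>pd i (\<psi> t) x\<bar> \<le> S) \<longrightarrow> (\<forall>i x. \<bar>pd i (v t) x\<bar> \<le> S) \<longrightarrow>
    Rfun \<tau> k \<kappa> \<psi> v w t \<le> C * S * (energy_part \<kappa> (\<psi> t) (v t) (w t) + gsq \<kappa> (v t))"
    using Rfun_le[OF \<kappa> \<tau>, where 'n = 'n] by blast
  define C' where "C' = C * ((1 + \<tau>) * sup_const CARD('n))"
  have sc: "(1 + \<tau>) * sup_const CARD('n) > 0" using \<tau> by (simp add: sup_const_def add_pos_nonneg)
  have C'0: "C' > 0" using C(1) sc by (simp add: C'_def)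
  have "Rfun \<tau> k \<kappa> \<psi> v w \<sigma> \<le> C' * m / (1 + \<sigma>) * (energy_part \<kappa> (\<psi> \<sigma>) (v \<sigma>) (w \<sigma>) + gsq \<kappa> (v \<sigma>))"
    if \<psi>: "smooth_fun (\<psi> \<sigma>)" "sq_int_from 1 (\<psi> \<sigma>)" and v: "Hinf (v \<sigma>)" and w: "Hinf (w \<sigma>)" and \<sigma>: "\<sigma> \<ge> 0"
      and dom: "decay_dominated \<tau> s0 \<psi> v w \<sigma> m"
    for \<psi> v w :: "real \<Rightarrow> real^'n \<Rightarrow> real" and \<sigma> m
  proof -
    define B where "B = energy_part \<kappa> (\<psi> \<sigma>) (v \<sigma>) (w \<sigma>) + gsq \<kappa> (v \<sigma>)"
    have B0: "B \<ge> 0" by (simp add: B_def energy_part_nonneg gsq_nonneg)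
    have pos: "Rfun \<tau> k \<kappa> \<psi> v w \<sigma> \<le> C' * m' / (1 + \<sigma>) * B" if m': "m' > m" for m'
    proof -
      have m'0: "m' > 0" using decay_dominated_nonneg[OF dom] m' by linarith
      have dom': "decay_dominated \<tau> s0 \<psi> v w \<sigma> m'" using decay_dominated_mono[OF dom] m' by simp
      define S where "S = (1 + \<tau>) * sup_const CARD('n) * (m' / (1 + \<sigma>))"
      have S: "S > 0" using mult_pos_pos[OF sc divide_pos_pos[OF m'0, of "1 + \<sigma>"]] \<sigma> by (simp add: S_def)
      have "Rfun \<tau> k \<kappa> \<psi> v w \<sigma> \<le> C * S * B"
        unfolding B_def
        by (intro C(2)[rule_format] \<psi> v w S) (unfold S_def, (rule sup_bounds[OF n \<tau> s0 \<sigma> \<psi> v w dom'])+)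
      then show ?thesis by (simp add: S_def C'_def mult_ac)
    qed
    have "Rfun \<tau> k \<kappa> \<psi> v w \<sigma> \<le> C' * m / (1 + \<sigma>) * B"
    proof (rule tendsto_lowerbound)
      show "((\<lambda>m'. C' * m' / (1 + \<sigma>) * B) \<longlongrightarrow> C' * m / (1 + \<sigma>) * B) (at_right m)"
        using \<sigma> by (intro tendsto_intros) auto
      show "\<forall>\<^sub>F m' in at_right m. Rfun \<tau> k \<kappa> \<psi> v w \<sigma> \<le> C' * m' / (1 + \<sigma>) * B"
        using pos by (auto simp: eventually_at_filter)
    qed simp
    then show ?thesis by (simp add: B_def)
  qed
  then show ?thesis using C'0 by blast
qed

section \<open>Integration in time\<close>


lemma smooth_solution_regular:
  assumes sol: "smooth_solution c b k \<tau> g T \<psi> v w \<eta>" and t: "t \<in> {0..T}"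
  shows "smooth_fun (\<psi> t)" "sq_int_from 1 (\<psi> t)" "Hinf (v t)" "Hinf (w t)"
proof -
  have slice: "continuous_on UNIV (\<lambda>x. F t x)"
    if "continuous_on ({0..T} \<times> UNIV) (\<lambda>(t, x). F t x)" for F :: "real \<Rightarrow> real^'a \<Rightarrow> real"
  proof -
    have "continuous_on UNIV (\<lambda>x. case (t, x) of (t, x) \<Rightarrow> F t x)"
      by (rule continuous_on_compose2[OF that]) (use t in \<open>auto intro!: continuous_intros\<close>)
    then show ?thesis by simp
  qed
  have "\<forall>\<alpha>. continuous_on ({0..T} \<times> UNIV) (\<lambda>(t, x). pdl \<alpha> (\<psi> t) x)"
    "\<forall>\<alpha>. continuous_on ({0..T} \<times> UNIV) (\<lambda>(t, x). pdl \<alpha> (v t) x)"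
    "\<forall>\<alpha>. continuous_on ({0..T} \<times> UNIV) (\<lambda>(t, x). pdl \<alpha> (w t) x)"
    using sol unfolding smooth_solution_def by blast+
  then have c: "\<forall>\<alpha>. continuous_on UNIV (pdl \<alpha> (\<psi> t))" "\<forall>\<alpha>. continuous_on UNIV (pdl \<alpha> (v t))"
    "\<forall>\<alpha>. continuous_on UNIV (pdl \<alpha> (w t))"
    using slice[of "\<lambda>t. pdl _ (\<psi> t)"] slice[of "\<lambda>t. pdl _ (v t)"] slice[of "\<lambda>t. pdl _ (w t)"] by auto
  have "all_partials (\<psi> t) \<and> all_partials (v t) \<and> all_partials (w t)
      \<and> sq_int_from 1 (\<psi> t) \<and> sq_int_from 0 (v t) \<and> sq_int_from 0 (w t)"
    using sol t unfolding smooth_solution_def by blast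
  with c show "smooth_fun (\<psi> t)" "sq_int_from 1 (\<psi> t)" "Hinf (v t)" "Hinf (w t)"
    by (simp_all add: Hinf_iff smooth_fun_def)
qed

lemma gsq_time_measurable:
  fixes u :: "real \<Rightarrow> real^'n::finite \<Rightarrow> real"
  assumes cont: "\<And>\<alpha>. continuous_on ({0..T} \<times> UNIV) (\<lambda>(t, x). pdl \<alpha> (u t) x)" and t: "t \<le> T"
  shows "(\<lambda>\<sigma>. indicator {0..t} \<sigma> * gsq l (u \<sigma>)) \<in> borel_measurable borel"
proof -
  have m: "(\<lambda>\<sigma>. indicator {0..t} \<sigma> * Lsq (pdl \<alpha> (u \<sigma>))) \<in> borel_measurable borel" for \<alpha>
  proof -
    have "(\<lambda>p. indicator ({0..T} \<times> UNIV) p *\<^sub>R (case p of (t, x) \<Rightarrow> pdl \<alpha> (u t) x)) \<in> borel_measurable (borel :: (real \<times> (real^'n)) measure)"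
      by (rule borel_measurable_continuous_on_indicator[OF _ cont]) (auto intro!: borel_closed closed_Times)
    then have [measurable]: "(\<lambda>p. indicator ({0..T} \<times> UNIV) p *\<^sub>R (case p of (t, x) \<Rightarrow> pdl \<alpha> (u t) x)) \<in> borel_measurable (borel \<Otimes>\<^sub>M (lborel :: (real^'n) measure))"
      by (simp add: borel_prod[symmetric] cong: measurable_cong_sets)
    have "(\<lambda>\<sigma>. LINT x|lborel. (indicator ({0..T} \<times> UNIV) (\<sigma>, x :: real^'n) *\<^sub>R (case (\<sigma>, x) of (t, x) \<Rightarrow> pdl \<alpha> (u t) x))\<^sup>2) \<in> borel_measurable borel"
      by measurable
    then have "(\<lambda>\<sigma>. indicator {0..t} \<sigma> * (LINT x|lborel. (indicator ({0..T} \<times> UNIV) (\<sigma>, x :: real^'n) *\<^sub>R pdl \<alpha> (u \<sigma>) x)\<^sup>2)) \<in> borel_measurable borel"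
      by simp
    also have "(\<lambda>\<sigma>. indicator {0..t} \<sigma> * (LINT x|lborel. (indicator ({0..T} \<times> UNIV) (\<sigma>, x :: real^'n) *\<^sub>R pdl \<alpha> (u \<sigma>) x)\<^sup>2)) =
        (\<lambda>\<sigma>. indicator {0..t} \<sigma> * Lsq (pdl \<alpha> (u \<sigma>)))"
      using t by (auto simp: fun_eq_iff Lsq_def indicator_def)
    finally show ?thesis .
  qed
  show ?thesis
    unfolding gsq_def sum_distrib_left by (intro borel_measurable_sum m)
qed

lemma lapsq_nonneg: "lapsq l k f \<ge> 0"
  by (simp add: lapsq_def sum_nonneg gsq_nonneg)

lemma energy_part_le_Efun:
  assumes \<tau>: "\<tau> > 0" and \<kappa>: "\<kappa> \<ge> 1"
    and \<psi>: "smooth_fun (\<psi> t)" "sq_int_from 1 (\<psi> t)" and v: "Hinf (v t)" and w: "Hinf (w t)"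
  shows "ennreal (energy_part \<kappa> (\<psi> t) (v t) (w t)) \<le> ennreal (2 + 2 / \<tau>\<^sup>2 + 2 * \<tau>\<^sup>2) * Efun \<tau> g1 \<kappa> \<psi> v w \<eta> t"
proof -
  define P Q where "P = (\<lambda>x. \<psi> t x + \<tau> * v t x)" and "Q = (\<lambda>x. v t x + \<tau> * w t x)"
  have PQ: "P = (\<lambda>x. 1 * \<psi> t x + \<tau> * v t x)" "Q = (\<lambda>x. 1 * v t x + \<tau> * w t x)"
    by (simp_all add: P_def Q_def)
  have vv: "smooth_fun (v t)" "sq_int_from 1 (v t)" and ww: "smooth_fun (w t)" "sq_int_from 1 (w t)"
    using v w by (auto simp: Hinf_iff sq_int_from_def)
  have sP: "smooth_fun P" "sq_int_from 1 P" and sQ: "smooth_fun Q" "sq_int_from 1 Q"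
    unfolding PQ by (intro smooth_fun_lincomb sq_int_from_lincomb \<psi> vv ww)+
  have \<psi>': "\<psi> t = (\<lambda>x. 1 * P x + (- \<tau>) * v t x)" by (simp add: P_def)
  have w': "w t = (\<lambda>x. (1 / \<tau>) * Q x + (- (1 / \<tau>)) * v t x)" using \<tau> by (simp add: Q_def field_simps)
  have \<psi>le: "gsq l (\<psi> t) \<le> 2 * gsq l P + 2 * \<tau>\<^sup>2 * gsq l (v t)" if "l \<ge> 1" for l
    using gsq_lincomb_le[OF sP vv that, of 1 "- \<tau>"] unfolding \<psi>'[symmetric] by simp
  have wle: "gsq l (w t) \<le> 2 / \<tau>\<^sup>2 * gsq l Q + 2 / \<tau>\<^sup>2 * gsq l (v t)" if "l \<ge> 1" for l
    using gsq_lincomb_le[OF sQ vv that, of "1 / \<tau>" "- (1 / \<tau>)"] unfolding w'[symmetric] by (simp add: power_divide)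
  define e where "e = gsq (\<kappa>+1) P + gsq (\<kappa>+1) (v t) + (lapsq 0 \<kappa> P + lapsq 1 \<kappa> P)
      + (gsq (\<kappa>+1) Q + gsq (\<kappa>+2) Q) + (lapsq 0 \<kappa> (v t) + lapsq 1 \<kappa> (v t)) + gsq \<kappa> (w t)"
  define K where "K = 2 + 2 / \<tau>\<^sup>2 + 2 * \<tau>\<^sup>2"
  note lap = gsq_eq_lapsq_0[OF sP \<kappa>, symmetric] gsq_eq_lapsq_1[OF sP \<kappa>, symmetric]
    gsq_eq_lapsq_0[OF vv \<kappa>, symmetric] gsq_eq_lapsq_1[OF vv \<kappa>, symmetric]
  have e_eq: "e = gsq (\<kappa>+1) P + gsq (\<kappa>+2) P + gsq (\<kappa>+3) P + gsq (\<kappa>+1) (v t) + gsq (\<kappa>+2) (v t) + gsq (\<kappa>+3) (v t)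
      + gsq (\<kappa>+1) Q + gsq (\<kappa>+2) Q + gsq \<kappa> (w t)"
    unfolding e_def lap by simp
  have nn: "gsq l f \<ge> 0" for l and f :: "real^'a \<Rightarrow> real" by (rule gsq_nonneg)
  have "energy_part \<kappa> (\<psi> t) (v t) (w t) \<le>
      2 * (gsq (\<kappa>+1) P + gsq (\<kappa>+2) P + gsq (\<kappa>+3) P)
      + (1 + 2 / \<tau>\<^sup>2 + 2 * \<tau>\<^sup>2) * (gsq (\<kappa>+1) (v t) + gsq (\<kappa>+2) (v t) + gsq (\<kappa>+3) (v t))
      + 2 / \<tau>\<^sup>2 * (gsq (\<kappa>+1) Q + gsq (\<kappa>+2) Q) + 1 * gsq \<kappa> (w t)"
  proof -
    have "0 \<le> 2 / \<tau>\<^sup>2 * gsq (\<kappa>+3) (v t)" by (simp add: nn)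
    then show ?thesis
      using \<psi>le[of "\<kappa>+1"] \<psi>le[of "\<kappa>+2"] \<psi>le[of "\<kappa>+3"] wle[of "\<kappa>+1"] wle[of "\<kappa>+2"]
      unfolding energy_part_def by (simp add: algebra_simps)
  qed
  also have "\<dots> \<le> K * (gsq (\<kappa>+1) P + gsq (\<kappa>+2) P + gsq (\<kappa>+3) P)
      + K * (gsq (\<kappa>+1) (v t) + gsq (\<kappa>+2) (v t) + gsq (\<kappa>+3) (v t))
      + K * (gsq (\<kappa>+1) Q + gsq (\<kappa>+2) Q) + K * gsq \<kappa> (w t)"
    by (intro add_mono mult_right_mono) (auto simp: K_def nn)
  also have "\<dots> = K * e" by (simp add: e_eq algebra_simps)
  finally have "ennreal (energy_part \<kappa> (\<psi> t) (v t) (w t)) \<le> ennreal (K * e)"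
    by (rule ennreal_leI)
  also have "\<dots> = ennreal K * ennreal e"
    by (rule ennreal_mult) (auto simp: K_def e_eq nn)
  also have "ennreal e \<le> Efun \<tau> g1 \<kappa> \<psi> v w \<eta> t"
  proof -
    have e1: "ennreal e = ennreal (gsq (\<kappa>+1) P) + 0 + ennreal (gsq (\<kappa>+1) (v t)) + 0 + 0 + ennreal (lapsq 0 \<kappa> P + lapsq 1 \<kappa> P)
      + ennreal (gsq (\<kappa>+1) Q + gsq (\<kappa>+2) Q) + ennreal (lapsq 0 \<kappa> (v t) + lapsq 1 \<kappa> (v t)) + ennreal (gsq \<kappa> (w t))"
      unfolding e_def by (simp add: ennreal_plus[symmetric] nn lapsq_nonneg del: ennreal_plus)
    show ?thesis
      unfolding Efun_def Let_def P_def[symmetric] Q_def[symmetric] e1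
      by (intro add_mono order_refl zero_le)
  qed
  finally show ?thesis by (simp add: K_def mult_left_mono)
qed

lemma gsq_le_Dfun:
  assumes "\<kappa> \<ge> 1"
  shows "ennreal (gsq \<kappa> (v t)) \<le> Dfun \<tau> g1 (\<kappa> - 1) \<psi> v w \<eta> t"
  using assms unfolding Dfun_def Let_def by (simp add: add_increasing add_increasing2)

lemma weighted_integral_bound:
  fixes R b :: "real \<Rightarrow> real" and M :: ennreal
  assumes meas: "(\<lambda>\<sigma>. indicator {0..t} \<sigma> * b \<sigma>) \<in> borel_measurable borel" and b: "\<And>\<sigma>. b \<sigma> \<ge> 0" and C: "C > 0"
    and pw: "\<And>\<sigma> m. \<sigma> \<in> {0..t} \<Longrightarrow> D \<sigma> m \<Longrightarrow> R \<sigma> \<le> C * m / (1 + \<sigma>) * b \<sigma>"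
    and ex: "\<And>\<sigma>. \<sigma> \<in> {0..t} \<Longrightarrow> \<exists>m. D \<sigma> m"
    and fin: "\<And>\<sigma>. M < \<infinity> \<Longrightarrow> \<sigma> \<in> {0..t} \<Longrightarrow> D \<sigma> (enn2real M)"
  shows "(\<integral>\<^sup>+ \<sigma>\<in>{0..t}. ennreal ((1+\<sigma>) powr (a - 1/2) * R \<sigma>) \<partial>lborel)
    \<le> ennreal C * M * (\<integral>\<^sup>+ \<sigma>\<in>{0..t}. ennreal ((1+\<sigma>) powr (a - 3/2) * b \<sigma>) \<partial>lborel)"
proof -
  let ?J = "\<integral>\<^sup>+ \<sigma>\<in>{0..t}. ennreal ((1+\<sigma>) powr (a - 3/2) * b \<sigma>) \<partial>lborel"
  have "(\<lambda>\<sigma>. ennreal ((1+\<sigma>) powr (a - 3/2) * (indicator {0..t} \<sigma> * b \<sigma>))) \<in> borel_measurable borel"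
    using meas by measurable
  also have "(\<lambda>\<sigma>. ennreal ((1+\<sigma>) powr (a - 3/2) * (indicator {0..t} \<sigma> * b \<sigma>))) =
      (\<lambda>\<sigma>. ennreal ((1+\<sigma>) powr (a - 3/2) * b \<sigma>) * indicator {0..t} \<sigma>)"
    by (auto simp: fun_eq_iff indicator_def)
  finally have mJ: "(\<lambda>\<sigma>. ennreal ((1+\<sigma>) powr (a - 3/2) * b \<sigma>) * indicator {0..t} \<sigma>) \<in> borel_measurable lborel"
    by simp
  show ?thesis
  proof (cases "M < \<infinity>")
    case True
    define m where "m = enn2real M"
    have Mm: "M = ennreal m" using True by (simp add: m_def)
    have m0: "m \<ge> 0" by (simp add: m_def)
    have "(\<integral>\<^sup>+ \<sigma>\<in>{0..t}. ennreal ((1+\<sigma>) powr (a - 1/2) * R \<sigma>) \<partial>lborel) \<le>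
        (\<integral>\<^sup>+ \<sigma>. ennreal (C * m) * (ennreal ((1+\<sigma>) powr (a - 3/2) * b \<sigma>) * indicator {0..t} \<sigma>) \<partial>lborel)"
    proof (rule nn_integral_mono)
      fix \<sigma> :: real
      show "ennreal ((1+\<sigma>) powr (a - 1/2) * R \<sigma>) * indicator {0..t} \<sigma> \<le>
          ennreal (C * m) * (ennreal ((1+\<sigma>) powr (a - 3/2) * b \<sigma>) * indicator {0..t} \<sigma>)"
      proof (cases "\<sigma> \<in> {0..t}")
        case s: True
        then have s0: "1 + \<sigma> > 0" by auto
        have "(1+\<sigma>) powr (a - 1/2) * R \<sigma> \<le> (1+\<sigma>) powr (a - 1/2) * (C * m / (1 + \<sigma>) * b \<sigma>)"
          using pw[OF s fin[OF True s]] by (intro mult_left_mono) (auto simp: m_def)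
        also have "(1+\<sigma>) powr (a - 1/2) * (C * m / (1 + \<sigma>) * b \<sigma>) = (C * m) * ((1+\<sigma>) powr (a - 3/2) * b \<sigma>)"
        proof -
          have "(1+\<sigma>) powr (a - 1/2) = (1+\<sigma>) powr (a - 3/2) * (1 + \<sigma>)"
            using s0 powr_add[of "1 + \<sigma>" "a - 3/2" 1] by simp
          then show ?thesis using s0 by simp
        qed
        finally have "ennreal ((1+\<sigma>) powr (a - 1/2) * R \<sigma>) \<le> ennreal ((C * m) * ((1+\<sigma>) powr (a - 3/2) * b \<sigma>))"
          by (rule ennreal_leI)
        also have "\<dots> = ennreal (C * m) * ennreal ((1+\<sigma>) powr (a - 3/2) * b \<sigma>)"
          using C m0 b by (intro ennreal_mult) auto
        finally show ?thesis using s by simp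
      qed simp
    qed
    also have "\<dots> = ennreal (C * m) * ?J"
      by (rule nn_integral_cmult[OF mJ])
    also have "ennreal (C * m) = ennreal C * M"
      using C m0 by (simp add: Mm ennreal_mult)
    finally show ?thesis .
  next
    case False
    then have M: "M = \<infinity>" by (simp add: not_less top.extremum_unique)
    show ?thesis
    proof (cases "?J = 0")
      case J: True
      then have "AE \<sigma> in lborel. ennreal ((1+\<sigma>) powr (a - 3/2) * b \<sigma>) * indicator {0..t} \<sigma> = 0"
        using nn_integral_0_iff_AE[OF mJ] by simp
      then have "AE \<sigma> in lborel. ennreal ((1+\<sigma>) powr (a - 1/2) * R \<sigma>) * indicator {0..t} \<sigma> = 0"
      proof (rule AE_mp, intro AE_I2 impI)
        fix \<sigma> :: real
        assume z: "ennreal ((1+\<sigma>) powr (a - 3/2) * b \<sigma>) * indicator {0..t} \<sigma> = 0"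
        show "ennreal ((1+\<sigma>) powr (a - 1/2) * R \<sigma>) * indicator {0..t} \<sigma> = 0"
        proof (cases "\<sigma> \<in> {0..t}")
          case s: True
          then have "(1+\<sigma>) powr (a - 3/2) * b \<sigma> \<le> 0" using z by (simp add: ennreal_eq_0_iff)
          moreover have "(1+\<sigma>) powr (a - 3/2) > 0" using s by simp
          ultimately have "b \<sigma> = 0" using b[of \<sigma>] by (simp add: mult_le_0_iff)
          then have "R \<sigma> \<le> 0" using ex[OF s] pw[OF s] by fastforce
          then have "(1+\<sigma>) powr (a - 1/2) * R \<sigma> \<le> 0" by (simp add: mult_nonneg_nonpos)
          then show ?thesis by (simp add: ennreal_neg)
        qed simp
      qed
      then have "(\<integral>\<^sup>+ \<sigma>\<in>{0..t}. ennreal ((1+\<sigma>) powr (a - 1/2) * R \<sigma>) \<partial>lborel) = (\<integral>\<^sup>+ (\<sigma>::real). 0 \<partial>lborel)"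
        by (rule nn_integral_cong_AE)
      then show ?thesis by simp
    next
      case False
      then have "ennreal C * M * ?J = \<infinity>"
        using C M by (simp add: ennreal_mult_top ennreal_top_mult ennreal_mult_eq_top_iff)
      then show ?thesis by simp
    qed
  qed
qed

theorem theorem7p3:
  fixes c b k \<tau> \<zeta> :: real and g g1 :: "real \<Rightarrow> real" and s :: int and \<kappa> j :: nat
  assumes "CARD('n::finite) \<ge> 3"
    and "\<tau> > 0" and "c > 0" and "b > 0"
    and "kernel_ok c \<zeta> g g1"
    and "\<lfloor>(2 * real_of_int s - real CARD('n)) / 4\<rfloor> \<ge> int (CARD('n) div 2) + 2"
    and "\<kappa> \<ge> 1"
  shows "\<exists>C>0. \<forall>T (\<psi> :: real \<Rightarrow> real^'n \<Rightarrow> real) v w \<eta> t.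
     smooth_solution c b k \<tau> g T \<psi> v w \<eta> \<longrightarrow> t \<in> {0..T} \<longrightarrow>
       (\<integral>\<^sup>+ \<sigma>\<in>{0..t}. ennreal ((1+\<sigma>) powr (real j - 1/2) * Rfun \<tau> k \<kappa> \<psi> v w \<sigma>) \<partial>lborel)
       \<le> ennreal C * Mfun \<tau> (nat \<lfloor>(2 * real_of_int s - real CARD('n)) / 4\<rfloor>) \<psi> v w t
         * ((\<integral>\<^sup>+ \<sigma>\<in>{0..t}. ennreal ((1+\<sigma>) powr (real j - 3/2)) * Efun \<tau> g1 \<kappa> \<psi> v w \<eta> \<sigma> \<partial>lborel)
          + (\<integral>\<^sup>+ \<sigma>\<in>{0..t}. ennreal ((1+\<sigma>) powr (real j - 1/2)) * Dfun \<tau> g1 \<kappa> \<psi> v w \<eta> \<sigma> \<partial>lborel)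
          + (\<integral>\<^sup>+ \<sigma>\<in>{0..t}. ennreal ((1+\<sigma>) powr (real j - 3/2)) * Dfun \<tau> g1 (\<kappa> - 1) \<psi> v w \<eta> \<sigma> \<partial>lborel))"
proof -
  define s0 where "s0 = nat \<lfloor>(2 * real_of_int s - real CARD('n)) / 4\<rfloor>"
  have s0: "s0 \<ge> CARD('n) div 2 + 2" using assms(6) unfolding s0_def by linarith
  have n: "CARD('n) \<ge> 2" using assms(1) by simp
  obtain C where C: "C > 0" "\<forall>(\<psi> :: real \<Rightarrow> real^'n \<Rightarrow> real) v w \<sigma> m.
    smooth_fun (\<psi> \<sigma>) \<longrightarrow> sq_int_from 1 (\<psi> \<sigma>) \<longrightarrow> Hinf (v \<sigma>) \<longrightarrow> Hinf (w \<sigma>) \<longrightarrow> \<sigma> \<ge> 0 \<longrightarrow>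
    decay_dominated \<tau> s0 \<psi> v w \<sigma> m \<longrightarrow>
    Rfun \<tau> k \<kappa> \<psi> v w \<sigma> \<le> C * m / (1 + \<sigma>) * (energy_part \<kappa> (\<psi> \<sigma>) (v \<sigma>) (w \<sigma>) + gsq \<kappa> (v \<sigma>))"
    using Rfun_le_dominated[OF assms(7) assms(2) n s0] by blast
  define K where "K = 2 + 2 / \<tau>\<^sup>2 + 2 * \<tau>\<^sup>2"
  have K1: "K \<ge> 1" by (simp add: K_def add_increasing2)
  have main: "(\<integral>\<^sup>+ \<sigma>\<in>{0..t}. ennreal ((1+\<sigma>) powr (real j - 1/2) * Rfun \<tau> k \<kappa> \<psi> v w \<sigma>) \<partial>lborel)
       \<le> ennreal (C * K) * Mfun \<tau> s0 \<psi> v w t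
         * ((\<integral>\<^sup>+ \<sigma>\<in>{0..t}. ennreal ((1+\<sigma>) powr (real j - 3/2)) * Efun \<tau> g1 \<kappa> \<psi> v w \<eta> \<sigma> \<partial>lborel)
          + (\<integral>\<^sup>+ \<sigma>\<in>{0..t}. ennreal ((1+\<sigma>) powr (real j - 1/2)) * Dfun \<tau> g1 \<kappa> \<psi> v w \<eta> \<sigma> \<partial>lborel)
          + (\<integral>\<^sup>+ \<sigma>\<in>{0..t}. ennreal ((1+\<sigma>) powr (real j - 3/2)) * Dfun \<tau> g1 (\<kappa> - 1) \<psi> v w \<eta> \<sigma> \<partial>lborel))"
    if sol: "smooth_solution c b k \<tau> g T \<psi> v w \<eta>" and t: "t \<in> {0..T}"
    for T t and \<psi> v w :: "real \<Rightarrow> real^'n \<Rightarrow> real" and \<eta>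
  proof -
    let ?lam = "\<lambda>\<sigma>::real. (1+\<sigma>) powr (real j - 3/2)"
    let ?IE = "\<integral>\<^sup>+ \<sigma>\<in>{0..t}. ennreal ((1+\<sigma>) powr (real j - 3/2)) * Efun \<tau> g1 \<kappa> \<psi> v w \<eta> \<sigma> \<partial>lborel"
    let ?ID = "\<integral>\<^sup>+ \<sigma>\<in>{0..t}. ennreal ((1+\<sigma>) powr (real j - 3/2)) * Dfun \<tau> g1 (\<kappa> - 1) \<psi> v w \<eta> \<sigma> \<partial>lborel"
    let ?I2 = "\<integral>\<^sup>+ \<sigma>\<in>{0..t}. ennreal ((1+\<sigma>) powr (real j - 1/2)) * Dfun \<tau> g1 \<kappa> \<psi> v w \<eta> \<sigma> \<partial>lborel"
    define be bd where "be = (\<lambda>\<sigma>. energy_part \<kappa> (\<psi> \<sigma>) (v \<sigma>) (w \<sigma>))" and "bd = (\<lambda>\<sigma>. gsq \<kappa> (v \<sigma>))"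
    have nn: "be \<sigma> \<ge> 0" "bd \<sigma> \<ge> 0" for \<sigma>
      by (simp_all add: be_def bd_def energy_part_nonneg gsq_nonneg)
    have tT: "t \<le> T" using t by simp
    have reg: "smooth_fun (\<psi> \<sigma>)" "sq_int_from 1 (\<psi> \<sigma>)" "Hinf (v \<sigma>)" "Hinf (w \<sigma>)" if "\<sigma> \<in> {0..t}" for \<sigma>
      using smooth_solution_regular[OF sol, of \<sigma>] that tT by auto
    have ms: "(\<lambda>\<sigma>. indicator {0..t} \<sigma> * gsq l (\<psi> \<sigma>)) \<in> borel_measurable borel"
      "(\<lambda>\<sigma>. indicator {0..t} \<sigma> * gsq l (v \<sigma>)) \<in> borel_measurable borel"
      "(\<lambda>\<sigma>. indicator {0..t} \<sigma> * gsq l (w \<sigma>)) \<in> borel_measurable borel" for l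
      by (rule gsq_time_measurable[OF _ tT], use sol in \<open>simp add: smooth_solution_def\<close>)+
    have mbe: "(\<lambda>\<sigma>. indicator {0..t} \<sigma> * be \<sigma>) \<in> borel_measurable borel"
      unfolding be_def energy_part_def distrib_left by (intro borel_measurable_add ms)
    have mbd: "(\<lambda>\<sigma>. indicator {0..t} \<sigma> * bd \<sigma>) \<in> borel_measurable borel"
      unfolding bd_def by (rule ms)
    have mb: "(\<lambda>\<sigma>. indicator {0..t} \<sigma> * (be \<sigma> + bd \<sigma>)) \<in> borel_measurable borel"
      unfolding distrib_left by (intro borel_measurable_add mbe mbd)
    have mw: "(\<lambda>\<sigma>. ennreal (?lam \<sigma> * f \<sigma>) * indicator {0..t} \<sigma>) \<in> borel_measurable lborel"
      if "(\<lambda>\<sigma>. indicator {0..t} \<sigma> * f \<sigma>) \<in> borel_measurable borel" for f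
    proof -
      have "(\<lambda>\<sigma>. ennreal (?lam \<sigma> * (indicator {0..t} \<sigma> * f \<sigma>))) \<in> borel_measurable borel"
        using that by measurable
      also have "(\<lambda>\<sigma>. ennreal (?lam \<sigma> * (indicator {0..t} \<sigma> * f \<sigma>))) = (\<lambda>\<sigma>. ennreal (?lam \<sigma> * f \<sigma>) * indicator {0..t} \<sigma>)"
        by (auto simp: fun_eq_iff indicator_def)
      finally show ?thesis by simp
    qed
    have "(\<integral>\<^sup>+ \<sigma>\<in>{0..t}. ennreal (?lam \<sigma> * (be \<sigma> + bd \<sigma>)) \<partial>lborel) =
        (\<integral>\<^sup>+ \<sigma>. ennreal (?lam \<sigma> * be \<sigma>) * indicator {0..t} \<sigma> + ennreal (?lam \<sigma> * bd \<sigma>) * indicator {0..t} \<sigma> \<partial>lborel)"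
      by (intro nn_integral_cong)
        (auto simp: indicator_def distrib_left nn ennreal_plus)
    also have "\<dots> = (\<integral>\<^sup>+ \<sigma>\<in>{0..t}. ennreal (?lam \<sigma> * be \<sigma>) \<partial>lborel) + (\<integral>\<^sup>+ \<sigma>\<in>{0..t}. ennreal (?lam \<sigma> * bd \<sigma>) \<partial>lborel)"
      by (intro nn_integral_add mw mbe mbd)
    finally have split: "(\<integral>\<^sup>+ \<sigma>\<in>{0..t}. ennreal (?lam \<sigma> * (be \<sigma> + bd \<sigma>)) \<partial>lborel) =
      (\<integral>\<^sup>+ \<sigma>\<in>{0..t}. ennreal (?lam \<sigma> * be \<sigma>) \<partial>lborel) + (\<integral>\<^sup>+ \<sigma>\<in>{0..t}. ennreal (?lam \<sigma> * bd \<sigma>) \<partial>lborel)" .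
    have IE: "(\<integral>\<^sup>+ \<sigma>\<in>{0..t}. ennreal (?lam \<sigma> * be \<sigma>) \<partial>lborel) \<le> ennreal K * ?IE"
    proof -
      have "(\<integral>\<^sup>+ \<sigma>\<in>{0..t}. ennreal (?lam \<sigma> * be \<sigma>) \<partial>lborel) =
          (\<integral>\<^sup>+ \<sigma>. ennreal K * (ennreal (?lam \<sigma> * (be \<sigma> / K)) * indicator {0..t} \<sigma>) \<partial>lborel)"
      proof (rule nn_integral_cong)
        fix \<sigma>
        have "?lam \<sigma> * be \<sigma> = K * (?lam \<sigma> * (be \<sigma> / K))" using K1 by simp
        then have "ennreal (?lam \<sigma> * be \<sigma>) = ennreal K * ennreal (?lam \<sigma> * (be \<sigma> / K))"
          using K1 nn by (metis ennreal_mult' order_trans zero_le_one)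
        then show "ennreal (?lam \<sigma> * be \<sigma>) * indicator {0..t} \<sigma> = ennreal K * (ennreal (?lam \<sigma> * (be \<sigma> / K)) * indicator {0..t} \<sigma>)"
          by (simp add: mult.assoc)
      qed
      also have "\<dots> = ennreal K * (\<integral>\<^sup>+ \<sigma>\<in>{0..t}. ennreal (?lam \<sigma> * (be \<sigma> / K)) \<partial>lborel)"
        by (intro nn_integral_cmult mw) (use mbe in \<open>simp add: borel_measurable_divide\<close>)
      also have "\<dots> \<le> ennreal K * ?IE"
      proof (intro mult_left_mono nn_integral_mono)
        fix \<sigma>
        show "ennreal (?lam \<sigma> * (be \<sigma> / K)) * indicator {0..t} \<sigma> \<le> ennreal (?lam \<sigma>) * Efun \<tau> g1 \<kappa> \<psi> v w \<eta> \<sigma> * indicator {0..t} \<sigma>"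
        proof (cases "\<sigma> \<in> {0..t}")
          case True
          have "ennreal (be \<sigma>) \<le> ennreal K * Efun \<tau> g1 \<kappa> \<psi> v w \<eta> \<sigma>"
            unfolding be_def K_def by (rule energy_part_le_Efun[where \<psi> = \<psi> and v = v and w = w and t = \<sigma>, OF assms(2,7) reg[OF True]])
          then have "ennreal (1 / K) * ennreal (be \<sigma>) \<le> ennreal (1 / K) * (ennreal K * Efun \<tau> g1 \<kappa> \<psi> v w \<eta> \<sigma>)"
            by (intro mult_left_mono) auto
          also have "\<dots> = Efun \<tau> g1 \<kappa> \<psi> v w \<eta> \<sigma>"
            using K1 by (simp add: mult.assoc[symmetric] ennreal_mult[symmetric])
          finally have "ennreal (be \<sigma> / K) \<le> Efun \<tau> g1 \<kappa> \<psi> v w \<eta> \<sigma>"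
            using K1 nn by (simp add: ennreal_mult[symmetric])
          moreover have "ennreal (?lam \<sigma> * (be \<sigma> / K)) = ennreal (?lam \<sigma>) * ennreal (be \<sigma> / K)"
            by (rule ennreal_mult) (use K1 nn in auto)
          ultimately show ?thesis
            by (simp only:) (intro mult_right_mono mult_left_mono, auto)
        qed simp
      qed simp
      finally show ?thesis .
    qed
    have ID: "(\<integral>\<^sup>+ \<sigma>\<in>{0..t}. ennreal (?lam \<sigma> * bd \<sigma>) \<partial>lborel) \<le> ?ID"
    proof (rule nn_integral_mono)
      fix \<sigma>
      show "ennreal (?lam \<sigma> * bd \<sigma>) * indicator {0..t} \<sigma> \<le> ennreal (?lam \<sigma>) * Dfun \<tau> g1 (\<kappa> - 1) \<psi> v w \<eta> \<sigma> * indicator {0..t} \<sigma>"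
      proof -
        have "ennreal (bd \<sigma>) \<le> Dfun \<tau> g1 (\<kappa> - 1) \<psi> v w \<eta> \<sigma>"
          unfolding bd_def by (rule gsq_le_Dfun[OF assms(7)])
        moreover have "ennreal (?lam \<sigma> * bd \<sigma>) = ennreal (?lam \<sigma>) * ennreal (bd \<sigma>)"
          by (rule ennreal_mult) (use nn in auto)
        ultimately show ?thesis
          by (simp only:) (intro mult_right_mono mult_left_mono, auto)
      qed
    qed
    have KI: "ennreal K * ?IE + ?ID \<le> ennreal K * (?IE + ?I2 + ?ID)"
    proof -
      have "1 * ?ID \<le> ennreal K * ?ID"
        using ennreal_leI[OF K1] by (intro mult_right_mono) auto
      then have "ennreal K * ?IE + ?ID \<le> ennreal K * ?IE + ennreal K * ?I2 + ennreal K * ?ID"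
        by (intro add_mono) (auto intro: add_increasing2)
      then show ?thesis by (simp add: distrib_left)
    qed
    have J: "(\<integral>\<^sup>+ \<sigma>\<in>{0..t}. ennreal (?lam \<sigma> * (be \<sigma> + bd \<sigma>)) \<partial>lborel) \<le> ennreal K * (?IE + ?I2 + ?ID)"
      unfolding split by (rule order_trans[OF add_mono[OF IE ID] KI])
    have "(\<integral>\<^sup>+ \<sigma>\<in>{0..t}. ennreal ((1+\<sigma>) powr (real j - 1/2) * Rfun \<tau> k \<kappa> \<psi> v w \<sigma>) \<partial>lborel)
      \<le> ennreal C * Mfun \<tau> s0 \<psi> v w t * (\<integral>\<^sup>+ \<sigma>\<in>{0..t}. ennreal (?lam \<sigma> * (be \<sigma> + bd \<sigma>)) \<partial>lborel)"
    proof (rule weighted_integral_bound[where D = "decay_dominated \<tau> s0 \<psi> v w", OF mb _ C(1)])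
      show "be \<sigma> + bd \<sigma> \<ge> 0" for \<sigma> using nn[of \<sigma>] by simp
      show "Rfun \<tau> k \<kappa> \<psi> v w \<sigma> \<le> C * m / (1 + \<sigma>) * (be \<sigma> + bd \<sigma>)"
        if "\<sigma> \<in> {0..t}" "decay_dominated \<tau> s0 \<psi> v w \<sigma> m" for \<sigma> m
        using C(2) reg[OF that(1)] that unfolding be_def bd_def by auto
    qed (use decay_dominated_exists decay_dominated_Mfun in blast)+
    also have "\<dots> \<le> ennreal C * Mfun \<tau> s0 \<psi> v w t * (ennreal K * (?IE + ?I2 + ?ID))"
      by (intro mult_left_mono J) simp
    also have "\<dots> = ennreal (C * K) * Mfun \<tau> s0 \<psi> v w t * (?IE + ?I2 + ?ID)"
      using C(1) K1 by (simp add: ennreal_mult mult_ac)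
    finally show ?thesis .
  qed
  show ?thesis
    unfolding s0_def[symmetric] using main C(1) K1 by (intro exI[of _ "C * K"]) auto
qed

end
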